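(* Let $C>0$, $\sigma>0$. Consider estimating $f:\mathbb{B}_1^d\to\mathbb{R}$ with $\mathrm{RTV}^2_{\mathbb{B}_1^d}(f)\le C$ from $y_n=f(\mathbf{x}_n)+\varepsilon_n$, $n=1,\dots,N$, where $\varepsilon_n$ are i.i.d. $\mathcal{N}(0,\sigma^2)$ and $\mathbf{x}_n$ are i.i.d. uniform on $\mathbb{B}_1^d$. Then \[ \inf_{\hat f}\sup_{\substack{f\in\mathrm{RBV}^2(\mathbb{B}_1^d)\\ \mathrm{RTV}^2_{\mathbb{B}_1^d}(f)\le C}}\mathbb{E}\|f-\hat f\|^2_{L^2(\mathbb{B}_1^d;\mathbb{P}_X)}\gtrsim_d\Big(\frac N{\sigma^2}\Big)^{-\frac{d+3}{2d+3}}, \] where the infimum is over all estimators (measurable functions of the data) and $\mathbb{P}_X$ is the uniform probability measure on $\mathbb{B}_1^d$.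
   Context: $\mathbb{B}_1^d$ is the closed Euclidean unit ball in $\mathbb{R}^d$. Radon transform: $\mathscr{R}f(\boldsymbol{\gamma},t)=\int_{\{\boldsymbol{\gamma}^\top\mathbf{x}=t\}}f\,\mathrm{d}s$, $(\boldsymbol\gamma,t)\in\mathbb{S}^{d-1}\times\mathbb{R}$; $\Lambda^{d-1}=(-\partial_t^2)^{(d-1)/2}$ (Riesz potentials); $\mathrm{RTV}^2(g)=c_d\|\partial_t^2\Lambda^{d-1}\mathscr{R}g\|_{\mathcal{M}(\mathbb{S}^{d-1}\times\mathbb{R})}$, $c_d^{-1}=2(2\pi)^{d-1}$, $\mathcal{M}$ the finite Radon measures with total variation norm (distributional sense). $\mathrm{RBV}^2(\mathbb{R}^d)$: functions of at most linear growth with finite $\mathrm{RTV}^2$. $\mathrm{RBV}^2(\mathbb{B}_1^d)=\{g|_{\mathbb{B}_1^d}:g\in\mathrm{RBV}^2(\mathbb{R}^d)\}$ and $\mathrm{RTV}^2_{\mathbb{B}_1^d}(f)=\inf\{\mathrm{RTV}^2(g): g|_{\mathbb{B}_1^d}=f\}$.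
   Formalization: The implied constant is allowed to depend on C as well as d (still uniform in σ and N), because a constant depending only on d is impossible: for C=(N/σ²)^{-1/2} affine least squares has risk of order σ²/N, below the claimed rate. *)

theory Defs
  imports "HOL-Probability.Probability"
begin

text \<open>Integral over the unit sphere w.r.t. (unnormalised) surface measure, via polar
  coordinates: integral over S of h equals d times the Lebesgue integral over the unit
  ball of h(y/|y|).\<close>
definition sph_int :: "('a::euclidean_space \<Rightarrow> real) \<Rightarrow> real" where
  "sph_int h = real DIM('a) * (\<integral>y\<in>ball (0::'a) 1. h (y /\<^sub>R norm y) \<partial>lborel)"

definition backproj :: "('a::euclidean_space \<Rightarrow> real \<Rightarrow> real) \<Rightarrow> 'a \<Rightarrow> real" where
  "backproj \<phi> x = sph_int (\<lambda>\<gamma>. \<phi> \<gamma> (\<gamma> \<bullet> x))"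

definition tderiv :: "nat \<Rightarrow> ('a \<Rightarrow> real \<Rightarrow> real) \<Rightarrow> 'a \<Rightarrow> real \<Rightarrow> real" where
  "tderiv k \<psi> \<gamma> t = (deriv ^^ k) (\<lambda>s. \<psi> \<gamma> s) t"

text \<open>Hilbert transform (principal value), Fourier multiplier -i sgn(omega).\<close>
definition hilbert :: "(real \<Rightarrow> real) \<Rightarrow> real \<Rightarrow> real" where
  "hilbert \<phi> t = Lim (at_right 0)
     (\<lambda>\<epsilon>. (1 / pi) * (\<integral>s\<in>{s. \<epsilon> < \<bar>s\<bar>}. \<phi> (t - s) / s \<partial>lborel))"

text \<open>The operator Lambda^(d-1) d_t^2 (Lambda = (-d_t^2)^(1/2) = H d_t), acting in t.
  For odd d it is (-1)^((d-1)/2) d_t^(d+1); for even d it is (-1)^((d-2)/2) H d_t^(d+1).\<close>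
definition Lop :: "('a::euclidean_space \<Rightarrow> real \<Rightarrow> real) \<Rightarrow> 'a \<Rightarrow> real \<Rightarrow> real" where
  "Lop \<psi> \<gamma> t =
     (if odd DIM('a) then (-1) ^ ((DIM('a) - 1) div 2) * tderiv (DIM('a) + 1) \<psi> \<gamma> t
      else (-1) ^ ((DIM('a) - 2) div 2) * hilbert (\<lambda>s. tderiv (DIM('a) + 1) \<psi> \<gamma> s) t)"

fun dirder :: "'b::real_normed_vector list \<Rightarrow> ('b \<Rightarrow> real) \<Rightarrow> 'b \<Rightarrow> real" where
  "dirder [] f = f"
| "dirder (v # vs) f = (\<lambda>z. frechet_derivative (dirder vs f) (at z) v)"

definition smooth_fun :: "('b::real_normed_vector \<Rightarrow> real) \<Rightarrow> bool" where
  "smooth_fun f \<longleftrightarrow> (\<forall>vs z. dirder vs f differentiable (at z))"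

definition schwartz_SR :: "('a::euclidean_space \<Rightarrow> real \<Rightarrow> real) \<Rightarrow> bool" where
  "schwartz_SR \<psi> \<longleftrightarrow>
     (\<exists>\<Psi> :: 'a \<times> real \<Rightarrow> real. smooth_fun \<Psi> \<and>
        (\<forall>\<gamma>\<in>sphere 0 1. \<forall>t. \<psi> \<gamma> t = \<Psi> (\<gamma>, t)) \<and>
        (\<forall>vs k. \<exists>B. \<forall>\<gamma>\<in>sphere 0 1. \<forall>t. \<bar>t\<bar> ^ k * \<bar>dirder vs \<Psi> (\<gamma>, t)\<bar> \<le> B))"

definition rtv_const :: "nat \<Rightarrow> real" where
  "rtv_const d = 1 / (2 * (2 * pi) ^ (d - 1))"

text \<open>RTV^2(g) = c_d * total variation norm of the distribution d_t^2 Lambda^(d-1) R g,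
  i.e. the supremum of its pairings with test functions of sup-norm at most 1; the pairing
  is <R g, Lambda^(d-1) d_t^2 psi> = integral of g * R*(Lambda^(d-1) d_t^2 psi).\<close>
definition RTV2 :: "('a::euclidean_space \<Rightarrow> real) \<Rightarrow> ereal" where
  "RTV2 g = ereal (rtv_const DIM('a)) *
     (SUP \<psi> \<in> {\<psi>. schwartz_SR \<psi> \<and> (\<forall>\<gamma>\<in>sphere 0 1. \<forall>t. \<bar>\<psi> \<gamma> t\<bar> \<le> 1)}.
        ereal (\<integral>x. g x * backproj (Lop \<psi>) x \<partial>lborel))"

definition RBV2 :: "('a::euclidean_space \<Rightarrow> real) \<Rightarrow> bool" where
  "RBV2 g \<longleftrightarrow> g \<in> borel_measurable borel \<and> (\<exists>K. \<forall>x. \<bar>g x\<bar> \<le> K * (1 + norm x)) \<and>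
               RTV2 g < \<infinity>"

definition RBV2_ball :: "('a::euclidean_space \<Rightarrow> real) \<Rightarrow> bool" where
  "RBV2_ball f \<longleftrightarrow> (\<exists>g. RBV2 g \<and> (\<forall>x\<in>cball 0 1. g x = f x))"

definition RTV2_ball :: "('a::euclidean_space \<Rightarrow> real) \<Rightarrow> ereal" where
  "RTV2_ball f = (INF g \<in> {g. RBV2 g \<and> (\<forall>x\<in>cball 0 1. g x = f x)}. RTV2 g)"

definition PX :: "'a::euclidean_space measure" where
  "PX = uniform_measure lborel (cball 0 1)"

definition noise :: "real \<Rightarrow> real measure" where
  "noise \<sigma> = density lborel (normal_density 0 \<sigma>)"

text \<open>Law of one observation (x, f x + eps); f only matters on the ball.\<close>
definition obs_law :: "('a::euclidean_space \<Rightarrow> real) \<Rightarrow> real \<Rightarrow> ('a \<times> real) measure" where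
  "obs_law f \<sigma> = distr (PX \<Otimes>\<^sub>M noise \<sigma>) (borel \<Otimes>\<^sub>M borel)
     (\<lambda>(x, e). (x, (if x \<in> cball 0 1 then f x else 0) + e))"

definition data_law :: "nat \<Rightarrow> ('a::euclidean_space \<Rightarrow> real) \<Rightarrow> real \<Rightarrow> (nat \<Rightarrow> 'a \<times> real) measure" where
  "data_law N f \<sigma> = PiM {..<N} (\<lambda>_. obs_law f \<sigma>)"

definition estimators :: "nat \<Rightarrow> ((nat \<Rightarrow> 'a::euclidean_space \<times> real) \<Rightarrow> 'a \<Rightarrow> real) set" where
  "estimators N = {fh. (\<lambda>p. fh (fst p) (snd p)) \<in>
       borel_measurable (PiM {..<N} (\<lambda>_. borel \<Otimes>\<^sub>M borel) \<Otimes>\<^sub>M borel)}"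

definition risk :: "nat \<Rightarrow> real \<Rightarrow> ((nat \<Rightarrow> 'a::euclidean_space \<times> real) \<Rightarrow> 'a \<Rightarrow> real) \<Rightarrow>
                    ('a \<Rightarrow> real) \<Rightarrow> ennreal" where
  "risk N \<sigma> fh f = (\<integral>\<^sup>+D. (\<integral>\<^sup>+x. ennreal ((f x - fh D x)\<^sup>2) \<partial>PX) \<partial>data_law N f \<sigma>)"

definition minimax_risk :: "'a::euclidean_space itself \<Rightarrow> nat \<Rightarrow> real \<Rightarrow> real \<Rightarrow> ennreal" where
  "minimax_risk _ N \<sigma> C =
     (INF fh \<in> (estimators N :: ((nat \<Rightarrow> 'a \<times> real) \<Rightarrow> 'a \<Rightarrow> real) set).
        SUP f \<in> {f :: 'a \<Rightarrow> real. RBV2_ball f \<and> RTV2_ball f \<le> ereal C}. risk N \<sigma> fh f)"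

end

theory Submission
  imports Defs
begin

text \<open>Take \<open>f = \<Sum>\<^sub>z \<epsilon>\<^sub>z a exp (- \<bar>x - z\<bar>\<^sup>2 / 2h\<^sup>2)\<close> with signs \<open>\<epsilon>\<^sub>z\<close> and \<open>z\<close> in a grid
  of mesh \<open>2h\<close>. Since every one-dimensional marginal of a Gaussian is Gaussian, the Radon-side
  density of \<open>f\<close> is \<open>F(\<gamma>, t) = c a h\<^sup>-\<^sup>2 \<Sum>\<^sub>z \<epsilon>\<^sub>z k((t - \<gamma> \<bullet> z) / h)\<close>, where \<open>k\<close> is the derivative of
  order \<open>d + 1\<close> of the one-dimensional Gaussian (its Hilbert transform if \<open>d\<close> is even) and is
  \<open>O(t\<^sup>-\<^sup>2)\<close>. Averaged over the signs, the cross terms in a weighted \<open>L\<^sup>2\<close> norm of \<open>F\<close> cancel, so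
  \<open>RTV\<^sup>2 f\<close> is of order \<open>a h\<^sup>-\<^sup>(\<^sup>d\<^sup>+\<^sup>3\<^sup>)\<^sup>/\<^sup>2\<close> for at least three quarters of the sign patterns. Assouad's
  argument restricted to these patterns, with \<open>h\<close> of order \<open>(N / \<sigma>\<^sup>2)\<^sup>-\<^sup>1\<^sup>/\<^sup>(\<^sup>2\<^sup>d\<^sup>+\<^sup>3\<^sup>)\<close>, gives the bound
  when \<open>N / \<sigma>\<^sup>2 \<ge> 1\<close>. For \<open>N / \<sigma>\<^sup>2 < 1\<close> a single very wide Gaussian of height of order \<open>\<sigma> / \<surd>N\<close>
  suffices because its \<open>RTV\<^sup>2\<close> tends to zero with growing width.\<close>

section \<open>Two-point lower bound for the regression model\<close>

definition ball_ext :: "('a::euclidean_space \<Rightarrow> real) \<Rightarrow> 'a \<Rightarrow> real" where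
  "ball_ext f x = (if x \<in> cball 0 1 then f x else 0)"

lemma ball_ext_measurable [measurable]:
  assumes [measurable]: "f \<in> borel_measurable borel"
  shows "ball_ext f \<in> borel_measurable borel"
  unfolding ball_ext_def by (intro measurable_If) (auto simp: pred_def intro!: borel_closed)

lemma sets_PX [simp, measurable_cong]: "sets (PX :: 'a::euclidean_space measure) = sets borel"
  by (simp add: PX_def)

lemma space_PX [simp]: "space (PX :: 'a::euclidean_space measure) = UNIV"
  by (simp add: PX_def)

lemma emeasure_cball_neq:
  "emeasure lborel (cball (0::'a::euclidean_space) 1) \<noteq> 0"
  "emeasure lborel (cball (0::'a::euclidean_space) 1) \<noteq> \<infinity>"
proof -
  have "measure lborel (ball (0::'a) 1) > 0"
    by (rule content_ball_pos) simp
  then have "emeasure lborel (ball (0::'a) 1) \<noteq> 0"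
    by (auto simp: measure_def)
  moreover have "emeasure lborel (ball (0::'a) 1) \<le> emeasure lborel (cball (0::'a) 1)"
    by (intro emeasure_mono) auto
  ultimately show "emeasure lborel (cball (0::'a::euclidean_space) 1) \<noteq> 0" by auto
  show "emeasure lborel (cball (0::'a::euclidean_space) 1) \<noteq> \<infinity>"
    using emeasure_lborel_cball_finite[of "0::'a" 1] by simp
qed

lemma prob_space_PX: "prob_space (PX :: 'a::euclidean_space measure)"
  unfolding PX_def using emeasure_cball_neq by (intro prob_space_uniform_measure) auto

lemma PiM_density_const:
  fixes p :: "'b \<Rightarrow> ennreal"
  assumes I: "finite I" and B: "sigma_finite_measure B" and p[measurable]: "p \<in> borel_measurable B"
    and P: "prob_space (density B p)"
  shows "PiM I (\<lambda>_. density B p) = density (PiM I (\<lambda>_. B)) (\<lambda>D. \<Prod>i\<in>I. p (D i))"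
proof -
  interpret P: product_sigma_finite "\<lambda>_. density B p"
    unfolding product_sigma_finite_def using P prob_space_imp_sigma_finite by blast
  interpret B: product_sigma_finite "\<lambda>_. B"
    unfolding product_sigma_finite_def using B by blast
  show ?thesis
  proof (rule sym, rule P.PiM_eqI[OF I])
    show "sets (density (Pi\<^sub>M I (\<lambda>_. B)) (\<lambda>D. \<Prod>i\<in>I. p (D i))) = sets (Pi\<^sub>M I (\<lambda>i. density B p))"
      by (auto intro!: sets_PiM_cong)
    fix A assume A: "\<And>i. i \<in> I \<Longrightarrow> A i \<in> sets (density B p)"
    have Am[measurable]: "A i \<in> sets B" if "i \<in> I" for i using A[OF that] by simp
    have Pm: "Pi\<^sub>E I A \<in> sets (Pi\<^sub>M I (\<lambda>_. B))"
      using Am I by (intro sets_PiM_I_finite) auto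
    have "emeasure (density (Pi\<^sub>M I (\<lambda>_. B)) (\<lambda>D. \<Prod>i\<in>I. p (D i))) (Pi\<^sub>E I A)
       = (\<integral>\<^sup>+D. (\<Prod>i\<in>I. p (D i)) * indicator (Pi\<^sub>E I A) D \<partial>Pi\<^sub>M I (\<lambda>_. B))"
      using Pm by (intro emeasure_density) auto
    also have "\<dots> = (\<integral>\<^sup>+D. (\<Prod>i\<in>I. p (D i) * indicator (A i) (D i)) \<partial>Pi\<^sub>M I (\<lambda>_. B))"
    proof (rule nn_integral_cong)
      fix D assume "D \<in> space (Pi\<^sub>M I (\<lambda>_. B))"
      then have D: "D \<in> extensional I" by (auto simp: space_PiM PiE_def)
      show "(\<Prod>i\<in>I. p (D i)) * indicator (Pi\<^sub>E I A) D = (\<Prod>i\<in>I. p (D i) * indicator (A i) (D i))"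
      proof (cases "D \<in> Pi\<^sub>E I A")
        case True
        then have "D i \<in> A i" if "i \<in> I" for i using that by auto
        with True show ?thesis by simp
      next
        case False
        with D obtain i where i: "i \<in> I" "D i \<notin> A i" by (auto simp: PiE_def Pi_def)
        then have "(\<Prod>i\<in>I. p (D i) * indicator (A i) (D i)) = 0"
          using I by (intro prod_zero) (auto intro!: bexI[of _ i])
        with False show ?thesis by simp
      qed
    qed
    also have "\<dots> = (\<Prod>i\<in>I. \<integral>\<^sup>+x. p x * indicator (A i) x \<partial>B)"
      by (rule B.product_nn_integral_prod) (use I Am in \<open>auto\<close>)
    also have "\<dots> = (\<Prod>i\<in>I. emeasure (density B p) (A i))"
      by (intro prod.cong refl emeasure_density[symmetric]) auto
    finally show "emeasure (density (Pi\<^sub>M I (\<lambda>_. B)) (\<lambda>D. \<Prod>i\<in>I. p (D i))) (Pi\<^sub>E I A) =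
      (\<Prod>i\<in>I. emeasure (density B p) (A i))" .
  qed
qed

definition obs_dens :: "('a::euclidean_space \<Rightarrow> real) \<Rightarrow> real \<Rightarrow> 'a \<times> real \<Rightarrow> real" where
  "obs_dens f \<sigma> z = normal_density (ball_ext f (fst z)) \<sigma> (snd z)"

lemma obs_dens_nonneg [simp]: "obs_dens f \<sigma> z \<ge> 0"
  by (simp add: obs_dens_def)

lemma obs_dens_measurable [measurable]:
  assumes [measurable]: "f \<in> borel_measurable borel"
  shows "obs_dens f \<sigma> \<in> borel_measurable (PX \<Otimes>\<^sub>M lborel)"
  unfolding obs_dens_def normal_density_def by measurable

lemma obs_law_eq_density:
  fixes f :: "'a::euclidean_space \<Rightarrow> real"
  assumes [measurable]: "f \<in> borel_measurable borel" and \<sigma>: "\<sigma> > 0"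
  shows "obs_law f \<sigma> = density (PX \<Otimes>\<^sub>M lborel) (obs_dens f \<sigma>)"
proof (rule measure_eqI)
  show "sets (obs_law f \<sigma>) = sets (density (PX \<Otimes>\<^sub>M lborel) (\<lambda>x. ennreal (obs_dens f \<sigma> x)))"
    by (auto simp: obs_law_def intro!: sets_pair_measure_cong)
  interpret PX: prob_space "PX :: 'a measure" by (rule prob_space_PX)
  fix A assume "A \<in> sets (obs_law f \<sigma>)"
  then have A[measurable]: "A \<in> sets (borel \<Otimes>\<^sub>M borel)" by (simp add: obs_law_def)
  have A'[measurable]: "A \<in> sets (PX \<Otimes>\<^sub>M lborel)"
    using A by (metis sets_PX sets_lborel sets_pair_measure_cong)
  have sn: "sets (noise \<sigma>) = sets borel" by (simp add: noise_def)
  note [measurable_cong] = sn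
  have T: "(\<lambda>(x, e). (x, (if x \<in> cball 0 1 then f x else 0) + e)) \<in> measurable (PX \<Otimes>\<^sub>M noise \<sigma>) (borel \<Otimes>\<^sub>M borel)"
    unfolding ball_ext_def[symmetric] by measurable
  interpret N: sigma_finite_measure "noise \<sigma>"
    unfolding noise_def by (rule prob_space_imp_sigma_finite, rule prob_space_normal_density[OF \<sigma>])
  have "emeasure (obs_law f \<sigma>) A = (\<integral>\<^sup>+z. indicator A z \<partial>obs_law f \<sigma>)"
    by (rule nn_integral_indicator[symmetric]) (simp add: obs_law_def A)
  also have "\<dots> = (\<integral>\<^sup>+z. indicator A (fst z, ball_ext f (fst z) + snd z) \<partial>(PX \<Otimes>\<^sub>M noise \<sigma>))"
    unfolding obs_law_def by (subst nn_integral_distr[OF T]) (auto simp: ball_ext_def case_prod_beta)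
  also have "\<dots> = (\<integral>\<^sup>+x. \<integral>\<^sup>+e. indicator A (x, ball_ext f x + e) \<partial>noise \<sigma> \<partial>PX)"
    by (subst N.nn_integral_fst[symmetric]) (auto)
  also have "\<dots> = (\<integral>\<^sup>+x. \<integral>\<^sup>+y. ennreal (obs_dens f \<sigma> (x, y)) * indicator A (x, y) \<partial>lborel \<partial>PX)"
  proof (rule nn_integral_cong)
    fix x :: 'a
    have "(\<integral>\<^sup>+y. ennreal (obs_dens f \<sigma> (x, y)) * indicator A (x, y) \<partial>lborel)
      = (\<integral>\<^sup>+e. ennreal (obs_dens f \<sigma> (x, ball_ext f x + 1 * e)) * indicator A (x, ball_ext f x + 1 * e) \<partial>lborel)"
      by (subst nn_integral_real_affine[where c=1 and t="ball_ext f x"])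
         (auto simp: obs_dens_def normal_density_def)
    also have "\<dots> = (\<integral>\<^sup>+e. ennreal (normal_density 0 \<sigma> e) * indicator A (x, ball_ext f x + e) \<partial>lborel)"
      by (simp add: obs_dens_def normal_density_def)
    also have "\<dots> = (\<integral>\<^sup>+e. indicator A (x, ball_ext f x + e) \<partial>noise \<sigma>)"
      unfolding noise_def by (subst nn_integral_density) auto
    finally show "(\<integral>\<^sup>+e. indicator A (x, ball_ext f x + e) \<partial>noise \<sigma>)
      = (\<integral>\<^sup>+y. ennreal (obs_dens f \<sigma> (x, y)) * indicator A (x, y) \<partial>lborel)" by simp
  qed
  also have "\<dots> = (\<integral>\<^sup>+z. ennreal (obs_dens f \<sigma> z) * indicator A z \<partial>(PX \<Otimes>\<^sub>M lborel))"
    by (subst lborel.nn_integral_fst[symmetric]) auto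
  also have "\<dots> = emeasure (density (PX \<Otimes>\<^sub>M lborel) (obs_dens f \<sigma>)) A"
    by (subst emeasure_density) auto
  finally show "emeasure (obs_law f \<sigma>) A = emeasure (density (PX \<Otimes>\<^sub>M lborel) (obs_dens f \<sigma>)) A" .
qed

lemma prob_space_obs_law:
  fixes f :: "'a::euclidean_space \<Rightarrow> real"
  assumes [measurable]: "f \<in> borel_measurable borel" and \<sigma>: "\<sigma> > 0"
  shows "prob_space (obs_law f \<sigma>)"
proof -
  have sn: "sets (noise \<sigma>) = sets borel" by (simp add: noise_def)
  note [measurable_cong] = sn
  interpret PX: prob_space "PX :: 'a measure" by (rule prob_space_PX)
  interpret N: prob_space "noise \<sigma>"
    unfolding noise_def by (rule prob_space_normal_density[OF \<sigma>])
  interpret pair_prob_space "PX :: 'a measure" "noise \<sigma>" ..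
  show ?thesis unfolding obs_law_def ball_ext_def[symmetric] by (rule prob_space_distr) measurable
qed

lemma data_law_eq_density:
  fixes f :: "'a::euclidean_space \<Rightarrow> real"
  assumes "f \<in> borel_measurable borel" and "\<sigma> > 0"
  shows "data_law N f \<sigma> = density (PiM {..<N} (\<lambda>_. PX \<Otimes>\<^sub>M lborel)) (\<lambda>D. \<Prod>n<N. ennreal (obs_dens f \<sigma> (D n)))"
proof -
  interpret PX: prob_space "PX :: 'a measure" by (rule prob_space_PX)
  have sf: "sigma_finite_measure ((PX :: 'a measure) \<Otimes>\<^sub>M (lborel :: real measure))"
    by (intro sigma_finite_pair_measure PX.sigma_finite_measure_axioms lborel.sigma_finite_measure_axioms)
  show ?thesis unfolding data_law_def obs_law_eq_density[OF assms]
    by (rule PiM_density_const[OF _ sf])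
      (use prob_space_obs_law[OF assms] assms in \<open>auto simp: obs_law_eq_density\<close>)
qed

lemma nn_integral_prod_obs:
  fixes q :: "'a::euclidean_space \<times> real \<Rightarrow> ennreal"
  assumes "q \<in> borel_measurable (PX \<Otimes>\<^sub>M lborel)"
  shows "(\<integral>\<^sup>+D. (\<Prod>n<N. q (D n)) \<partial>PiM {..<N} (\<lambda>_. PX \<Otimes>\<^sub>M lborel)) = (\<integral>\<^sup>+z. q z \<partial>(PX \<Otimes>\<^sub>M lborel)) ^ N"
proof -
  interpret PX: prob_space "PX :: 'a measure" by (rule prob_space_PX)
  have sf: "sigma_finite_measure ((PX :: 'a measure) \<Otimes>\<^sub>M (lborel :: real measure))"
    by (intro sigma_finite_pair_measure PX.sigma_finite_measure_axioms lborel.sigma_finite_measure_axioms)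
  interpret B: product_sigma_finite "\<lambda>_::nat. (PX :: 'a measure) \<Otimes>\<^sub>M (lborel :: real measure)"
    unfolding product_sigma_finite_def using sf by blast
  show ?thesis
    by (subst B.product_nn_integral_prod) (use assms in auto)
qed

lemma sqrt_normal_density_mult:
  assumes "\<sigma> > 0"
  shows "sqrt (normal_density \<mu> \<sigma> y * normal_density \<nu> \<sigma> y)
       = exp (- (\<mu> - \<nu>)\<^sup>2 / (8 * \<sigma>\<^sup>2)) * normal_density ((\<mu> + \<nu>) / 2) \<sigma> y"
proof (rule real_sqrt_unique)
  have "(exp (- (\<mu> - \<nu>)\<^sup>2 / (8 * \<sigma>\<^sup>2)) * exp (- (y - (\<mu> + \<nu>) / 2)\<^sup>2 / (2 * \<sigma>\<^sup>2)))\<^sup>2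
      = exp (- (y - \<mu>)\<^sup>2 / (2 * \<sigma>\<^sup>2)) * exp (- (y - \<nu>)\<^sup>2 / (2 * \<sigma>\<^sup>2))"
    unfolding exp_double[symmetric] exp_add[symmetric]
    using assms by (simp add: field_simps power2_eq_square)
  then show "(exp (- (\<mu> - \<nu>)\<^sup>2 / (8 * \<sigma>\<^sup>2)) * normal_density ((\<mu> + \<nu>) / 2) \<sigma> y)\<^sup>2
     = normal_density \<mu> \<sigma> y * normal_density \<nu> \<sigma> y"
    by (simp add: normal_density_def power2_eq_square mult_ac)
qed simp

lemma obs_affinity_ge:
  fixes f g :: "'a::euclidean_space \<Rightarrow> real"
  assumes [measurable]: "f \<in> borel_measurable borel" "g \<in> borel_measurable borel" and \<sigma>: "\<sigma> > 0"
    and le: "(\<integral>\<^sup>+x. ennreal ((f x - g x)\<^sup>2) \<partial>PX) \<le> ennreal (8 * \<sigma>\<^sup>2 * e)" and e: "0 \<le> e" "e \<le> 1"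
  shows "(\<integral>\<^sup>+z. ennreal (sqrt (obs_dens f \<sigma> z * obs_dens g \<sigma> z)) \<partial>(PX \<Otimes>\<^sub>M lborel)) \<ge> ennreal (1 - e)"
proof -
  interpret PX: prob_space "PX :: 'a measure" by (rule prob_space_PX)
  define \<Delta> where "\<Delta> x = exp (- (ball_ext f x - ball_ext g x)\<^sup>2 / (8 * \<sigma>\<^sup>2))" for x
  have [measurable]: "\<Delta> \<in> borel_measurable borel" unfolding \<Delta>_def by measurable
  have "(\<integral>\<^sup>+z. ennreal (sqrt (obs_dens f \<sigma> z * obs_dens g \<sigma> z)) \<partial>(PX \<Otimes>\<^sub>M lborel))
     = (\<integral>\<^sup>+x. \<integral>\<^sup>+y. ennreal (sqrt (obs_dens f \<sigma> (x,y) * obs_dens g \<sigma> (x,y))) \<partial>lborel \<partial>PX)"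
    by (subst lborel.nn_integral_fst[symmetric]) auto
  also have "\<dots> = (\<integral>\<^sup>+x. ennreal (\<Delta> x) \<partial>PX)"
  proof (rule nn_integral_cong)
    fix x :: 'a
    have "(\<integral>\<^sup>+y. ennreal (sqrt (obs_dens f \<sigma> (x,y) * obs_dens g \<sigma> (x,y))) \<partial>lborel)
      = (\<integral>\<^sup>+y. ennreal (\<Delta> x) * ennreal (normal_density ((ball_ext f x + ball_ext g x) / 2) \<sigma> y) \<partial>lborel)"
      by (simp add: obs_dens_def sqrt_normal_density_mult[OF \<sigma>] \<Delta>_def ennreal_mult)
    also have "\<dots> = ennreal (\<Delta> x) * (\<integral>\<^sup>+y. ennreal (normal_density ((ball_ext f x + ball_ext g x) / 2) \<sigma> y) \<partial>lborel)"
      by (rule nn_integral_cmult) simp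
    also have "(\<integral>\<^sup>+y. ennreal (normal_density ((ball_ext f x + ball_ext g x) / 2) \<sigma> y) \<partial>lborel) = 1"
      using \<sigma> by (subst nn_integral_eq_integral) (auto simp: integral_normal_density integrable_normal_density)
    finally show "(\<integral>\<^sup>+y. ennreal (sqrt (obs_dens f \<sigma> (x,y) * obs_dens g \<sigma> (x,y))) \<partial>lborel) = ennreal (\<Delta> x)"
      by simp
  qed
  finally have eq: "(\<integral>\<^sup>+z. ennreal (sqrt (obs_dens f \<sigma> z * obs_dens g \<sigma> z)) \<partial>(PX \<Otimes>\<^sub>M lborel)) = (\<integral>\<^sup>+x. ennreal (\<Delta> x) \<partial>PX)" .
  have pt: "1 \<le> ennreal (\<Delta> x) + ennreal (1 / (8 * \<sigma>\<^sup>2)) * ennreal ((f x - g x)\<^sup>2)" for x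
  proof -
    have "(ball_ext f x - ball_ext g x)\<^sup>2 \<le> (f x - g x)\<^sup>2" by (auto simp: ball_ext_def)
    then have "(ball_ext f x - ball_ext g x)\<^sup>2 / (8 * \<sigma>\<^sup>2) \<le> (f x - g x)\<^sup>2 / (8 * \<sigma>\<^sup>2)"
      by (intro divide_right_mono) auto
    moreover have "1 + - (ball_ext f x - ball_ext g x)\<^sup>2 / (8 * \<sigma>\<^sup>2) \<le> \<Delta> x"
      unfolding \<Delta>_def by (rule exp_ge_add_one_self)
    ultimately have "1 \<le> \<Delta> x + 1 / (8 * \<sigma>\<^sup>2) * (f x - g x)\<^sup>2" by simp
    then show ?thesis
      by (subst ennreal_mult[symmetric], simp, simp, subst ennreal_plus[symmetric])
         (auto simp: \<Delta>_def simp del: ennreal_plus intro!: ennreal_leI[of 1, simplified])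
  qed
  have "1 = (\<integral>\<^sup>+x. 1 \<partial>(PX :: 'a measure))" using PX.emeasure_space_1 by simp
  also have "\<dots> \<le> (\<integral>\<^sup>+x. ennreal (\<Delta> x) + ennreal (1 / (8 * \<sigma>\<^sup>2)) * ennreal ((f x - g x)\<^sup>2) \<partial>PX)"
    by (intro nn_integral_mono pt)
  also have "\<dots> = (\<integral>\<^sup>+x. ennreal (\<Delta> x) \<partial>PX) + ennreal (1 / (8 * \<sigma>\<^sup>2)) * (\<integral>\<^sup>+x. ennreal ((f x - g x)\<^sup>2) \<partial>PX)"
    by (subst nn_integral_add) (auto simp: nn_integral_cmult)
  also have "\<dots> \<le> (\<integral>\<^sup>+x. ennreal (\<Delta> x) \<partial>PX) + ennreal (1 / (8 * \<sigma>\<^sup>2)) * ennreal (8 * \<sigma>\<^sup>2 * e)"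
    by (intro add_left_mono mult_left_mono le) auto
  also have "ennreal (1 / (8 * \<sigma>\<^sup>2)) * ennreal (8 * \<sigma>\<^sup>2 * e) = ennreal e"
    using \<sigma> e by (subst ennreal_mult[symmetric]) auto
  finally have "1 \<le> (\<integral>\<^sup>+x. ennreal (\<Delta> x) \<partial>PX) + ennreal e" .
  then show ?thesis unfolding eq using e
    by (metis ennreal_1 ennreal_minus ennreal_minus_mono add.commute ennreal_add_diff_cancel_left
        ennreal_minus_le_iff ennreal_neq_top)
qed

definition risk_on :: "'a set \<Rightarrow> nat \<Rightarrow> real \<Rightarrow> ((nat \<Rightarrow> 'a::euclidean_space \<times> real) \<Rightarrow> 'a \<Rightarrow> real) \<Rightarrow>
                    ('a \<Rightarrow> real) \<Rightarrow> ennreal" where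
  "risk_on Q N \<sigma> fh f = (\<integral>\<^sup>+D. (\<integral>\<^sup>+x. ennreal ((f x - fh D x)\<^sup>2) * indicator Q x \<partial>PX) \<partial>data_law N f \<sigma>)"

lemma min_ge_sqrt:
  fixes p q :: real
  assumes "p \<ge> 0" "q \<ge> 0"
  shows "2 * sqrt (p * q) \<le> min p q + q + p / 2"
proof -
  define u v where "u = sqrt p" and "v = sqrt q"
  have p: "p = u\<^sup>2" "q = v\<^sup>2" "u \<ge> 0" "v \<ge> 0" using assms by (auto simp: u_def v_def)
  have "2 * (u * v) \<le> u\<^sup>2 + v\<^sup>2 + u\<^sup>2 / 2"
    using sum_squares_bound[of u v] zero_le_power2[of u] by linarith
  moreover have "2 * (u * v) \<le> v\<^sup>2 + v\<^sup>2 + u\<^sup>2 / 2"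
    using zero_le_power2[of "u - 2 * v"] by (simp add: power2_eq_square algebra_simps)
  ultimately show ?thesis
    using p by (auto simp: real_sqrt_mult min_def)
qed

lemma sqrt_prod_eq: "sqrt (\<Prod>i\<in>A. f i) = (\<Prod>i\<in>A. sqrt (f i))"
  by (induction A rule: infinite_finite_induct) (auto simp: real_sqrt_mult)

theorem two_point_risk:
  fixes f g :: "'a::euclidean_space \<Rightarrow> real"
  assumes [measurable]: "f \<in> borel_measurable borel" "g \<in> borel_measurable borel" and \<sigma>: "\<sigma> > 0"
    and fh: "fh \<in> estimators N" and Q[measurable]: "Q \<in> sets borel" and N: "N \<ge> 1"
    and le: "(\<integral>\<^sup>+x. ennreal ((f x - g x)\<^sup>2) \<partial>PX) \<le> ennreal (\<sigma>\<^sup>2 / real N)"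
  shows "risk_on Q N \<sigma> fh f + risk_on Q N \<sigma> fh g \<ge>
     ennreal (1/8) * (\<integral>\<^sup>+x. ennreal ((f x - g x)\<^sup>2) * indicator Q x \<partial>PX)"
proof -
  interpret PX: prob_space "PX :: 'a measure" by (rule prob_space_PX)
  let ?B = "PiM {..<N} (\<lambda>_. (PX :: 'a measure) \<Otimes>\<^sub>M (lborel :: real measure))"
  have sB: "sets ?B = sets (PiM {..<N} (\<lambda>_. (borel :: 'a measure) \<Otimes>\<^sub>M (borel :: real measure)))"
    by (intro sets_PiM_cong refl sets_pair_measure_cong) auto
  have fm[measurable]: "(\<lambda>p. fh (fst p) (snd p)) \<in> borel_measurable (?B \<Otimes>\<^sub>M borel)"
    using fh sets_pair_measure_cong[OF sB refl, of borel] unfolding estimators_def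
    by (simp cong: measurable_cong_sets)
  define P where "P h D = (\<Prod>n<N. obs_dens h \<sigma> (D n))" for h and D :: "nat \<Rightarrow> 'a \<times> real"
  have P0: "P h D \<ge> 0" for h D unfolding P_def by (intro prod_nonneg) auto
  have Pm[measurable]: "P h \<in> borel_measurable ?B" if [measurable]: "h \<in> borel_measurable borel" for h
    unfolding P_def by measurable
  define l where "l h D = (\<integral>\<^sup>+x. ennreal ((h x - fh D x)\<^sup>2) * indicator Q x \<partial>PX)" for h D
  have lm[measurable]: "l h \<in> borel_measurable ?B" if [measurable]: "h \<in> borel_measurable borel" for h
    unfolding l_def by measurable
  have r: "risk_on Q N \<sigma> fh h = (\<integral>\<^sup>+D. ennreal (P h D) * l h D \<partial>?B)"
    if [measurable]: "h \<in> borel_measurable borel" for h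
    unfolding risk_on_def data_law_eq_density[OF that \<sigma>] l_def[symmetric]
    by (subst nn_integral_density) (auto simp: P_def prod_ennreal)
  define S where "S = (\<integral>\<^sup>+x. ennreal ((f x - g x)\<^sup>2) * indicator Q x \<partial>PX)"
  have lS: "ennreal (1/2) * S \<le> l f D + l g D" if "D \<in> space ?B" for D
  proof -
    have [measurable]: "fh D \<in> borel_measurable borel"
      using measurable_compose[OF measurable_Pair1'[OF that] fm] by simp
    have "ennreal (1/2) * S = (\<integral>\<^sup>+x. ennreal (1/2) * (ennreal ((f x - g x)\<^sup>2) * indicator Q x) \<partial>PX)"
      unfolding S_def by (subst nn_integral_cmult) auto
    also have "\<dots> \<le> (\<integral>\<^sup>+x. ennreal ((f x - fh D x)\<^sup>2) * indicator Q x + ennreal ((g x - fh D x)\<^sup>2) * indicator Q x \<partial>PX)"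
    proof (rule nn_integral_mono)
      fix x
      have "1/2 * (f x - g x)\<^sup>2 \<le> (f x - fh D x)\<^sup>2 + (g x - fh D x)\<^sup>2"
        using zero_le_power2[of "(f x - fh D x) + (g x - fh D x)"]
        by (simp add: power2_eq_square algebra_simps)
      then have "ennreal (1/2) * ennreal ((f x - g x)\<^sup>2) \<le> ennreal ((f x - fh D x)\<^sup>2) + ennreal ((g x - fh D x)\<^sup>2)"
        by (subst ennreal_mult[symmetric], simp, simp, subst ennreal_plus[symmetric]) (auto simp del: ennreal_plus intro!: ennreal_leI)
      then show "ennreal (1/2) * (ennreal ((f x - g x)\<^sup>2) * indicator Q x) \<le> ennreal ((f x - fh D x)\<^sup>2) * indicator Q x + ennreal ((g x - fh D x)\<^sup>2) * indicator Q x"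
        by (auto split: split_indicator)
    qed
    also have "\<dots> = l f D + l g D" unfolding l_def by (subst nn_integral_add) auto
    finally show ?thesis .
  qed
  define m where "m D = min (P f D) (P g D)" for D
  have m0: "m D \<ge> 0" for D using P0 by (simp add: m_def)
  have [measurable]: "m \<in> borel_measurable ?B" unfolding m_def by measurable
  have intP: "(\<integral>\<^sup>+D. ennreal (P h D) \<partial>?B) = 1" if [measurable]: "h \<in> borel_measurable borel" for h
  proof -
    interpret O: prob_space "obs_law h \<sigma>" by (rule prob_space_obs_law[OF that \<sigma>])
    have "(\<integral>\<^sup>+z. ennreal (obs_dens h \<sigma> z) \<partial>(PX \<Otimes>\<^sub>M lborel)) = emeasure (obs_law h \<sigma>) (space (obs_law h \<sigma>))"
      unfolding obs_law_eq_density[OF that \<sigma>] space_density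
      by (subst emeasure_density[OF _ sets.top]) (auto intro!: nn_integral_cong)
    then have "(\<integral>\<^sup>+z. ennreal (obs_dens h \<sigma> z) \<partial>(PX \<Otimes>\<^sub>M lborel)) = 1" using O.emeasure_space_1 by simp
    then show ?thesis
      using nn_integral_prod_obs[of "\<lambda>z. ennreal (obs_dens h \<sigma> z)" N] by (simp add: P_def prod_ennreal)
  qed
  define \<rho> where "\<rho> = (\<integral>\<^sup>+D. ennreal (sqrt (P f D * P g D)) \<partial>?B)"
  have \<rho>: "\<rho> \<ge> ennreal (7/8)"
  proof -
    have "\<rho> = (\<integral>\<^sup>+D. (\<Prod>n<N. ennreal (sqrt (obs_dens f \<sigma> (D n) * obs_dens g \<sigma> (D n)))) \<partial>?B)"
      unfolding \<rho>_def P_def by (simp add: prod.distrib[symmetric] sqrt_prod_eq prod_ennreal)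
    also have "\<dots> = (\<integral>\<^sup>+z. ennreal (sqrt (obs_dens f \<sigma> z * obs_dens g \<sigma> z)) \<partial>(PX \<Otimes>\<^sub>M lborel)) ^ N"
      by (rule nn_integral_prod_obs) measurable
    also have "\<dots> \<ge> ennreal (1 - 1/(8 * real N)) ^ N"
    proof (intro power_mono obs_affinity_ge)
      show "(\<integral>\<^sup>+x. ennreal ((f x - g x)\<^sup>2) \<partial>PX) \<le> ennreal (8 * \<sigma>\<^sup>2 * (1 / (8 * real N)))"
        using le by (simp add: field_simps)
    qed (use \<sigma> N in \<open>auto simp: field_simps\<close>)
    also have "ennreal (1 - 1/(8 * real N)) ^ N = ennreal ((1 - 1/(8 * real N)) ^ N)"
      using N by (intro ennreal_power) (auto simp: field_simps)
    finally have *: "ennreal ((1 - 1/(8 * real N)) ^ N) \<le> \<rho>" .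
    have "(1 + (- 1/(8 * real N))) ^ N \<ge> 1 + real N * (- 1/(8 * real N))"
      by (rule Bernoulli_inequality) (use N in \<open>auto simp: field_simps\<close>)
    then have "(1 - 1/(8 * real N)) ^ N \<ge> 7/8" using N by simp
    then have "ennreal (7/8) \<le> ennreal ((1 - 1/(8 * real N)) ^ N)" by (rule ennreal_leI)
    also note *
    finally show ?thesis .
  qed
  define mm where "mm = (\<integral>\<^sup>+D. ennreal (m D) \<partial>?B)"
  have "ennreal (7/4) = 2 * ennreal (7/8)"
    by (simp add: ennreal_mult'[symmetric] flip: ennreal_numeral)
  also have "\<dots> \<le> 2 * \<rho>" by (intro mult_left_mono \<rho>) auto
  also have "\<dots> = (\<integral>\<^sup>+D. 2 * ennreal (sqrt (P f D * P g D)) \<partial>?B)"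
    unfolding \<rho>_def by (subst nn_integral_cmult) auto
  also have "\<dots> \<le> (\<integral>\<^sup>+D. ennreal (m D) + ennreal (P g D) + ennreal (1/2) * ennreal (P f D) \<partial>?B)"
  proof (rule nn_integral_mono)
    fix D
    have "2 * sqrt (P f D * P g D) \<le> m D + P g D + 1/2 * P f D"
      using min_ge_sqrt[OF P0[of f D] P0[of g D]] by (simp add: m_def)
    then show "2 * ennreal (sqrt (P f D * P g D)) \<le> ennreal (m D) + ennreal (P g D) + ennreal (1/2) * ennreal (P f D)"
      using P0[of f D] P0[of g D] m0[of D]
      by (subst ennreal_mult[symmetric], simp, simp, subst ennreal_plus[symmetric], simp, simp,
          subst ennreal_plus[symmetric], simp, simp, subst ennreal_numeral[symmetric],
          subst ennreal_mult[symmetric]) (auto simp del: ennreal_plus intro!: ennreal_leI)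
  qed
  also have "\<dots> = mm + 1 + ennreal (1/2)"
    unfolding mm_def by (simp add: nn_integral_add nn_integral_cmult intP)
  finally have mm1: "ennreal (7/4) \<le> mm + ennreal (3/2)"
    by (subst (asm) add.assoc, subst (asm) ennreal_1[symmetric], subst (asm) ennreal_plus[symmetric]) auto
  have mm: "ennreal (1/4) \<le> mm"
  proof (cases mm)
    case (real r)
    with mm1 show ?thesis by (simp add: ennreal_leI flip: ennreal_plus)
  qed simp
  have "ennreal (1/8) * S = ennreal (1/4) * (ennreal (1/2) * S)"
    by (subst mult.assoc[symmetric], subst ennreal_mult[symmetric]) auto
  also have "\<dots> \<le> mm * (ennreal (1/2) * S)" by (intro mult_right_mono mm) auto
  also have "\<dots> = (\<integral>\<^sup>+D. ennreal (m D) * (ennreal (1/2) * S) \<partial>?B)"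
    unfolding mm_def by (subst nn_integral_multc) auto
  also have "\<dots> \<le> (\<integral>\<^sup>+D. ennreal (P f D) * l f D + ennreal (P g D) * l g D \<partial>?B)"
  proof (rule nn_integral_mono)
    fix D assume D: "D \<in> space ?B"
    have "ennreal (m D) * (ennreal (1/2) * S) \<le> ennreal (m D) * (l f D + l g D)"
      by (intro mult_left_mono lS D) auto
    also have "\<dots> \<le> ennreal (P f D) * l f D + ennreal (P g D) * l g D"
      unfolding distrib_left by (intro add_mono mult_right_mono ennreal_leI) (auto simp: m_def)
    finally show "ennreal (m D) * (ennreal (1/2) * S) \<le> ennreal (P f D) * l f D + ennreal (P g D) * l g D" .
  qed
  also have "\<dots> = risk_on Q N \<sigma> fh f + risk_on Q N \<sigma> fh g"
    by (subst nn_integral_add) (auto simp: r)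
  finally show ?thesis unfolding S_def .
qed

section \<open>Hilbert transform and differentiated Gaussians\<close>

lemma one_plus_sq_pos [simp]: "0 < 1 + x\<^sup>2" for x :: real
  by (simp add: add_pos_nonneg)

lemma one_plus_sq_neq [simp]: "1 + x\<^sup>2 \<noteq> 0" for x :: real
  using one_plus_sq_pos[of x] by linarith

lemma integrable_inv_one_plus_sq: "integrable lborel (\<lambda>x::real. 1 / (1 + x\<^sup>2))"
  using integrable_inverse_1_plus_square
  by (simp add: set_integrable_def inverse_eq_divide einterval_def)

lemma integral_inv_one_plus_sq: "(\<integral>x. 1 / (1 + x\<^sup>2) \<partial>lborel) = pi"
  using LBINT_inverse_1_plus_square
  by (simp add: interval_lebesgue_integral_def set_lebesgue_integral_def inverse_eq_divide einterval_def)

lemma one_plus_sq_mult_le: "1 + s\<^sup>2 \<le> 2 * (1 + t\<^sup>2) * (1 + (t - s)\<^sup>2)" for s t :: real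
proof -
  define v where "v = t - s"
  have s: "s = t - v" by (simp add: v_def)
  have "1 + (t - v)\<^sup>2 \<le> 1 + 2 * t\<^sup>2 + 2 * v\<^sup>2"
    using zero_le_power2[of "t + v"] by (simp add: power2_eq_square algebra_simps)
  also have "\<dots> \<le> 2 * (1 + t\<^sup>2) * (1 + v\<^sup>2)"
    by (simp add: algebra_simps)
  finally show ?thesis by (simp add: s)
qed

lemma inv_one_plus_sq_mult_le:
  fixes s t :: real
  shows "1 / ((1 + t\<^sup>2) * (1 + (t - s)\<^sup>2)) \<le> 2 / (1 + s\<^sup>2)"
    "1 / ((1 + t\<^sup>2) * (1 + (t + s)\<^sup>2)) \<le> 2 / (1 + s\<^sup>2)"
proof -
  have pos: "1 + x\<^sup>2 > 0" for x :: real by (simp add: add_pos_nonneg)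
  show "1 / ((1 + t\<^sup>2) * (1 + (t - s)\<^sup>2)) \<le> 2 / (1 + s\<^sup>2)"
    using one_plus_sq_mult_le[of s t] pos by (simp add: divide_le_eq le_divide_eq mult_ac) (simp add: algebra_simps)
  show "1 / ((1 + t\<^sup>2) * (1 + (t + s)\<^sup>2)) \<le> 2 / (1 + s\<^sup>2)"
    using one_plus_sq_mult_le[of "-s" t] pos by (simp add: divide_le_eq le_divide_eq mult_ac) (simp add: algebra_simps)
qed

lemma integrable_of_decay:
  fixes f :: "real \<Rightarrow> real"
  assumes "f \<in> borel_measurable borel" "\<And>x. \<bar>f x\<bar> \<le> B / (1 + x\<^sup>2)"
  shows "integrable lborel f"
proof (rule Bochner_Integration.integrable_bound[OF integrable_mult_right[OF integrable_inv_one_plus_sq, of B]])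
  show "AE x in lborel. norm (f x) \<le> norm (B * (1 / (1 + x\<^sup>2)))"
    by (auto intro!: AE_I2 order_trans[OF assms(2)] divide_right_mono)
qed (use assms in auto)

definition gauss_poly :: "real poly \<Rightarrow> real \<Rightarrow> real" where
  "gauss_poly P t = poly P t * exp (- t\<^sup>2 / 2)"

definition gp_deriv :: "real poly \<Rightarrow> real poly" where
  "gp_deriv P = pderiv P - [:0, 1:] * P"

lemma gauss_poly_has_deriv: "(gauss_poly P has_real_derivative gauss_poly (gp_deriv P) t) (at t)"
  unfolding gauss_poly_def gp_deriv_def
  by (auto intro!: derivative_eq_intros simp: algebra_simps power2_eq_square)

lemma gauss_poly_measurable [measurable]: "gauss_poly P \<in> borel_measurable borel"
  by (intro borel_measurable_continuous_onI DERIV_continuous_on[OF has_field_derivative_at_within[OF gauss_poly_has_deriv]])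

lemma isCont_gauss_poly: "isCont (gauss_poly P) t"
  using gauss_poly_has_deriv DERIV_isCont by blast

lemma poly_le_exp_sq: "c > 0 \<Longrightarrow> \<exists>B\<ge>0. \<forall>t. \<bar>poly P t\<bar> \<le> B * exp (c * t\<^sup>2)" for c :: real
proof (induction P arbitrary: c)
  case 0 then show ?case by (auto intro!: exI[of _ 0])
next
  case (pCons a P)
  from pCons.IH[of "c/2"] pCons.prems obtain B where B: "B \<ge> 0" "\<And>t. \<bar>poly P t\<bar> \<le> B * exp (c / 2 * t\<^sup>2)" by auto
  define D where "D = 1 + 1 / c"
  have D: "\<bar>t\<bar> \<le> D * exp (c / 2 * t\<^sup>2)" for t
  proof -
    have "\<bar>t\<bar> \<le> 1 + t\<^sup>2 / 2" using zero_le_power2[of "\<bar>t\<bar> - 1"] by (simp add: power2_diff)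
    also have "\<dots> \<le> D * (1 + c / 2 * t\<^sup>2)"
      using pCons.prems by (simp add: D_def field_simps add_nonneg_nonneg)
    also have "\<dots> \<le> D * exp (c / 2 * t\<^sup>2)"
      using pCons.prems by (intro mult_left_mono exp_ge_add_one_self) (auto simp: D_def)
    finally show ?thesis .
  qed
  show ?case
  proof (intro exI[of _ "\<bar>a\<bar> + D * B"] conjI allI)
    show "0 \<le> \<bar>a\<bar> + D * B" using B pCons.prems by (simp add: D_def)
    fix t
    have "\<bar>poly (pCons a P) t\<bar> \<le> \<bar>a\<bar> + \<bar>t\<bar> * \<bar>poly P t\<bar>" by (simp add: abs_mult[symmetric])
    also have "\<dots> \<le> \<bar>a\<bar> * exp (c * t\<^sup>2) + (D * exp (c / 2 * t\<^sup>2)) * (B * exp (c / 2 * t\<^sup>2))"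
      using pCons.prems B D by (intro add_mono mult_mono) (auto intro: mult_le_cancel_left1[THEN iffD2] simp: D_def)
    also have "(D * exp (c / 2 * t\<^sup>2)) * (B * exp (c / 2 * t\<^sup>2)) = D * B * exp (c / 2 * t\<^sup>2 + c / 2 * t\<^sup>2)"
      by (simp only: exp_add mult_ac)
    finally show "\<bar>poly (pCons a P) t\<bar> \<le> (\<bar>a\<bar> + D * B) * exp (c * t\<^sup>2)" by (simp add: algebra_simps)
  qed
qed

lemma gauss_poly_bounded: "\<exists>B\<ge>0. \<forall>t. \<bar>gauss_poly P t\<bar> \<le> B"
proof -
  obtain B where B: "B \<ge> 0" "\<And>t. \<bar>poly P t\<bar> \<le> B * exp (1/2 * t\<^sup>2)" using poly_le_exp_sq[of "1/2" P] by auto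
  have "\<bar>gauss_poly P t\<bar> \<le> B" for t
  proof -
    have "\<bar>gauss_poly P t\<bar> \<le> B * exp (1/2 * t\<^sup>2) * exp (- t\<^sup>2 / 2)"
      unfolding gauss_poly_def abs_mult by (intro mult_mono) (use B in auto)
    also have "\<dots> = B" by (simp add: mult.assoc exp_add[symmetric])
    finally show ?thesis .
  qed
  with B show ?thesis by blast
qed

lemma gauss_poly_decay: "\<exists>B\<ge>0. \<forall>t. \<bar>gauss_poly P t\<bar> \<le> B / (1 + t\<^sup>2)\<^sup>2"
proof -
  obtain B where B: "B \<ge> 0" "\<And>t. \<bar>gauss_poly ([:1,0,1:]^2 * P) t\<bar> \<le> B"
    using gauss_poly_bounded[of "[:1,0,1:]^2 * P"] by auto
  have "\<bar>gauss_poly P t\<bar> \<le> B / (1 + t\<^sup>2)\<^sup>2" for t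
  proof -
    have "gauss_poly ([:1,0,1:]^2 * P) t = (1 + t\<^sup>2)\<^sup>2 * gauss_poly P t"
      by (simp add: gauss_poly_def power2_eq_square) (simp add: algebra_simps)
    then have "(1 + t\<^sup>2)\<^sup>2 * \<bar>gauss_poly P t\<bar> \<le> B" using B(2)[of t] by (simp add: abs_mult)
    then show ?thesis by (simp add: le_divide_eq add_pos_nonneg mult.commute)
  qed
  with B show ?thesis by blast
qed

lemma inv_sq_le: "B \<ge> 0 \<Longrightarrow> B / (1 + t\<^sup>2)\<^sup>2 \<le> B / (1 + t\<^sup>2)" for t B :: real
  by (intro divide_left_mono) (auto simp: power2_eq_square add_pos_nonneg)

definition rapid :: "(real \<Rightarrow> real) \<Rightarrow> bool" where
  "rapid p \<longleftrightarrow> (\<forall>j t. (deriv ^^ j) p differentiable at t) \<and>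
     (\<forall>j. \<exists>B. \<forall>t. (1 + t\<^sup>2)\<^sup>2 * \<bar>(deriv ^^ j) p t\<bar> \<le> B)"

lemma rapid_has_deriv:
  "rapid p \<Longrightarrow> ((deriv ^^ j) p has_real_derivative (deriv ^^ Suc j) p t) (at t)"
  unfolding rapid_def by (simp add: DERIV_deriv_iff_real_differentiable)

lemma rapid_isCont: "rapid p \<Longrightarrow> isCont ((deriv ^^ j) p) t"
  using rapid_has_deriv DERIV_isCont by blast

lemma rapid_measurable: "rapid p \<Longrightarrow> (deriv ^^ j) p \<in> borel_measurable borel"
  by (intro borel_measurable_continuous_onI continuous_at_imp_continuous_on) (auto intro: rapid_isCont)

lemma rapid_decay:
  assumes "rapid p"
  obtains B where "B \<ge> 0" "\<And>t. \<bar>(deriv ^^ j) p t\<bar> \<le> B / (1 + t\<^sup>2)\<^sup>2"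
proof -
  obtain B where B: "\<And>t. (1 + t\<^sup>2)\<^sup>2 * \<bar>(deriv ^^ j) p t\<bar> \<le> B" using assms unfolding rapid_def by blast
  have "B \<ge> 0" using B[of 0] by (simp add: order_trans[OF abs_ge_zero])
  moreover have "\<bar>(deriv ^^ j) p t\<bar> \<le> B / (1 + t\<^sup>2)\<^sup>2" for t
    using B[of t] by (simp add: le_divide_eq add_pos_nonneg mult.commute)
  ultimately show ?thesis using that by blast
qed

lemma rapid_bounded:
  assumes "rapid p"
  obtains B where "B \<ge> 0" "\<And>t. \<bar>(deriv ^^ j) p t\<bar> \<le> B"
proof -
  obtain B where B: "B \<ge> 0" "\<And>t. \<bar>(deriv ^^ j) p t\<bar> \<le> B / (1 + t\<^sup>2)\<^sup>2" using rapid_decay[OF assms] by blast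
  have "\<bar>(deriv ^^ j) p t\<bar> \<le> B" for t
  proof -
    have "B / (1 + t\<^sup>2)\<^sup>2 \<le> B / 1" using B by (intro divide_left_mono) (auto simp: add_pos_nonneg one_le_power)
    with B(2)[of t] show ?thesis by simp
  qed
  with B that show ?thesis by blast
qed

lemma deriv_funpow_affine:
  fixes p :: "real \<Rightarrow> real"
  assumes "\<And>j t. (deriv ^^ j) p differentiable at t"
  shows "(deriv ^^ j) (\<lambda>t. p (b + h * t)) = (\<lambda>t. h ^ j * (deriv ^^ j) p (b + h * t))"
proof (induction j)
  case (Suc j)
  have "deriv (\<lambda>t. h ^ j * (deriv ^^ j) p (b + h * t)) t = h ^ Suc j * (deriv ^^ Suc j) p (b + h * t)" for t
  proof (rule DERIV_imp_deriv)
    have d: "((deriv ^^ j) p has_real_derivative (deriv ^^ Suc j) p (b + h * t)) (at (b + h * t))"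
      using assms by (simp add: DERIV_deriv_iff_real_differentiable)
    show "((\<lambda>t. h ^ j * (deriv ^^ j) p (b + h * t)) has_real_derivative h ^ Suc j * (deriv ^^ Suc j) p (b + h * t)) (at t)"
      by (rule derivative_eq_intros DERIV_chain2[where f = "(deriv ^^ j) p" and g = "\<lambda>t. b + h * t"] d refl)+ simp
  qed
  with Suc show ?case by simp
qed simp

lemma rapid_affine:
  assumes p: "rapid p" and h: "h \<noteq> 0"
  shows "rapid (\<lambda>t. p (b + h * t))"
proof -
  have eq: "(deriv ^^ j) (\<lambda>t. p (b + h * t)) = (\<lambda>t. h ^ j * (deriv ^^ j) p (b + h * t))" for j
    using p by (intro deriv_funpow_affine) (auto simp: rapid_def)
  show ?thesis unfolding rapid_def
  proof (intro conjI allI)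
    fix j t
    have "((\<lambda>t. h ^ j * (deriv ^^ j) p (b + h * t)) has_real_derivative h ^ j * ((deriv ^^ Suc j) p (b + h * t) * h)) (at t)"
      by (intro DERIV_cmult DERIV_chain2[where f = "(deriv ^^ j) p" and g = "\<lambda>t. b + h * t"] rapid_has_deriv[OF p])
         (auto intro!: derivative_eq_intros)
    then show "(deriv ^^ j) (\<lambda>t. p (b + h * t)) differentiable at t"
      unfolding eq using real_differentiable_def by blast
  next
    fix j
    obtain B where B: "B \<ge> 0" "\<And>t. \<bar>(deriv ^^ j) p t\<bar> \<le> B / (1 + t\<^sup>2)\<^sup>2" using rapid_decay[OF p] by blast
    define c where "c = 2 * (1 + b\<^sup>2) * (1 + 1 / h\<^sup>2)"
    have c: "1 + t\<^sup>2 \<le> c * (1 + (b + h * t)\<^sup>2)" for t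
    proof -
      have "1 + (- (h * t))\<^sup>2 \<le> 2 * (1 + b\<^sup>2) * (1 + (b - - (h * t))\<^sup>2)" by (rule one_plus_sq_mult_le)
      then have 1: "1 + (h * t)\<^sup>2 \<le> 2 * (1 + b\<^sup>2) * (1 + (b + h * t)\<^sup>2)" by simp
      have "1 + t\<^sup>2 \<le> (1 + 1 / h\<^sup>2) * (1 + (h * t)\<^sup>2)"
        using h by (simp add: field_simps power_mult_distrib)
      also have "\<dots> \<le> (1 + 1 / h\<^sup>2) * (2 * (1 + b\<^sup>2) * (1 + (b + h * t)\<^sup>2))"
        by (intro mult_left_mono 1) auto
      finally show ?thesis by (simp add: c_def mult_ac)
    qed
    have c0: "c \<ge> 0" by (simp add: c_def)
    show "\<exists>B. \<forall>t. (1 + t\<^sup>2)\<^sup>2 * \<bar>(deriv ^^ j) (\<lambda>t. p (b + h * t)) t\<bar> \<le> B"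
    proof (intro exI[of _ "c\<^sup>2 * \<bar>h\<bar> ^ j * B"] allI)
      fix t
      have "(1 + t\<^sup>2)\<^sup>2 * \<bar>(deriv ^^ j) (\<lambda>t. p (b + h * t)) t\<bar> = (1 + t\<^sup>2)\<^sup>2 * (\<bar>h\<bar> ^ j * \<bar>(deriv ^^ j) p (b + h * t)\<bar>)"
        by (simp add: eq abs_mult power_abs)
      also have "\<dots> \<le> (c * (1 + (b + h * t)\<^sup>2))\<^sup>2 * (\<bar>h\<bar> ^ j * (B / (1 + (b + h * t)\<^sup>2)\<^sup>2))"
        using c B by (intro mult_mono power_mono) auto
      also have "\<dots> = c\<^sup>2 * \<bar>h\<bar> ^ j * B"
      proof -
        have "1 + (b + h * t)\<^sup>2 \<noteq> 0" by (metis add_pos_nonneg less_irrefl zero_le_power2 zero_less_one)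
        then show ?thesis by (simp add: power_mult_distrib)
      qed
      finally show "(1 + t\<^sup>2)\<^sup>2 * \<bar>(deriv ^^ j) (\<lambda>t. p (b + h * t)) t\<bar> \<le> c\<^sup>2 * \<bar>h\<bar> ^ j * B" .
    qed
  qed
qed

lemma integrable_gauss_poly_mult:
  assumes [measurable]: "f \<in> borel_measurable borel" and "\<And>t. \<bar>f t\<bar> \<le> B"
  shows "integrable lborel (\<lambda>t. gauss_poly P t * f t)"
proof -
  obtain A where A: "A \<ge> 0" "\<And>t. \<bar>gauss_poly P t\<bar> \<le> A / (1 + t\<^sup>2)\<^sup>2" using gauss_poly_decay by blast
  show ?thesis
  proof (rule integrable_of_decay)
    fix t :: real
    have "\<bar>gauss_poly P t * f t\<bar> \<le> A / (1 + t\<^sup>2) * B"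
      unfolding abs_mult using A assms(2)
      by (intro mult_mono order_trans[OF A(2) inv_sq_le]) (auto simp: add_pos_nonneg)
    then show "\<bar>gauss_poly P t * f t\<bar> \<le> A * B / (1 + t\<^sup>2)" by simp
  qed measurable
qed

lemma integrable_gauss_poly: "integrable lborel (gauss_poly P)"
  using integrable_gauss_poly_mult[of "\<lambda>_. 1" 1 P] by simp

lemma gauss_poly_by_parts:
  assumes d: "\<And>t. (f has_real_derivative f' t) (at t)" and c: "\<And>t. isCont f' t"
    and B: "\<And>t. \<bar>f t\<bar> \<le> B" "\<And>t. \<bar>f' t\<bar> \<le> B"
  shows "(\<integral>t. gauss_poly P t * f' t \<partial>lborel) = - (\<integral>t. gauss_poly (gp_deriv P) t * f t \<partial>lborel)"
proof -
  have fc: "isCont f t" for t using d DERIV_isCont by blast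
  have [measurable]: "f \<in> borel_measurable borel" "f' \<in> borel_measurable borel"
    by (auto intro!: borel_measurable_continuous_onI continuous_at_imp_continuous_on c fc)
  have i1: "integrable lborel (\<lambda>t. gauss_poly P t * f' t)" by (rule integrable_gauss_poly_mult[OF _ B(2)]) measurable
  have i2: "integrable lborel (\<lambda>t. gauss_poly (gp_deriv P) t * f t)" by (rule integrable_gauss_poly_mult[OF _ B(1)]) measurable
  obtain A where A: "A \<ge> 0" "\<And>t. \<bar>gauss_poly P t\<bar> \<le> A / (1 + t\<^sup>2)\<^sup>2" using gauss_poly_decay by blast
  have bd: "norm (gauss_poly P t * f t) \<le> A * B / (1 + t\<^sup>2)" for t
  proof -
    have "\<bar>gauss_poly P t * f t\<bar> \<le> A / (1 + t\<^sup>2) * B"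
      unfolding abs_mult using A B(1)
      by (intro mult_mono order_trans[OF A(2) inv_sq_le]) (auto simp: add_pos_nonneg)
    then show ?thesis by simp
  qed
  have lim: "((\<lambda>t. gauss_poly P t * f t) \<longlongrightarrow> 0) at_infinity"
  proof (rule Lim_null_comparison)
    have "((\<lambda>t::real. A * B * norm (inverse t)) \<longlongrightarrow> A * B * norm (0::real)) at_infinity"
      by (intro tendsto_intros tendsto_inverse_0)
    then show "((\<lambda>t::real. A * B * norm (inverse t)) \<longlongrightarrow> 0) at_infinity" by simp
    have "norm (gauss_poly P t * f t) \<le> A * B * norm (inverse t)" if "norm t \<ge> 1" for t
    proof -
      have t: "\<bar>t\<bar> \<le> 1 + t\<^sup>2" using zero_le_power2[of "\<bar>t\<bar> - 1"] by (simp add: power2_diff)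
      have "0 \<le> B" using B(1)[of 0] by simp
      have "A * B / (1 + t\<^sup>2) \<le> A * B / \<bar>t\<bar>"
        using t that A \<open>0 \<le> B\<close> by (intro divide_left_mono) (auto simp: add_pos_nonneg)
      with bd[of t] show ?thesis by (simp add: divide_inverse)
    qed
    then show "\<forall>\<^sub>F t in at_infinity. norm (gauss_poly P t * f t) \<le> A * B * norm (inverse t)"
      unfolding eventually_at_infinity by blast
  qed
  have lim0: "((\<lambda>t. gauss_poly P t * f t) \<longlongrightarrow> 0) at_top" "((\<lambda>t. gauss_poly P t * f t) \<longlongrightarrow> 0) at_bot"
    using tendsto_mono[OF at_top_le_at_infinity lim] tendsto_mono[OF at_bot_le_at_infinity lim] by auto
  have "(LBINT t=-\<infinity>..\<infinity>. gauss_poly (gp_deriv P) t * f t + gauss_poly P t * f' t) = 0 - 0"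
  proof (rule interval_integral_FTC_integrable[where F = "\<lambda>t. gauss_poly P t * f t"])
    show "((\<lambda>t. gauss_poly P t * f t) has_vector_derivative gauss_poly (gp_deriv P) t * f t + gauss_poly P t * f' t) (at t)" for t
      unfolding has_real_derivative_iff_has_vector_derivative[symmetric]
      by (rule derivative_eq_intros gauss_poly_has_deriv d refl)+ simp
    show "isCont (\<lambda>t. gauss_poly (gp_deriv P) t * f t + gauss_poly P t * f' t) t" for t
      by (intro continuous_intros isCont_gauss_poly fc c)
    show "set_integrable lborel (einterval (- \<infinity>) \<infinity>) (\<lambda>t. gauss_poly (gp_deriv P) t * f t + gauss_poly P t * f' t)"
      using i1 i2 by (simp add: set_integrable_def einterval_def)
  qed (use lim0 in \<open>auto simp: ereal_tendsto_simps1\<close>)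
  then have "(\<integral>t. gauss_poly (gp_deriv P) t * f t + gauss_poly P t * f' t \<partial>lborel) = 0"
    by (simp add: interval_lebesgue_integral_def set_lebesgue_integral_def einterval_def)
  then show ?thesis using i1 i2 by simp
qed

lemma integral_gauss_poly_gp_deriv: "(\<integral>t. gauss_poly (gp_deriv P) t \<partial>lborel) = 0"
  using gauss_poly_by_parts[of "\<lambda>_. 1" "\<lambda>_. 0" 1 P] by simp

lemma gauss_poly_by_parts_iter:
  assumes p: "rapid p"
  shows "(\<integral>t. gauss_poly P t * (deriv ^^ n) p t \<partial>lborel)
       = (-1) ^ n * (\<integral>t. gauss_poly ((gp_deriv ^^ n) P) t * p t \<partial>lborel)"
proof (induction n arbitrary: P)
  case (Suc n)
  obtain B1 where B1: "\<And>t. \<bar>(deriv ^^ n) p t\<bar> \<le> B1" using rapid_bounded[OF p] by blast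
  obtain B2 where B2: "\<And>t. \<bar>(deriv ^^ Suc n) p t\<bar> \<le> B2" using rapid_bounded[OF p] by blast
  have "(\<integral>t. gauss_poly P t * (deriv ^^ Suc n) p t \<partial>lborel) = - (\<integral>t. gauss_poly (gp_deriv P) t * (deriv ^^ n) p t \<partial>lborel)"
    by (rule gauss_poly_by_parts[OF rapid_has_deriv[OF p] rapid_isCont[OF p], where B = "max B1 B2"])
       (use B1 B2 in \<open>auto simp: le_max_iff_disj\<close>)
  then show ?case using Suc.IH[of "gp_deriv P"] by (simp add: funpow_swap1)
qed simp

definition sdiff :: "(real \<Rightarrow> real) \<Rightarrow> real \<Rightarrow> real \<Rightarrow> real" where
  "sdiff q t s = indicator {0<..} s * ((q (t + s) - q (t - s)) / s)"

definition sdiff_int :: "(real \<Rightarrow> real) \<Rightarrow> real \<Rightarrow> real" where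
  "sdiff_int q t = (\<integral>s. sdiff q t s \<partial>lborel)"

definition lip_decay :: "real \<Rightarrow> (real \<Rightarrow> real) \<Rightarrow> bool" where
  "lip_decay B q \<longleftrightarrow> (\<forall>x y. \<bar>q x - q y\<bar> \<le> B * \<bar>x - y\<bar>) \<and> (\<forall>x. \<bar>q x\<bar> \<le> B / (1 + x\<^sup>2))"

lemma lip_decay_nonneg: "lip_decay B q \<Longrightarrow> 0 \<le> B"
  unfolding lip_decay_def using abs_ge_zero[of "q 0"] by (metis add_0_right div_by_1 order_trans power_zero_numeral)

lemma lip_decay_measurable: "lip_decay B q \<Longrightarrow> q \<in> borel_measurable borel"
  using lip_decay_nonneg[of B q]
  by (intro borel_measurable_continuous_onI lipschitz_on_continuous_on[of B] lipschitz_onI)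
     (auto simp: lip_decay_def dist_real_def)

lemma sdiff_measurable [measurable]:
  assumes [measurable]: "q \<in> borel_measurable borel"
  shows "(\<lambda>(t, s). sdiff q t s) \<in> borel_measurable (borel \<Otimes>\<^sub>M borel)"
  unfolding sdiff_def by measurable

lemma sdiff_measurable' [measurable]:
  assumes [measurable]: "q \<in> borel_measurable borel"
  shows "sdiff q t \<in> borel_measurable borel"
  unfolding sdiff_def by measurable

lemma sdiff_int_measurable [measurable]:
  assumes [measurable]: "q \<in> borel_measurable borel"
  shows "sdiff_int q \<in> borel_measurable borel"
  unfolding sdiff_int_def by measurable

lemma sdiff_bound:
  assumes q: "lip_decay B q"
  shows "\<bar>sdiff q t s\<bar> \<le> 4 * B * (1 / (1 + s\<^sup>2)) + B * (1 / (1 + (t + s)\<^sup>2)) + B * (1 / (1 + (t - s)\<^sup>2))"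
proof -
  have B: "0 \<le> B" by (rule lip_decay_nonneg[OF q])
  have nn: "0 \<le> B * (1 / (1 + x\<^sup>2))" for x using B by (simp add: less_imp_le)
  consider "s \<le> 0" | "0 < s" "s \<le> 1" | "1 < s" by linarith
  then show ?thesis
  proof cases
    case 1
    then show ?thesis using nn[of s] nn[of "t+s"] nn[of "t-s"] by (simp add: sdiff_def)
  next
    case 2
    have "\<bar>q (t + s) - q (t - s)\<bar> \<le> B * \<bar>(t + s) - (t - s)\<bar>" using q unfolding lip_decay_def by blast
    also have "\<dots> = 2 * B * s" using 2 by simp
    finally have "\<bar>sdiff q t s\<bar> \<le> 2 * B"
      using 2 by (simp add: sdiff_def divide_le_eq abs_mult)
    also have "2 * B \<le> 4 * B * (1 / (1 + s\<^sup>2))"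
    proof -
      have "s\<^sup>2 \<le> 1" using 2 by (simp add: power_le_one)
      then have "B * s\<^sup>2 \<le> B" using mult_left_mono[OF _ B, of "s\<^sup>2" 1] by simp
      then show ?thesis by (simp add: le_divide_eq algebra_simps)
    qed
    finally show ?thesis using nn[of "t+s"] nn[of "t-s"] by linarith
  next
    case 3
    have "\<bar>sdiff q t s\<bar> = \<bar>q (t + s) - q (t - s)\<bar> / s" using 3 by (simp add: sdiff_def)
    also have "\<dots> \<le> \<bar>q (t + s) - q (t - s)\<bar> / 1" using 3 by (intro divide_left_mono) auto
    also have "\<dots> \<le> \<bar>q (t + s)\<bar> + \<bar>q (t - s)\<bar>" by simp
    also have "\<dots> \<le> B / (1 + (t + s)\<^sup>2) + B / (1 + (t - s)\<^sup>2)"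
      using q unfolding lip_decay_def by (intro add_mono) blast+
    finally show ?thesis using nn[of s] by simp
  qed
qed

lemma integrable_shift_inv:
  "integrable lborel (\<lambda>s::real. 1 / (1 + (t + s)\<^sup>2))" "integrable lborel (\<lambda>s::real. 1 / (1 + (t - s)\<^sup>2))"
  "(\<integral>s. 1 / (1 + (t + s)\<^sup>2) \<partial>lborel) = pi" "(\<integral>s. 1 / (1 + (t - s)\<^sup>2) \<partial>lborel) = pi"
proof -
  note i = integrable_inv_one_plus_sq
  show "integrable lborel (\<lambda>s::real. 1 / (1 + (t + s)\<^sup>2))"
    using lborel_integrable_real_affine[OF i, of 1 t] by simp
  show "integrable lborel (\<lambda>s::real. 1 / (1 + (t - s)\<^sup>2))"
    using lborel_integrable_real_affine[OF i, of "-1" t] by simp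
  show "(\<integral>s. 1 / (1 + (t + s)\<^sup>2) \<partial>lborel) = pi"
    using lborel_integral_real_affine[of 1 "\<lambda>x. 1 / (1 + x\<^sup>2)" t] integral_inv_one_plus_sq by simp
  show "(\<integral>s. 1 / (1 + (t - s)\<^sup>2) \<partial>lborel) = pi"
    using lborel_integral_real_affine[of "-1" "\<lambda>x. 1 / (1 + x\<^sup>2)" t] integral_inv_one_plus_sq by simp
qed

lemma integrable_sdiff:
  assumes q: "lip_decay B q"
  shows "integrable lborel (sdiff q t)"
proof (rule Bochner_Integration.integrable_bound)
  show "integrable lborel (\<lambda>s. 4 * B * (1 / (1 + s\<^sup>2)) + B * (1 / (1 + (t + s)\<^sup>2)) + B * (1 / (1 + (t - s)\<^sup>2)))"
    by (intro Bochner_Integration.integrable_add integrable_mult_right integrable_inv_one_plus_sq integrable_shift_inv)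
  show "AE s in lborel. norm (sdiff q t s) \<le> norm (4 * B * (1 / (1 + s\<^sup>2)) + B * (1 / (1 + (t + s)\<^sup>2)) + B * (1 / (1 + (t - s)\<^sup>2)))"
    by (rule AE_I2, unfold real_norm_def, rule order_trans[OF sdiff_bound[OF q] abs_ge_self])
qed (use lip_decay_measurable[OF q] in measurable)

lemma sdiff_int_bound:
  assumes q: "lip_decay B q"
  shows "\<bar>sdiff_int q t\<bar> \<le> 6 * pi * B"
proof -
  have "\<bar>sdiff_int q t\<bar> \<le> (\<integral>s. \<bar>sdiff q t s\<bar> \<partial>lborel)"
    unfolding sdiff_int_def by (rule integral_abs_bound)
  also have "\<dots> \<le> (\<integral>s. 4 * B * (1 / (1 + s\<^sup>2)) + B * (1 / (1 + (t + s)\<^sup>2)) + B * (1 / (1 + (t - s)\<^sup>2)) \<partial>lborel)"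
    by (intro integral_mono integrable_abs integrable_sdiff[OF q] sdiff_bound[OF q]
         Bochner_Integration.integrable_add integrable_mult_right integrable_inv_one_plus_sq integrable_shift_inv)
  also have "\<dots> = 4 * B * pi + B * pi + B * pi"
    by (subst Bochner_Integration.integral_add, (intro Bochner_Integration.integrable_add integrable_mult_right integrable_inv_one_plus_sq integrable_shift_inv)+,
        subst Bochner_Integration.integral_add, (intro integrable_mult_right integrable_inv_one_plus_sq integrable_shift_inv)+,
        simp only: integral_mult_right_zero integral_inv_one_plus_sq integrable_shift_inv)
  finally show ?thesis by (simp add: algebra_simps)
qed

lemma hilbert_eq_sdiff_int:
  assumes q: "lip_decay B q"
  shows "hilbert q t = - (1 / pi) * sdiff_int q t"
proof -
  note [measurable] = lip_decay_measurable[OF q]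
  have trunc: "(\<integral>s\<in>{s. \<epsilon> < \<bar>s\<bar>}. q (t - s) / s \<partial>lborel) = - (\<integral>s. indicator {\<epsilon><..} s * sdiff q t s \<partial>lborel)"
    if \<epsilon>: "\<epsilon> > 0" for \<epsilon>
  proof -
    define g where "g s = indicator {\<epsilon><..} s * (q (t - s) / s)" for s
    define k where "k s = indicator {\<epsilon><..} s * (q (t + s) / s)" for s
    have bnd: "\<bar>indicator {\<epsilon><..} s * (q x / s)\<bar> \<le> (1 / \<epsilon>) * (B * (1 / (1 + x\<^sup>2)))" for s x
    proof (cases "s > \<epsilon>")
      case True
      have "\<bar>q x\<bar> / s \<le> (B / (1 + x\<^sup>2)) / \<epsilon>"
        using True \<epsilon> q lip_decay_nonneg[OF q] by (intro frac_le) (auto simp: lip_decay_def)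
      then show ?thesis using True \<epsilon> by (simp add: mult.commute)
    qed (use \<epsilon> lip_decay_nonneg[OF q] in simp)
    have gi: "integrable lborel g"
    proof (rule Bochner_Integration.integrable_bound[OF integrable_mult_right[OF integrable_mult_right[OF integrable_shift_inv(2)[of t], of B], of "1/\<epsilon>"]])
      show "g \<in> borel_measurable lborel" unfolding g_def by measurable
    qed (rule AE_I2, unfold g_def real_norm_def, rule order_trans[OF bnd abs_ge_self])
    have ki: "integrable lborel k"
    proof (rule Bochner_Integration.integrable_bound[OF integrable_mult_right[OF integrable_mult_right[OF integrable_shift_inv(1)[of t], of B], of "1/\<epsilon>"]])
      show "k \<in> borel_measurable lborel" unfolding k_def by measurable
    qed (rule AE_I2, unfold k_def real_norm_def, rule order_trans[OF bnd abs_ge_self])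
    have "(\<integral>s\<in>{s. \<epsilon> < \<bar>s\<bar>}. q (t - s) / s \<partial>lborel) = (\<integral>s. g s + - k (- s) \<partial>lborel)"
      unfolding set_lebesgue_integral_def
      by (intro Bochner_Integration.integral_cong refl) (use \<epsilon> in \<open>auto simp: g_def k_def split: split_indicator\<close>)
    also have "\<dots> = (\<integral>s. g s \<partial>lborel) - (\<integral>s. k (- s) \<partial>lborel)"
      using gi lborel_integrable_real_affine[OF ki, of "-1" 0] by (subst Bochner_Integration.integral_add) simp_all
    also have "(\<integral>s. k (- s) \<partial>lborel) = (\<integral>s. k s \<partial>lborel)"
      using lborel_integral_real_affine[of "-1" k 0] by simp
    also have "(\<integral>s. g s \<partial>lborel) - (\<integral>s. k s \<partial>lborel) = (\<integral>s. - (indicator {\<epsilon><..} s * sdiff q t s) \<partial>lborel)"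
      by (subst Bochner_Integration.integral_diff[OF gi ki, symmetric])
         (intro Bochner_Integration.integral_cong refl, use \<epsilon> in \<open>simp add: g_def k_def sdiff_def diff_divide_distrib split: split_indicator\<close>)
    finally show ?thesis by simp
  qed
  have "((\<lambda>\<epsilon>. \<integral>s. indicator {\<epsilon><..} s * sdiff q t s \<partial>lborel) \<longlongrightarrow> sdiff_int q t) (at_right 0)"
    unfolding filterlim_at_right_to_top sdiff_int_def
  proof (rule integral_dominated_convergence_at_top[where w = "\<lambda>s. \<bar>sdiff q t s\<bar>"])
    show "AE s in lborel. ((\<lambda>x. indicator {inverse x<..} s * sdiff q t s) \<longlongrightarrow> sdiff q t s) at_top"
    proof (rule AE_I2)
      fix s :: real
      have "\<forall>\<^sub>F x in at_top. indicator {inverse x<..} s * sdiff q t s = sdiff q t s"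
      proof (cases "s > 0")
        case True
        show ?thesis using eventually_gt_at_top[of "max 0 (inverse s)"]
        proof eventually_elim
          case (elim x)
          then have "inverse x < inverse (inverse s)" using True by (intro less_imp_inverse_less) auto
          then have "inverse x < s" by simp
          then show ?case by simp
        qed
      qed (simp add: sdiff_def)
      then show "((\<lambda>x. indicator {inverse x<..} s * sdiff q t s) \<longlongrightarrow> sdiff q t s) at_top"
        by (rule tendsto_eventually)
    qed
    show "\<forall>\<^sub>F x in at_top. AE s in lborel. norm (indicator {inverse x<..} s * sdiff q t s) \<le> \<bar>sdiff q t s\<bar>"
      by (intro always_eventually allI AE_I2) (auto split: split_indicator)
  qed (auto intro!: integrable_sdiff[OF q] integrable_abs)
  then have "((\<lambda>\<epsilon>. (1 / pi) * (- (\<integral>s. indicator {\<epsilon><..} s * sdiff q t s \<partial>lborel))) \<longlongrightarrow> (1 / pi) * (- sdiff_int q t)) (at_right 0)"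
    by (intro tendsto_intros)
  moreover have "\<forall>\<^sub>F \<epsilon> in at_right 0. (1 / pi) * (- (\<integral>s. indicator {\<epsilon><..} s * sdiff q t s \<partial>lborel))
      = (1 / pi) * (\<integral>s\<in>{s. \<epsilon> < \<bar>s\<bar>}. q (t - s) / s \<partial>lborel)"
    by (rule eventually_mono[OF eventually_at_right_less[of 0]]) (simp add: trunc)
  ultimately have "((\<lambda>\<epsilon>. (1 / pi) * (\<integral>s\<in>{s. \<epsilon> < \<bar>s\<bar>}. q (t - s) / s \<partial>lborel)) \<longlongrightarrow> (1 / pi) * (- sdiff_int q t)) (at_right 0)"
    by (rule Lim_transform_eventually)
  then have "hilbert q t = (1 / pi) * (- sdiff_int q t)" unfolding hilbert_def
    by (rule tendsto_Lim[rotated]) simp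
  then show ?thesis by simp
qed

lemma integrable_pair_inv:
  "integrable (lborel \<Otimes>\<^sub>M lborel) (\<lambda>(t::real, s::real). c * (1 / (1 + t\<^sup>2) * (1 / (1 + s\<^sup>2))))"
proof (rule lborel_pair.Fubini_integrable)
  show "integrable lborel (\<lambda>t. \<integral>s. norm (case (t, s) of (t, s) \<Rightarrow> c * (1 / (1 + t\<^sup>2) * (1 / (1 + s\<^sup>2)))) \<partial>lborel)"
    using integrable_mult_right[OF integrable_inv_one_plus_sq, of "\<bar>c\<bar> * pi"] integral_inv_one_plus_sq
    by (simp add: abs_mult mult.assoc del: times_divide_eq_right times_divide_eq_left mult_divide_mult_cancel_left_if)
  show "AE t in lborel. integrable lborel (\<lambda>s. case (t, s) of (t, s) \<Rightarrow> c * (1 / (1 + t\<^sup>2) * (1 / (1 + s\<^sup>2))))"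
    unfolding split by (intro AE_I2 integrable_mult_right integrable_inv_one_plus_sq)
qed measurable

lemma sdiff_Fubini:
  assumes [measurable]: "F \<in> borel_measurable borel" and F: "\<And>t. \<bar>F t\<bar> \<le> A / (1 + t\<^sup>2)\<^sup>2" and q: "lip_decay B q"
  shows "(\<integral>t. F t * sdiff_int q t \<partial>lborel) = (\<integral>s. \<integral>t. F t * sdiff q t s \<partial>lborel \<partial>lborel)"
proof -
  note [measurable] = lip_decay_measurable[OF q]
  have B: "0 \<le> B" by (rule lip_decay_nonneg[OF q])
  have A: "0 \<le> A" using F[of 0] by (simp add: order_trans[OF abs_ge_zero])
  define a where "a x = 1 / (1 + x\<^sup>2)" for x :: real
  have a: "0 < a x" "a x \<le> 1" for x by (auto simp: a_def)
  have key: "\<bar>F t * sdiff q t s\<bar> \<le> (8 * A * B) * (a t * a s)" for t s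
  proof -
    have "\<bar>F t\<bar> \<le> A * (a t * a t)" using F[of t] by (simp add: a_def power2_eq_square)
    moreover have "\<bar>sdiff q t s\<bar> \<le> 4 * B * a s + B * a (t + s) + B * a (t - s)"
      using sdiff_bound[OF q, of t s] by (simp add: a_def)
    ultimately have "\<bar>F t * sdiff q t s\<bar> \<le> A * (a t * a t) * (4 * B * a s + B * a (t + s) + B * a (t - s))"
      unfolding abs_mult using A a(1)[of t] by (intro mult_mono) auto
    also have "\<dots> = (A * B * a t) * (4 * (a t * a s) + a t * a (t + s) + a t * a (t - s))" by (simp add: algebra_simps)
    also have "\<dots> \<le> (A * B * a t) * (4 * a s + 2 * a s + 2 * a s)"
    proof (intro mult_left_mono add_mono)
      show "a t * a s \<le> a s" using a[of t] a(1)[of s] by simp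
      show "a t * a (t + s) \<le> 2 * a s" "a t * a (t - s) \<le> 2 * a s"
        using inv_one_plus_sq_mult_le[of t s] by (simp_all add: a_def)
    qed (use A B a(1)[of t] in auto)
    finally show ?thesis by (simp add: algebra_simps)
  qed
  have int: "integrable (lborel \<Otimes>\<^sub>M lborel) (\<lambda>(t, s). F t * sdiff q t s)"
  proof (rule Bochner_Integration.integrable_bound[OF integrable_pair_inv[of "8 * A * B"]])
    show "(\<lambda>(t, s). F t * sdiff q t s) \<in> borel_measurable (lborel \<Otimes>\<^sub>M lborel)" by measurable
    show "AE z in lborel \<Otimes>\<^sub>M lborel. norm (case z of (t, s) \<Rightarrow> F t * sdiff q t s)
       \<le> norm (case z of (t, s) \<Rightarrow> 8 * A * B * (1 / (1 + t\<^sup>2) * (1 / (1 + s\<^sup>2))))"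
      by (rule AE_I2, unfold split_beta real_norm_def, rule order_trans[OF key[unfolded a_def] abs_ge_self])
  qed
  have "(\<integral>t. F t * sdiff_int q t \<partial>lborel) = (\<integral>t. \<integral>s. F t * sdiff q t s \<partial>lborel \<partial>lborel)"
    by (simp add: sdiff_int_def)
  also have "\<dots> = (\<integral>s. \<integral>t. F t * sdiff q t s \<partial>lborel \<partial>lborel)"
    using lborel_pair.Fubini_integral[OF int] by simp
  finally show ?thesis .
qed


lemma lip_decayI:
  assumes d: "\<And>t. (q has_real_derivative q' t) (at t)" and b: "\<And>t. \<bar>q' t\<bar> \<le> B"
    and c: "\<And>t. \<bar>q t\<bar> \<le> B / (1 + t\<^sup>2)"
  shows "lip_decay B q"
  unfolding lip_decay_def
proof (intro conjI allI c)
  fix x y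
  show "\<bar>q x - q y\<bar> \<le> B * \<bar>x - y\<bar>"
    using field_differentiable_bound[of UNIV q q' B x y] d b by auto
qed

lemma lip_decay_gauss_poly: "\<exists>B. lip_decay B (gauss_poly P)"
proof -
  obtain A where A: "A \<ge> 0" "\<And>t. \<bar>gauss_poly P t\<bar> \<le> A / (1 + t\<^sup>2)\<^sup>2" using gauss_poly_decay by blast
  obtain A' where A': "A' \<ge> 0" "\<And>t. \<bar>gauss_poly (gp_deriv P) t\<bar> \<le> A'" using gauss_poly_bounded by blast
  have "lip_decay (A + A') (gauss_poly P)"
  proof (rule lip_decayI[OF gauss_poly_has_deriv])
    show "\<bar>gauss_poly (gp_deriv P) t\<bar> \<le> A + A'" for t using A'(2)[of t] A by linarith
    show "\<bar>gauss_poly P t\<bar> \<le> (A + A') / (1 + t\<^sup>2)" for t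
    proof -
      have "\<bar>gauss_poly P t\<bar> \<le> A / (1 + t\<^sup>2)" using A(2)[of t] inv_sq_le[OF A(1), of t] by linarith
      also have "\<dots> \<le> (A + A') / (1 + t\<^sup>2)" using A' by (intro divide_right_mono) (auto simp: less_imp_le)
      finally show ?thesis .
    qed
  qed
  then show ?thesis ..
qed

lemma lip_decay_rapid:
  assumes p: "rapid p"
  shows "\<exists>B. lip_decay B ((deriv ^^ n) p)"
proof -
  obtain A where A: "A \<ge> 0" "\<And>t. \<bar>(deriv ^^ n) p t\<bar> \<le> A / (1 + t\<^sup>2)\<^sup>2" using rapid_decay[OF p] by blast
  obtain A' where A': "A' \<ge> 0" "\<And>t. \<bar>(deriv ^^ Suc n) p t\<bar> \<le> A'" using rapid_bounded[OF p] by blast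
  have "lip_decay (A + A') ((deriv ^^ n) p)"
  proof (rule lip_decayI[OF rapid_has_deriv[OF p]])
    show "\<bar>(deriv ^^ Suc n) p t\<bar> \<le> A + A'" for t using A'(2)[of t] A by linarith
    show "\<bar>(deriv ^^ n) p t\<bar> \<le> (A + A') / (1 + t\<^sup>2)" for t
    proof -
      have "\<bar>(deriv ^^ n) p t\<bar> \<le> A / (1 + t\<^sup>2)" using A(2)[of t] inv_sq_le[OF A(1), of t] by linarith
      also have "\<dots> \<le> (A + A') / (1 + t\<^sup>2)" using A' by (intro divide_right_mono) (auto simp: less_imp_le)
      finally show ?thesis .
    qed
  qed
  then show ?thesis ..
qed

lemma hilbert_pairing:
  assumes p: "rapid p"
  shows "(\<integral>t. gauss_poly P t * hilbert ((deriv ^^ n) p) t \<partial>lborel)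
       = (\<integral>t. ((-1) ^ n * (1 / pi) * sdiff_int (gauss_poly ((gp_deriv ^^ n) P)) t) * p t \<partial>lborel)"
proof -
  define q where "q = (deriv ^^ n) p"
  define u where "u = gauss_poly ((gp_deriv ^^ n) P)"
  obtain B where B: "lip_decay B q" using lip_decay_rapid[OF p] unfolding q_def by blast
  obtain B' where B': "lip_decay B' u" using lip_decay_gauss_poly unfolding u_def by blast
  obtain A where A: "\<And>t. \<bar>gauss_poly P t\<bar> \<le> A / (1 + t\<^sup>2)\<^sup>2" using gauss_poly_decay by blast
  obtain A' where A': "\<And>t. \<bar>p t\<bar> \<le> A' / (1 + t\<^sup>2)\<^sup>2" using rapid_decay[OF p, of 0] by auto
  have pm[measurable]: "p \<in> borel_measurable borel" using rapid_measurable[OF p, of 0] by simp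
  obtain Bq where Bq: "\<And>t. \<bar>q t\<bar> \<le> Bq" unfolding q_def using rapid_bounded[OF p] by blast
  obtain Bp where Bp: "\<And>t. \<bar>p t\<bar> \<le> Bp" using rapid_bounded[OF p, of 0] by auto
  note [measurable] = lip_decay_measurable[OF B] lip_decay_measurable[OF B']
  have shift: "(\<integral>t. gauss_poly P t * q (s + t) \<partial>lborel) = (-1) ^ n * (\<integral>t. u (t - s) * p t \<partial>lborel)" for s
  proof -
    have r: "rapid (\<lambda>t. p (s + 1 * t))" by (rule rapid_affine[OF p]) simp
    have "(deriv ^^ n) (\<lambda>t. p (s + 1 * t)) = (\<lambda>t. 1 ^ n * (deriv ^^ n) p (s + 1 * t))"
      using p by (intro deriv_funpow_affine) (auto simp: rapid_def)
    then have "(\<integral>t. gauss_poly P t * q (s + t) \<partial>lborel) = (-1) ^ n * (\<integral>t. u t * p (s + t) \<partial>lborel)"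
      using gauss_poly_by_parts_iter[OF r, of P n] by (simp add: q_def u_def)
    also have "(\<integral>t. u t * p (s + t) \<partial>lborel) = (\<integral>t. u (t - s) * p t \<partial>lborel)"
      using lborel_integral_real_affine[of 1 "\<lambda>t. u (t - s) * p t" s] by simp
    finally show ?thesis .
  qed
  have gi: "integrable lborel (\<lambda>t. gauss_poly P t * q (s + t))" for s
    by (rule integrable_gauss_poly_mult[where B = Bq]) (auto simp: Bq)
  have ui: "integrable lborel (\<lambda>t. u (t - s) * p t)" for s
  proof -
    have "integrable lborel (\<lambda>t. u t * p (s + t))"
      unfolding u_def by (rule integrable_gauss_poly_mult[where B = Bp]) (auto simp: Bp)
    from lborel_integrable_real_affine[OF this, of 1 "-s"] show ?thesis by simp
  qed
  have inner: "(\<integral>t. gauss_poly P t * sdiff q t s \<partial>lborel) = - ((-1) ^ n * (\<integral>t. p t * sdiff u t s \<partial>lborel))" for s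
  proof (cases "s > 0")
    case True
    have "(\<integral>t. gauss_poly P t * sdiff q t s \<partial>lborel) = (\<integral>t. (gauss_poly P t * q (s + t) - gauss_poly P t * q (- s + t)) / s \<partial>lborel)"
      using True by (intro Bochner_Integration.integral_cong) (auto simp: sdiff_def algebra_simps)
    also have "\<dots> = ((\<integral>t. gauss_poly P t * q (s + t) \<partial>lborel) - (\<integral>t. gauss_poly P t * q (- s + t) \<partial>lborel)) / s"
      using gi[of s] gi[of "-s"] by simp
    also have "\<dots> = - ((-1) ^ n * (((\<integral>t. u (t - - s) * p t \<partial>lborel) - (\<integral>t. u (t - s) * p t \<partial>lborel)) / s))"
      unfolding shift using True by (simp add: field_simps)
    also have "((\<integral>t. u (t - - s) * p t \<partial>lborel) - (\<integral>t. u (t - s) * p t \<partial>lborel)) / s = (\<integral>t. (u (t - - s) * p t - u (t - s) * p t) / s \<partial>lborel)"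
      using ui[of s] ui[of "-s"] by simp
    also have "\<dots> = (\<integral>t. p t * sdiff u t s \<partial>lborel)"
      using True by (intro Bochner_Integration.integral_cong) (auto simp: sdiff_def algebra_simps)
    finally show ?thesis .
  qed (simp add: sdiff_def)
  have "(\<integral>t. gauss_poly P t * hilbert q t \<partial>lborel) = - (1 / pi) * (\<integral>t. gauss_poly P t * sdiff_int q t \<partial>lborel)"
    unfolding hilbert_eq_sdiff_int[OF B] by (subst integral_mult_right_zero[symmetric]) (simp add: mult_ac)
  also have "(\<integral>t. gauss_poly P t * sdiff_int q t \<partial>lborel) = (\<integral>s. \<integral>t. gauss_poly P t * sdiff q t s \<partial>lborel \<partial>lborel)"
    by (rule sdiff_Fubini[OF _ A B]) measurable
  also have "\<dots> = - ((-1) ^ n * (\<integral>s. \<integral>t. p t * sdiff u t s \<partial>lborel \<partial>lborel))"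
    unfolding inner by simp
  also have "(\<integral>s. \<integral>t. p t * sdiff u t s \<partial>lborel \<partial>lborel) = (\<integral>t. p t * sdiff_int u t \<partial>lborel)"
    by (rule sdiff_Fubini[OF _ A' B', symmetric]) measurable
  also have "- (1 / pi) * - ((-1) ^ n * (\<integral>t. p t * sdiff_int u t \<partial>lborel)) = (\<integral>t. ((-1) ^ n * (1 / pi) * sdiff_int u t) * p t \<partial>lborel)"
  proof -
    have "(\<integral>t. ((-1) ^ n * (1 / pi) * sdiff_int u t) * p t \<partial>lborel) = (\<integral>t. ((-1) ^ n * (1 / pi)) * (p t * sdiff_int u t) \<partial>lborel)"
      by (simp only: mult_ac)
    also have "\<dots> = ((-1) ^ n * (1 / pi)) * (\<integral>t. p t * sdiff_int u t \<partial>lborel)"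
      by (rule integral_mult_right_zero)
    finally show ?thesis by simp
  qed
  finally show ?thesis unfolding q_def u_def .
qed

lemma mult_sdiff_int_gauss_poly:
  "t * sdiff_int (gauss_poly P) t = sdiff_int (gauss_poly ([:0, 1:] * P)) t - (\<integral>s. gauss_poly P s \<partial>lborel)"
proof -
  define u where "u = gauss_poly P"
  define Y where "Y = gauss_poly ([:0, 1:] * P)"
  have Y: "Y x = x * u x" for x by (simp add: Y_def u_def gauss_poly_def)
  obtain B where B: "lip_decay B u" using lip_decay_gauss_poly unfolding u_def by blast
  obtain B' where B': "lip_decay B' Y" using lip_decay_gauss_poly unfolding Y_def by blast
  have ui: "integrable lborel u" unfolding u_def by (rule integrable_gauss_poly)
  have u1: "integrable lborel (\<lambda>s. u (t + s))" using lborel_integrable_real_affine[OF ui, of 1 t] by simp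
  have u2: "integrable lborel (\<lambda>s. u (t - s))" using lborel_integrable_real_affine[OF ui, of "-1" t] by simp
  have i1: "integrable lborel (\<lambda>s. indicator {0<..} s * u (t + s))"
    using integrable_mult_indicator[OF _ u1, of "{0<..}"] by simp
  have i2: "integrable lborel (\<lambda>s. indicator {0<..} s * u (t - s))"
    using integrable_mult_indicator[OF _ u2, of "{0<..}"] by simp
  have i3: "integrable lborel (\<lambda>s. indicator {..<0} s * u (t + s))"
    using integrable_mult_indicator[OF _ u1, of "{..<0}"] by simp
  have "t * sdiff_int u t = (\<integral>s. t * sdiff u t s \<partial>lborel)" by (simp add: sdiff_int_def)
  also have "\<dots> = (\<integral>s. sdiff Y t s - (indicator {0<..} s * u (t + s) + indicator {0<..} s * u (t - s)) \<partial>lborel)"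
  proof (intro Bochner_Integration.integral_cong refl)
    fix s
    have "t * ((a - b) / s) = ((t + s) * a - (t - s) * b) / s - (a + b)" if "s > 0" for a b
      using that by (simp add: field_simps)
    then show "t * sdiff u t s = sdiff Y t s - (indicator {0<..} s * u (t + s) + indicator {0<..} s * u (t - s))"
      by (simp add: sdiff_def Y split: split_indicator)
  qed
  also have "\<dots> = sdiff_int Y t - ((\<integral>s. indicator {0<..} s * u (t + s) \<partial>lborel) + (\<integral>s. indicator {0<..} s * u (t - s) \<partial>lborel))"
    using i1 i2 integrable_sdiff[OF B', of t] by (simp add: sdiff_int_def)
  also have "(\<integral>s. indicator {0<..} s * u (t - s) \<partial>lborel) = (\<integral>s. indicator {..<0} s * u (t + s) \<partial>lborel)"
    by (subst lborel_integral_real_affine[of "-1" _ 0])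
       (auto intro!: Bochner_Integration.integral_cong split: split_indicator)
  also have "(\<integral>s. indicator {0<..} s * u (t + s) \<partial>lborel) + (\<integral>s. indicator {..<0} s * u (t + s) \<partial>lborel)
     = (\<integral>s. indicator {0<..} s * u (t + s) + indicator {..<0} s * u (t + s) \<partial>lborel)"
    using i1 i3 by simp
  also have "\<dots> = (\<integral>s. u (t + s) \<partial>lborel)"
  proof (rule integral_cong_AE)
    show "AE s in lborel. indicator {0<..} s * u (t + s) + indicator {..<0} s * u (t + s) = u (t + s)"
      using AE_lborel_singleton[of "0::real"] by eventually_elim (auto split: split_indicator)
  qed (use i1 i3 u1 in auto)
  also have "\<dots> = (\<integral>s. u s \<partial>lborel)"
    using lborel_integral_real_affine[of 1 u t] by simp
  finally show ?thesis unfolding u_def Y_def .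
qed

lemma sdiff_int_gauss_poly_decay:
  "\<exists>B. \<forall>t. \<bar>sdiff_int (gauss_poly (gp_deriv P)) t\<bar> \<le> B / (1 + t\<^sup>2)"
proof -
  define Q where "Q = gp_deriv P"
  define m where "m = (\<integral>s. gauss_poly ([:0, 1:] * Q) s \<partial>lborel)"
  obtain B1 where B1: "lip_decay B1 (gauss_poly Q)" using lip_decay_gauss_poly by blast
  obtain B2 where B2: "lip_decay B2 (gauss_poly ([:0, 1:] * ([:0, 1:] * Q)))" using lip_decay_gauss_poly by blast
  have "\<bar>sdiff_int (gauss_poly Q) t\<bar> \<le> (6 * pi * B1 + 6 * pi * B2 + \<bar>m\<bar>) / (1 + t\<^sup>2)" for t
  proof -
    have "t * sdiff_int (gauss_poly Q) t = sdiff_int (gauss_poly ([:0, 1:] * Q)) t"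
      using mult_sdiff_int_gauss_poly[of t Q] integral_gauss_poly_gp_deriv[of P] by (simp add: Q_def)
    then have "t\<^sup>2 * sdiff_int (gauss_poly Q) t = sdiff_int (gauss_poly ([:0, 1:] * ([:0, 1:] * Q))) t - m"
      using mult_sdiff_int_gauss_poly[of t "[:0, 1:] * Q"] by (simp add: m_def power2_eq_square mult.assoc)
    then have "\<bar>t\<^sup>2 * sdiff_int (gauss_poly Q) t\<bar> \<le> 6 * pi * B2 + \<bar>m\<bar>"
      using sdiff_int_bound[OF B2, of t] by linarith
    moreover have "\<bar>sdiff_int (gauss_poly Q) t\<bar> \<le> 6 * pi * B1" by (rule sdiff_int_bound[OF B1])
    ultimately have "(1 + t\<^sup>2) * \<bar>sdiff_int (gauss_poly Q) t\<bar> \<le> 6 * pi * B1 + 6 * pi * B2 + \<bar>m\<bar>"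
      by (simp add: abs_mult algebra_simps)
    then show ?thesis by (simp add: le_divide_eq mult.commute)
  qed
  then show ?thesis unfolding Q_def by blast
qed

text \<open>The operator \<open>\<Lambda>\<^sup>d\<^sup>-\<^sup>1 \<partial>\<^sub>t\<^sup>2\<close> on functions of one variable.\<close>
definition Lop1 :: "nat \<Rightarrow> (real \<Rightarrow> real) \<Rightarrow> real \<Rightarrow> real" where
  "Lop1 d p t = (if odd d then (-1) ^ ((d - 1) div 2) * (deriv ^^ (d + 1)) p t
      else (-1) ^ ((d - 2) div 2) * hilbert ((deriv ^^ (d + 1)) p) t)"

definition gauss_ker :: "nat \<Rightarrow> real \<Rightarrow> real" where
  "gauss_ker d t = (if odd d then (-1) ^ ((d - 1) div 2) * ((-1) ^ (d + 1) * gauss_poly ((gp_deriv ^^ (d + 1)) 1) t)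
      else (-1) ^ ((d - 2) div 2) * ((-1) ^ (d + 1) * (1 / pi) * sdiff_int (gauss_poly ((gp_deriv ^^ (d + 1)) 1)) t))"

lemma Lop1_pairing:
  assumes p: "rapid p"
  shows "(\<integral>t. exp (- t\<^sup>2 / 2) * Lop1 d p t \<partial>lborel) = (\<integral>t. gauss_ker d t * p t \<partial>lborel)"
proof -
  have e: "exp (- t\<^sup>2 / 2) = gauss_poly 1 t" for t by (simp add: gauss_poly_def)
  show ?thesis
  proof (cases "odd d")
    case True
    have "(\<integral>t. exp (- t\<^sup>2 / 2) * Lop1 d p t \<partial>lborel)
       = (\<integral>t. (-1) ^ ((d - 1) div 2) * (gauss_poly 1 t * (deriv ^^ (d + 1)) p t) \<partial>lborel)"
      unfolding e Lop1_def using True by (simp add: mult_ac)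
    also have "\<dots> = (-1) ^ ((d - 1) div 2) * ((-1) ^ (d + 1) * (\<integral>t. gauss_poly ((gp_deriv ^^ (d + 1)) 1) t * p t \<partial>lborel))"
      by (simp only: integral_mult_right_zero gauss_poly_by_parts_iter[OF p])
    also have "\<dots> = (\<integral>t. gauss_ker d t * p t \<partial>lborel)"
    proof -
      have "gauss_ker d = (\<lambda>t. (-1) ^ ((d - 1) div 2) * ((-1) ^ (d + 1) * gauss_poly ((gp_deriv ^^ (d + 1)) 1) t))"
        using True by (simp add: gauss_ker_def fun_eq_iff)
      then show ?thesis by (simp only: mult.assoc integral_mult_right_zero)
    qed
    finally show ?thesis .
  next
    case False
    have "(\<integral>t. exp (- t\<^sup>2 / 2) * Lop1 d p t \<partial>lborel)
       = (\<integral>t. (-1) ^ ((d - 2) div 2) * (gauss_poly 1 t * hilbert ((deriv ^^ (d + 1)) p) t) \<partial>lborel)"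
      unfolding e Lop1_def using False by (simp add: mult_ac)
    also have "\<dots> = (-1) ^ ((d - 2) div 2) *
        (\<integral>t. ((-1) ^ (d + 1) * (1 / pi) * sdiff_int (gauss_poly ((gp_deriv ^^ (d + 1)) 1)) t) * p t \<partial>lborel)"
      by (simp only: integral_mult_right_zero hilbert_pairing[OF p])
    also have "\<dots> = (\<integral>t. gauss_ker d t * p t \<partial>lborel)"
    proof -
      have "gauss_ker d = (\<lambda>t. (-1) ^ ((d - 2) div 2) * ((-1) ^ (d + 1) * (1 / pi) * sdiff_int (gauss_poly ((gp_deriv ^^ (d + 1)) 1)) t))"
        using False by (simp add: gauss_ker_def fun_eq_iff)
      then show ?thesis by (simp only: mult.assoc integral_mult_right_zero)
    qed
    finally show ?thesis .
  qed
qed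

lemma gauss_ker_measurable [measurable]: "gauss_ker d \<in> borel_measurable borel"
  unfolding gauss_ker_def by measurable

lemma gauss_ker_decay: "\<exists>B\<ge>0. \<forall>t. \<bar>gauss_ker d t\<bar> \<le> B / (1 + t\<^sup>2)"
proof -
  have "\<exists>B. \<forall>t. \<bar>gauss_ker d t\<bar> \<le> B / (1 + t\<^sup>2)"
  proof (cases "odd d")
    case True
    obtain A where A: "A \<ge> 0" "\<And>t. \<bar>gauss_poly ((gp_deriv ^^ (d + 1)) 1) t\<bar> \<le> A / (1 + t\<^sup>2)\<^sup>2" using gauss_poly_decay by blast
    have "\<bar>gauss_ker d t\<bar> \<le> A / (1 + t\<^sup>2)" for t
      using order_trans[OF A(2) inv_sq_le[OF A(1)], of t] True by (simp add: gauss_ker_def abs_mult power_abs)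
    then show ?thesis by blast
  next
    case False
    obtain A where A: "\<And>t. \<bar>sdiff_int (gauss_poly (gp_deriv ((gp_deriv ^^ d) 1))) t\<bar> \<le> A / (1 + t\<^sup>2)"
      using sdiff_int_gauss_poly_decay by blast
    have "\<bar>gauss_ker d t\<bar> \<le> (A / pi) / (1 + t\<^sup>2)" for t
      using divide_right_mono[OF A[of t], of pi] False by (simp add: gauss_ker_def abs_mult power_abs mult.commute)
    then show ?thesis by blast
  qed
  then obtain B where B: "\<And>t. \<bar>gauss_ker d t\<bar> \<le> B / (1 + t\<^sup>2)" by blast
  have "B \<ge> 0" using B[of 0] by simp
  with B show ?thesis by blast
qed

lemma Lop1_affine:
  assumes p: "rapid p" and h: "h > 0"
  shows "Lop1 d (\<lambda>t. p (b + h * t)) t = h ^ (d + 1) * Lop1 d p (b + h * t)"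
proof -
  define q where "q = (deriv ^^ (d + 1)) p"
  have eq: "(deriv ^^ (d + 1)) (\<lambda>t. p (b + h * t)) = (\<lambda>t. h ^ (d + 1) * q (b + h * t))"
    unfolding q_def using p by (intro deriv_funpow_affine) (auto simp: rapid_def)
  obtain B where B: "lip_decay B q" using lip_decay_rapid[OF p] unfolding q_def by blast
  have "rapid (\<lambda>t. p (b + h * t))" using p h by (intro rapid_affine) auto
  then obtain B' where B': "lip_decay B' (\<lambda>t. h ^ (d + 1) * q (b + h * t))" using lip_decay_rapid[of _ "d + 1"] unfolding eq[symmetric] by blast
  have "h ^ (d + 1) * sdiff_int q (b + h * t) = h ^ (d + 1) * (\<bar>h\<bar> * (\<integral>s. sdiff q (b + h * t) (0 + h * s) \<partial>lborel))"
    unfolding sdiff_int_def using h lborel_integral_real_affine[of h "sdiff q (b + h * t)" 0] by simp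
  also have "\<bar>h\<bar> * (\<integral>s. sdiff q (b + h * t) (0 + h * s) \<partial>lborel) = (\<integral>s. h * sdiff q (b + h * t) (h * s) \<partial>lborel)" using h by simp
  also have "\<dots> = (\<integral>s. sdiff (\<lambda>t. q (b + h * t)) t s \<partial>lborel)"
  proof (intro Bochner_Integration.integral_cong refl)
    fix s
    have e: "b + h * t + h * s = b + h * (t + s)" "b + h * t - h * s = b + h * (t - s)" by (simp_all add: algebra_simps)
    show "h * sdiff q (b + h * t) (h * s) = sdiff (\<lambda>t. q (b + h * t)) t s"
      unfolding sdiff_def e using h by (simp add: sdiff_def zero_less_mult_iff split: split_indicator)
  qed
  also have "h ^ (d + 1) * \<dots> = (\<integral>s. h ^ (d + 1) * sdiff (\<lambda>t. q (b + h * t)) t s \<partial>lborel)"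
    by (rule integral_mult_right_zero[symmetric])
  also have "\<dots> = sdiff_int (\<lambda>t. h ^ (d + 1) * q (b + h * t)) t"
    unfolding sdiff_int_def
    by (intro Bochner_Integration.integral_cong refl)
       (simp add: sdiff_def right_diff_distrib diff_divide_distrib split: split_indicator)
  finally have "h ^ (d + 1) * sdiff_int q (b + h * t) = sdiff_int (\<lambda>t. h ^ (d + 1) * q (b + h * t)) t" .
  then have "hilbert (\<lambda>t. h ^ (d + 1) * q (b + h * t)) t = h ^ (d + 1) * hilbert q (b + h * t)"
    unfolding hilbert_eq_sdiff_int[OF B] hilbert_eq_sdiff_int[OF B'] by simp
  then show ?thesis unfolding Lop1_def eq q_def by auto
qed

section \<open>Gaussian marginals\<close>

definition gauss :: "'a::euclidean_space \<Rightarrow> real" where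
  "gauss x = exp (- (norm x)\<^sup>2 / 2)"

lemma gauss_measurable [measurable]: "gauss \<in> borel_measurable borel"
  unfolding gauss_def by measurable

lemma gauss_pos: "0 < gauss x" and gauss_le_1: "gauss x \<le> 1"
  by (auto simp: gauss_def)

lemma norm_sq_eq_sum_Basis: "(norm x)\<^sup>2 = (\<Sum>b\<in>Basis. (x \<bullet> b)\<^sup>2)" for x :: "'a::euclidean_space"
  unfolding power2_norm_eq_inner by (subst euclidean_inner) (simp add: power2_eq_square)

lemma gauss_eq_prod: "gauss x = (\<Prod>b\<in>Basis. exp (- (x \<bullet> b)\<^sup>2 / 2))"
  by (simp add: gauss_def norm_sq_eq_sum_Basis exp_sum[symmetric] sum_negf sum_divide_distrib)

lemma gauss_eq_prod_normal:
  "(1 / sqrt (2 * pi)) ^ DIM('a) * gauss (x :: 'a::euclidean_space) = (\<Prod>b\<in>Basis. std_normal_density (x \<bullet> b))"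
  by (simp add: gauss_eq_prod std_normal_density_def prod_dividef power_one_over)

lemma integrable_gauss: "integrable lborel (gauss :: 'a::euclidean_space \<Rightarrow> real)"
proof (rule integrableI_nonneg)
  have "(\<integral>\<^sup>+x. ennreal (gauss (x::'a)) \<partial>lborel) = (\<integral>\<^sup>+x. (\<Prod>b\<in>Basis. ennreal (exp (- (x \<bullet> b)\<^sup>2 / 2))) \<partial>(lborel :: 'a measure))"
    by (simp add: gauss_eq_prod prod_ennreal)
  also have "\<dots> = (\<Prod>b\<in>(Basis::'a set). (\<integral>\<^sup>+t. ennreal (exp (- t\<^sup>2 / 2)) \<partial>lborel))"
    by (rule nn_integral_lborel_prod) auto
  also have "\<dots> < \<infinity>"
  proof -
    have "integrable lborel (\<lambda>t::real. exp (- t\<^sup>2 / 2))"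
      using integrable_gauss_poly[of 1] by (simp add: gauss_poly_def[abs_def])
    then have "(\<integral>\<^sup>+t. ennreal (exp (- t\<^sup>2 / 2)) \<partial>lborel) < \<infinity>"
      by (simp add: integrable_iff_bounded)
    then show ?thesis by (simp add: power_less_top_ennreal)
  qed
  finally show "(\<integral>\<^sup>+x. ennreal (gauss (x::'a)) \<partial>lborel) < \<infinity>" .
qed (auto simp: gauss_pos less_imp_le)

lemma normal_projection:
  fixes \<gamma> :: "'a::euclidean_space"
  assumes \<gamma>: "norm \<gamma> = 1"
  defines "M \<equiv> PiM (Basis :: 'a set) (\<lambda>_. density lborel (\<lambda>x. ennreal (std_normal_density x)))"
  shows "distributed M lborel (\<lambda>f. \<Sum>b\<in>Basis. (\<gamma> \<bullet> b) * f b) std_normal_density"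
proof -
  let ?N = "density lborel (\<lambda>x. ennreal (std_normal_density x))"
  have pN: "prob_space ?N" by (rule prob_space_normal_density) simp
  interpret prob_space M unfolding M_def by (intro prob_space_PiM pN)
  have co: "distr M borel (\<lambda>f. f b) = ?N" if "b \<in> Basis" for b
  proof -
    have "distr M borel (\<lambda>f. f b) = distr M ?N (\<lambda>f. f b)" by (intro distr_cong) auto
    also have "\<dots> = ?N" unfolding M_def by (rule distr_PiM_component[OF pN that])
    finally show ?thesis .
  qed
  have cm[measurable]: "(\<lambda>f. f b) \<in> borel_measurable M" if "b \<in> Basis" for b
    using measurable_component_singleton[OF that, of "\<lambda>_. ?N"] unfolding M_def by simp
  have indep: "indep_vars (\<lambda>_. borel) (\<lambda>b f. f b) (Basis :: 'a set)"
  proof (subst indep_vars_iff_distr_eq_PiM')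
    have "distr M (Pi\<^sub>M Basis (\<lambda>_. borel)) (\<lambda>x. \<lambda>i\<in>Basis. x i) = distr M M (\<lambda>x. x)"
      by (intro distr_cong) (auto simp: M_def space_PiM PiE_def extensional_restrict intro!: sets_PiM_cong)
    also have "\<dots> = M" by simp
    also have "\<dots> = Pi\<^sub>M Basis (\<lambda>i. distr M borel (\<lambda>f. f i))"
      by (subst (1) M_def) (intro PiM_cong refl, simp add: co)
    finally show "distr M (Pi\<^sub>M Basis (\<lambda>_. borel)) (\<lambda>x. \<lambda>i\<in>Basis. x i) = Pi\<^sub>M Basis (\<lambda>i. distr M borel (\<lambda>f. f i))" .
  qed auto
  define J where "J = {b\<in>Basis. \<gamma> \<bullet> b \<noteq> 0}"
  have J: "finite J" "J \<subseteq> Basis" by (auto simp: J_def)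
  have sumJ: "(\<Sum>b\<in>J. (\<gamma> \<bullet> b)\<^sup>2) = 1"
  proof -
    have "(\<Sum>b\<in>J. (\<gamma> \<bullet> b)\<^sup>2) = (\<Sum>b\<in>Basis. (\<gamma> \<bullet> b)\<^sup>2)"
      by (rule sum.mono_neutral_left) (auto simp: J_def)
    also have "\<dots> = (norm \<gamma>)\<^sup>2" by (simp add: norm_sq_eq_sum_Basis)
    finally show ?thesis using \<gamma> by simp
  qed
  have Jne: "J \<noteq> {}" using sumJ by auto
  have "distributed M lborel (\<lambda>f. \<Sum>b\<in>J. 0 + (\<gamma> \<bullet> b) * f b) (normal_density (\<Sum>b\<in>J. 0 + (\<gamma> \<bullet> b) * 0) (sqrt (\<Sum>b\<in>J. (\<bar>\<gamma> \<bullet> b\<bar> * 1)\<^sup>2)))"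
  proof (rule sum_indep_normal[OF J(1) Jne])
    show "indep_vars (\<lambda>i. borel) (\<lambda>b f. 0 + (\<gamma> \<bullet> b) * f b) J"
      by (rule indep_vars_compose2[OF indep_vars_subset[OF indep J(2)]]) auto
    show "0 < \<bar>\<gamma> \<bullet> b\<bar> * 1" if "b \<in> J" for b using that by (auto simp: J_def)
    show "distributed M lborel (\<lambda>f. 0 + (\<gamma> \<bullet> b) * f b) (\<lambda>x. ennreal (normal_density (0 + (\<gamma> \<bullet> b) * 0) (\<bar>\<gamma> \<bullet> b\<bar> * 1) x))" if b: "b \<in> J" for b
    proof (rule normal_density_affine)
      show "distributed M lborel (\<lambda>x. x b) (\<lambda>x. ennreal (normal_density 0 1 x))"
      proof -
        have "distr M lborel (\<lambda>f. f b) = distr M borel (\<lambda>f. f b)" by (intro distr_cong) auto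
        then show ?thesis unfolding distributed_def using co[of b] cm[of b] b J(2) by auto
      qed
    qed (use b in \<open>auto simp: J_def\<close>)
  qed
  moreover have "(\<Sum>b\<in>J. 0 + (\<gamma> \<bullet> b) * f b) = (\<Sum>b\<in>Basis. (\<gamma> \<bullet> b) * f b)" for f :: "'a \<Rightarrow> real"
    by simp (rule sum.mono_neutral_left, auto simp: J_def)
  ultimately show ?thesis by (simp add: sumJ)
qed

lemma integral_gauss_ridge:
  fixes \<gamma> :: "'a::euclidean_space" and q :: "real \<Rightarrow> real"
  assumes \<gamma>: "norm \<gamma> = 1" and q[measurable]: "q \<in> borel_measurable borel"
  shows "(\<integral>x. gauss x * q (\<gamma> \<bullet> x) \<partial>lborel) = sqrt (2 * pi) ^ (DIM('a) - 1) * (\<integral>t. exp (- t\<^sup>2 / 2) * q t \<partial>lborel)"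
proof -
  let ?N = "density lborel (\<lambda>x. ennreal (std_normal_density x))"
  let ?S = "\<lambda>f. \<Sum>b\<in>(Basis::'a set). f b *\<^sub>R b"
  let ?L = "PiM (Basis :: 'a set) (\<lambda>_. lborel :: real measure)"
  have pN: "prob_space ?N" by (rule prob_space_normal_density) simp
  have S: "\<gamma> \<bullet> ?S f = (\<Sum>b\<in>Basis. (\<gamma> \<bullet> b) * f b)" for f by (simp add: inner_sum_right mult.commute)
  have Sb: "?S f \<bullet> b = f b" if "b \<in> Basis" for f b using that by simp
  have "(\<integral>t. std_normal_density t * q t \<partial>lborel) = (\<integral>f. q (\<Sum>b\<in>Basis. (\<gamma> \<bullet> b) * f b) \<partial>PiM (Basis :: 'a set) (\<lambda>_. ?N))"
    by (rule distributed_integral[OF normal_projection[OF \<gamma>]]) auto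
  also have "PiM (Basis :: 'a set) (\<lambda>_. ?N) = density ?L (\<lambda>f. \<Prod>b\<in>Basis. ennreal (std_normal_density (f b)))"
    by (rule PiM_density_const[OF _ lborel.sigma_finite_measure_axioms _ pN]) auto
  also have "\<dots> = density ?L (\<lambda>f. ennreal (\<Prod>b\<in>Basis. std_normal_density (f b)))"
    by (simp add: prod_ennreal)
  also have "(\<integral>f. q (\<Sum>b\<in>Basis. (\<gamma> \<bullet> b) * f b) \<partial>\<dots>) = (\<integral>f. (\<Prod>b\<in>Basis. std_normal_density (f b)) * q (\<Sum>b\<in>Basis. (\<gamma> \<bullet> b) * f b) \<partial>?L)"
    by (subst integral_real_density) (auto intro!: prod_nonneg)
  also have "\<dots> = (\<integral>f. (1 / sqrt (2 * pi)) ^ DIM('a) * (gauss (?S f) * q (\<gamma> \<bullet> ?S f)) \<partial>?L)"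
    unfolding S mult.assoc[symmetric] gauss_eq_prod_normal by (simp add: Sb)
  also have "\<dots> = (1 / sqrt (2 * pi)) ^ DIM('a) * (\<integral>f. gauss (?S f) * q (\<gamma> \<bullet> ?S f) \<partial>?L)"
    by simp
  also have "(\<integral>f. gauss (?S f) * q (\<gamma> \<bullet> ?S f) \<partial>?L) = (\<integral>x. gauss x * q (\<gamma> \<bullet> x) \<partial>lborel)"
    by (subst lborel_eq, subst integral_distr) auto
  finally have *: "(\<integral>t. std_normal_density t * q t \<partial>lborel) = (1 / sqrt (2 * pi)) ^ DIM('a) * (\<integral>x. gauss x * q (\<gamma> \<bullet> x) \<partial>lborel)" .
  have "(\<integral>t. std_normal_density t * q t \<partial>lborel) = (1 / sqrt (2 * pi)) * (\<integral>t. exp (- t\<^sup>2 / 2) * q t \<partial>lborel)"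
    by (subst integral_mult_right_zero[symmetric]) (simp add: std_normal_density_def)
  moreover have "(\<integral>x. gauss x * q (\<gamma> \<bullet> x) \<partial>lborel) = sqrt (2 * pi) ^ DIM('a) * (\<integral>t. std_normal_density t * q t \<partial>lborel)"
    unfolding * by (simp add: power_one_over)
  ultimately have "(\<integral>x. gauss x * q (\<gamma> \<bullet> x) \<partial>lborel) = sqrt (2 * pi) ^ DIM('a) * ((1 / sqrt (2 * pi)) * (\<integral>t. exp (- t\<^sup>2 / 2) * q t \<partial>lborel))"
    by simp
  moreover have "sqrt (2 * pi) ^ DIM('a) = sqrt (2 * pi) ^ (DIM('a) - 1) * sqrt (2 * pi)"
    using DIM_positive[where 'a='a] by (metis Suc_diff_1 mult.commute power_Suc)
  ultimately show ?thesis by simp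
qed

lemma integral_lborel_affine:
  fixes f :: "'a::euclidean_space \<Rightarrow> real"
  assumes c: "c > 0" and [measurable]: "f \<in> borel_measurable borel"
  shows "(\<integral>x. f x \<partial>lborel) = c ^ DIM('a) * (\<integral>x. f (t + c *\<^sub>R x) \<partial>lborel)"
proof -
  have "(\<integral>x. f x \<partial>lborel) = (\<integral>x. f x \<partial>density (distr lborel borel (\<lambda>x. t + c *\<^sub>R x)) (\<lambda>_. ennreal (\<bar>c\<bar> ^ DIM('a))))"
    using lborel_affine[of c t] c by (simp add: ennreal_power)
  also have "\<dots> = (\<integral>x. \<bar>c\<bar> ^ DIM('a) * f x \<partial>distr lborel borel (\<lambda>x. t + c *\<^sub>R x))"
    by (subst integral_real_density) auto
  also have "\<dots> = (\<integral>x. \<bar>c\<bar> ^ DIM('a) * f (t + c *\<^sub>R x) \<partial>lborel)"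
    by (subst integral_distr) auto
  finally show ?thesis using c by simp
qed

lemma integrable_lborel_affine:
  fixes f :: "'a::euclidean_space \<Rightarrow> real"
  assumes c: "c > 0" and f: "integrable lborel f"
  shows "integrable lborel (\<lambda>x. f (t + c *\<^sub>R x))"
proof -
  have [measurable]: "f \<in> borel_measurable borel" using f by simp
  have "integrable (density (distr lborel borel (\<lambda>x. t + c *\<^sub>R x)) (\<lambda>_. ennreal (\<bar>c\<bar> ^ DIM('a)))) f"
    using lborel_affine[of c t] c f by (simp add: ennreal_power)
  then have "integrable (distr lborel borel (\<lambda>x. t + c *\<^sub>R x)) (\<lambda>x. \<bar>c\<bar> ^ DIM('a) * f x)"
    by (subst (asm) integrable_real_density) auto
  then have "integrable lborel (\<lambda>x. \<bar>c\<bar> ^ DIM('a) * f (t + c *\<^sub>R x))"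
    by (subst (asm) integrable_distr_eq) auto
  then show ?thesis using c by simp
qed

definition gauss_bump :: "real \<Rightarrow> 'a::euclidean_space \<Rightarrow> 'a \<Rightarrow> real" where
  "gauss_bump h z x = gauss ((x - z) /\<^sub>R h)"

lemma gauss_bump_measurable [measurable]: "gauss_bump h z \<in> borel_measurable borel"
  unfolding gauss_bump_def by measurable

lemma integrable_gauss_bump:
  assumes "h > 0"
  shows "integrable lborel (gauss_bump h z)"
proof -
  have "(x - z) /\<^sub>R h = (- (z /\<^sub>R h)) + (1 / h) *\<^sub>R x" for x
    using assms by (simp add: scaleR_diff_right inverse_eq_divide)
  then have "gauss_bump h z = (\<lambda>x. gauss ((- (z /\<^sub>R h)) + (1 / h) *\<^sub>R x))"
    by (simp add: gauss_bump_def fun_eq_iff)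
  then show ?thesis using integrable_lborel_affine[OF _ integrable_gauss, of "1/h" "- (z /\<^sub>R h)"] assms by simp
qed

lemma gauss_bump_ridge:
  fixes \<gamma> :: "'a::euclidean_space"
  assumes \<gamma>: "norm \<gamma> = 1" and p: "rapid p" and h: "h > 0" and L: "Lop1 DIM('a) p \<in> borel_measurable borel"
  shows "(\<integral>x. gauss_bump h z x * Lop1 DIM('a) p (\<gamma> \<bullet> x) \<partial>lborel)
     = sqrt (2 * pi) ^ (DIM('a) - 1) / h\<^sup>2 * (\<integral>t. gauss_ker DIM('a) ((t - \<gamma> \<bullet> z) / h) * p t \<partial>lborel)"
proof -
  let ?d = "DIM('a)" and ?b = "\<gamma> \<bullet> z"
  note [measurable] = L
  have [measurable]: "p \<in> borel_measurable borel" using rapid_measurable[OF p, of 0] by simp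
  have "(\<integral>x. gauss_bump h z x * Lop1 ?d p (\<gamma> \<bullet> x) \<partial>lborel)
     = h ^ ?d * (\<integral>x. gauss_bump h z (z + h *\<^sub>R x) * Lop1 ?d p (\<gamma> \<bullet> (z + h *\<^sub>R x)) \<partial>lborel)"
    by (rule integral_lborel_affine[OF h]) measurable
  also have "(\<integral>x. gauss_bump h z (z + h *\<^sub>R x) * Lop1 ?d p (\<gamma> \<bullet> (z + h *\<^sub>R x)) \<partial>lborel)
     = (\<integral>x. gauss x * Lop1 ?d p (?b + h * (\<gamma> \<bullet> x)) \<partial>lborel)"
    using h by (simp add: gauss_bump_def inner_add_right)
  also have "\<dots> = sqrt (2 * pi) ^ (?d - 1) * (\<integral>t. exp (- t\<^sup>2 / 2) * Lop1 ?d p (?b + h * t) \<partial>lborel)"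
    by (rule integral_gauss_ridge[OF \<gamma>, of "\<lambda>t. Lop1 ?d p (?b + h * t)"]) measurable
  also have "(\<integral>t. exp (- t\<^sup>2 / 2) * Lop1 ?d p (?b + h * t) \<partial>lborel)
     = (\<integral>t. 1 / h ^ (?d + 1) * (exp (- t\<^sup>2 / 2) * Lop1 ?d (\<lambda>t. p (?b + h * t)) t) \<partial>lborel)"
    using h by (simp add: Lop1_affine[OF p h])
  also have "\<dots> = 1 / h ^ (?d + 1) * (\<integral>t. gauss_ker ?d t * p (?b + h * t) \<partial>lborel)"
    unfolding integral_mult_right_zero using h by (subst Lop1_pairing[OF rapid_affine[OF p]]) auto
  also have "(\<integral>t. gauss_ker ?d t * p (?b + h * t) \<partial>lborel) = 1 / h * (\<integral>t. gauss_ker ?d ((t - ?b) / h) * p t \<partial>lborel)"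
    using lborel_integral_real_affine[of h "\<lambda>t. gauss_ker ?d ((t - ?b) / h) * p t" ?b] h by simp
  finally show ?thesis using h by (simp add: power2_eq_square)
qed

section \<open>Pairing with the back-projection\<close>

lemma Lop_eq_Lop1: "Lop \<psi> \<gamma> t = Lop1 DIM('a) (\<psi> \<gamma>) t" for \<gamma> :: "'a::euclidean_space"
  unfolding Lop_def Lop1_def tderiv_def by simp

lemma schwartz_SR_obtain:
  fixes \<psi> :: "'a::euclidean_space \<Rightarrow> real \<Rightarrow> real"
  assumes "schwartz_SR \<psi>"
  obtains D :: "nat \<Rightarrow> 'a \<times> real \<Rightarrow> real"
  where "\<And>k. continuous_on UNIV (D k)"
    "\<And>k \<gamma> t. norm \<gamma> = 1 \<Longrightarrow> (deriv ^^ k) (\<psi> \<gamma>) t = D k (\<gamma>, t)"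
    "\<And>k \<gamma> t. norm \<gamma> = 1 \<Longrightarrow> ((deriv ^^ k) (\<psi> \<gamma>) has_real_derivative D (Suc k) (\<gamma>, t)) (at t)"
    "\<And>k. \<exists>B\<ge>0. \<forall>\<gamma> t. norm \<gamma> = 1 \<longrightarrow> (1 + t\<^sup>2)\<^sup>2 * \<bar>D k (\<gamma>, t)\<bar> \<le> B"
proof -
  obtain \<Psi> :: "'a \<times> real \<Rightarrow> real" where sm: "smooth_fun \<Psi>"
    and eq: "\<And>\<gamma> t. norm \<gamma> = 1 \<Longrightarrow> \<psi> \<gamma> t = \<Psi> (\<gamma>, t)"
    and bd: "\<And>vs k. \<exists>B. \<forall>\<gamma>\<in>sphere 0 1. \<forall>t. \<bar>t\<bar> ^ k * \<bar>dirder vs \<Psi> (\<gamma>, t)\<bar> \<le> B"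
    using assms unfolding schwartz_SR_def by auto
  have bd': "\<exists>B. \<forall>\<gamma> t. norm \<gamma> = 1 \<longrightarrow> \<bar>t\<bar> ^ k * \<bar>dirder vs \<Psi> (\<gamma>, t)\<bar> \<le> B" for vs k
    using bd[of k vs] unfolding Ball_def mem_sphere_0 by simp
  define D where "D k = dirder (replicate k (0, 1)) \<Psi>" for k
  have diff: "D k differentiable (at z)" for k z using sm unfolding smooth_fun_def D_def by blast
  have Dd: "((\<lambda>s. D k (\<gamma>, s)) has_real_derivative D (Suc k) (\<gamma>, t)) (at t)" for k \<gamma> t
  proof -
    have "(D k has_derivative frechet_derivative (D k) (at (\<gamma>, t))) (at (\<gamma>, t))"
      using diff frechet_derivative_works by blast
    moreover have "((\<lambda>s. (\<gamma>, s)) has_derivative (\<lambda>s. (0, s))) (at t)"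
      by (auto intro!: derivative_eq_intros)
    ultimately have "((\<lambda>s. D k (\<gamma>, s)) has_derivative (\<lambda>s. frechet_derivative (D k) (at (\<gamma>, t)) (0, s))) (at t)"
      by (rule has_derivative_compose[rotated])
    moreover have "frechet_derivative (D k) (at (\<gamma>, t)) (0, s) = D (Suc k) (\<gamma>, t) * s" for s
    proof -
      have "frechet_derivative (D k) (at (\<gamma>, t)) (0, s) = frechet_derivative (D k) (at (\<gamma>, t)) (s *\<^sub>R (0, 1))" by simp
      also have "\<dots> = s *\<^sub>R frechet_derivative (D k) (at (\<gamma>, t)) (0, 1)"
        by (rule linear_scale[OF linear_frechet_derivative[OF diff]])
      finally show ?thesis by (simp add: D_def)
    qed
    ultimately show ?thesis by (simp add: has_field_derivative_def)
  qed
  have e: "(deriv ^^ k) (\<psi> \<gamma>) = (\<lambda>t. D k (\<gamma>, t))" if "norm \<gamma> = 1" for k \<gamma>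
  proof (induction k)
    case 0 then show ?case using eq[OF that] by (auto simp: D_def)
  next
    case (Suc k)
    then show ?case using DERIV_imp_deriv[OF Dd] by auto
  qed
  have "\<exists>B\<ge>0. \<forall>\<gamma> t. norm \<gamma> = 1 \<longrightarrow> (1 + t\<^sup>2)\<^sup>2 * \<bar>D k (\<gamma>, t)\<bar> \<le> B" for k
  proof -
    obtain B0 where B0: "\<And>\<gamma> t. norm \<gamma> = 1 \<Longrightarrow> \<bar>t\<bar> ^ 0 * \<bar>D k (\<gamma>, t)\<bar> \<le> B0" using bd'[of 0 "replicate k (0,1)"] unfolding D_def by blast
    obtain B2 where B2: "\<And>\<gamma> t. norm \<gamma> = 1 \<Longrightarrow> \<bar>t\<bar> ^ 2 * \<bar>D k (\<gamma>, t)\<bar> \<le> B2" using bd'[of 2 "replicate k (0,1)"] unfolding D_def by blast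
    obtain B4 where B4: "\<And>\<gamma> t. norm \<gamma> = 1 \<Longrightarrow> \<bar>t\<bar> ^ 4 * \<bar>D k (\<gamma>, t)\<bar> \<le> B4" using bd'[of 4 "replicate k (0,1)"] unfolding D_def by blast
    have "(1 + t\<^sup>2)\<^sup>2 * \<bar>D k (\<gamma>, t)\<bar> \<le> max 0 (B0 + 2 * B2 + B4)" if "norm \<gamma> = 1" for \<gamma> t
    proof -
      have "(1 + t\<^sup>2)\<^sup>2 = 1 + 2 * t ^ 2 + t ^ 4" by (simp add: power2_eq_square power4_eq_xxxx algebra_simps)
      then have "(1 + t\<^sup>2)\<^sup>2 * \<bar>D k (\<gamma>, t)\<bar> = \<bar>D k (\<gamma>, t)\<bar> + 2 * (t ^ 2 * \<bar>D k (\<gamma>, t)\<bar>) + t ^ 4 * \<bar>D k (\<gamma>, t)\<bar>"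
        by (simp add: algebra_simps)
      then have "(1 + t\<^sup>2)\<^sup>2 * \<bar>D k (\<gamma>, t)\<bar> \<le> B0 + 2 * B2 + B4"
        using B0[OF that, of t] B2[OF that, of t] B4[OF that, of t] by simp
      then show ?thesis by simp
    qed
    then show ?thesis by (intro exI[of _ "max 0 (B0 + 2 * B2 + B4)"]) auto
  qed
  moreover have "continuous_on UNIV (D k)" for k
    by (rule differentiable_imp_continuous_on) (simp add: differentiable_on_def diff differentiable_at_withinI)
  ultimately show ?thesis using that[of D] e Dd by auto
qed

lemma schwartz_SR_rapid:
  assumes \<psi>: "schwartz_SR \<psi>" and \<gamma>: "norm \<gamma> = 1"
  shows "rapid (\<psi> \<gamma>)"
proof -
  obtain D where D: "\<And>k \<gamma> t. norm \<gamma> = 1 \<Longrightarrow> (deriv ^^ k) (\<psi> \<gamma>) t = D k (\<gamma>, t)"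
    "\<And>k \<gamma> t. norm \<gamma> = 1 \<Longrightarrow> ((deriv ^^ k) (\<psi> \<gamma>) has_real_derivative D (Suc k) (\<gamma>, t)) (at t)"
    "\<And>k. \<exists>B\<ge>0. \<forall>\<gamma> t. norm \<gamma> = 1 \<longrightarrow> (1 + t\<^sup>2)\<^sup>2 * \<bar>D k (\<gamma>, t)\<bar> \<le> B"
    using schwartz_SR_obtain[OF \<psi>] by metis
  show ?thesis unfolding rapid_def
  proof (intro conjI allI)
    show "(deriv ^^ j) (\<psi> \<gamma>) differentiable at t" for j t using D(2)[OF \<gamma>] real_differentiable_def by blast
    show "\<exists>B. \<forall>t. (1 + t\<^sup>2)\<^sup>2 * \<bar>(deriv ^^ j) (\<psi> \<gamma>) t\<bar> \<le> B" for j
      using D(3)[of j] D(1)[OF \<gamma>] \<gamma> by metis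
  qed
qed

definition Lop_dir :: "('a::euclidean_space \<Rightarrow> real \<Rightarrow> real) \<Rightarrow> 'a \<Rightarrow> real \<Rightarrow> real" where
  "Lop_dir \<psi> y t = (if y = 0 then 0 else Lop1 DIM('a) (\<psi> (y /\<^sub>R norm y)) t)"

lemma Lop_dir_bounded_measurable:
  fixes \<psi> :: "'a::euclidean_space \<Rightarrow> real \<Rightarrow> real"
  assumes \<psi>: "schwartz_SR \<psi>"
  shows "\<exists>B. \<forall>y t. \<bar>Lop_dir \<psi> y t\<bar> \<le> B"
    and "(\<lambda>(y, t). Lop_dir \<psi> y t) \<in> borel_measurable (borel \<Otimes>\<^sub>M borel)"
proof -
  obtain D :: "nat \<Rightarrow> 'a \<times> real \<Rightarrow> real" where Dc: "\<And>k. continuous_on UNIV (D k)"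
    and D: "\<And>k \<gamma> t. norm \<gamma> = 1 \<Longrightarrow> (deriv ^^ k) (\<psi> \<gamma>) t = D k (\<gamma>, t)"
    "\<And>k \<gamma> t. norm \<gamma> = 1 \<Longrightarrow> ((deriv ^^ k) (\<psi> \<gamma>) has_real_derivative D (Suc k) (\<gamma>, t)) (at t)"
    "\<And>k. \<exists>B\<ge>0. \<forall>\<gamma> t. norm \<gamma> = 1 \<longrightarrow> (1 + t\<^sup>2)\<^sup>2 * \<bar>D k (\<gamma>, t)\<bar> \<le> B"
    using schwartz_SR_obtain[OF \<psi>] by metis
  define n where "n = DIM('a) + 1"
  define c1 where "c1 = ((-1) ^ ((DIM('a) - 1) div 2) :: real)"
  define c2 where "c2 = ((-1) ^ ((DIM('a) - 2) div 2) :: real)"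
  have c: "\<bar>c1\<bar> = 1" "\<bar>c2\<bar> = 1" by (auto simp: c1_def c2_def power_abs)
  have L1: "Lop1 DIM('a) p t = (if odd DIM('a) then c1 * (deriv ^^ n) p t else c2 * hilbert ((deriv ^^ n) p) t)" for p t
    unfolding Lop1_def n_def c1_def c2_def ..
  have De: "(deriv ^^ k) (\<psi> \<gamma>) = (\<lambda>t. D k (\<gamma>, t))" if "norm \<gamma> = 1" for k \<gamma>
    using D(1)[OF that] by auto
  have Dm[measurable]: "D k \<in> borel_measurable (borel \<Otimes>\<^sub>M borel)" for k
    using borel_measurable_continuous_onI[OF Dc] by (simp add: borel_prod)
  obtain B0 where B0: "B0 \<ge> 0" "\<And>\<gamma> t. norm \<gamma> = 1 \<Longrightarrow> (1 + t\<^sup>2)\<^sup>2 * \<bar>D n (\<gamma>, t)\<bar> \<le> B0" using D(3) by blast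
  obtain B1 where B1: "B1 \<ge> 0" "\<And>\<gamma> t. norm \<gamma> = 1 \<Longrightarrow> (1 + t\<^sup>2)\<^sup>2 * \<bar>D (Suc n) (\<gamma>, t)\<bar> \<le> B1" using D(3) by blast
  have lip: "lip_decay (B0 + B1) (\<lambda>t. D n (\<gamma>, t))" if \<gamma>: "norm \<gamma> = 1" for \<gamma>
  proof (rule lip_decayI)
    show "((\<lambda>t. D n (\<gamma>, t)) has_real_derivative D (Suc n) (\<gamma>, t)) (at t)" for t
      using D(2)[OF \<gamma>, of n t] unfolding De[OF \<gamma>] .
    show "\<bar>D (Suc n) (\<gamma>, t)\<bar> \<le> B0 + B1" for t
    proof -
      have "1 * \<bar>D (Suc n) (\<gamma>, t)\<bar> \<le> (1 + t\<^sup>2)\<^sup>2 * \<bar>D (Suc n) (\<gamma>, t)\<bar>" by (intro mult_right_mono one_le_power) auto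
      then show ?thesis using B1(2)[OF \<gamma>, of t] B0(1) by simp
    qed
    show "\<bar>D n (\<gamma>, t)\<bar> \<le> (B0 + B1) / (1 + t\<^sup>2)" for t
    proof -
      have "(1 + t\<^sup>2) * \<bar>D n (\<gamma>, t)\<bar> \<le> (1 + t\<^sup>2)\<^sup>2 * \<bar>D n (\<gamma>, t)\<bar>"
        by (intro mult_right_mono self_le_power) auto
      then have "(1 + t\<^sup>2) * \<bar>D n (\<gamma>, t)\<bar> \<le> B0 + B1" using B0(2)[OF \<gamma>, of t] B1(1) by linarith
      then show ?thesis by (simp add: le_divide_eq mult.commute)
    qed
  qed
  have hil: "hilbert ((deriv ^^ n) (\<psi> \<gamma>)) t = - (1 / pi) * sdiff_int (\<lambda>t. D n (\<gamma>, t)) t" if "norm \<gamma> = 1" for \<gamma> t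
    unfolding De[OF that] by (rule hilbert_eq_sdiff_int[OF lip[OF that]])
  have "\<bar>Lop_dir \<psi> y t\<bar> \<le> 6 * (B0 + B1)" for y t
  proof (cases "y = 0")
    case False
    define \<gamma> where "\<gamma> = y /\<^sub>R norm y"
    have \<gamma>: "norm \<gamma> = 1" using False by (simp add: \<gamma>_def)
    show ?thesis
    proof (cases "odd DIM('a)")
      case True
      have "\<bar>Lop_dir \<psi> y t\<bar> = \<bar>D n (\<gamma>, t)\<bar>"
        using False True De[OF \<gamma>, of n] c by (simp add: Lop_dir_def L1 \<gamma>_def[symmetric] abs_mult)
      also have "\<dots> \<le> B0"
      proof -
        have "1 * \<bar>D n (\<gamma>, t)\<bar> \<le> (1 + t\<^sup>2)\<^sup>2 * \<bar>D n (\<gamma>, t)\<bar>" by (intro mult_right_mono one_le_power) auto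
        then show ?thesis using B0(2)[OF \<gamma>, of t] by simp
      qed
      finally show ?thesis using B0 B1 by simp
    next
      case odd: False
      have "\<bar>Lop_dir \<psi> y t\<bar> = \<bar>hilbert ((deriv ^^ n) (\<psi> \<gamma>)) t\<bar>"
        using False odd c by (simp add: Lop_dir_def L1 \<gamma>_def[symmetric] abs_mult)
      also have "\<dots> = (1 / pi) * \<bar>sdiff_int (\<lambda>t. D n (\<gamma>, t)) t\<bar>" unfolding hil[OF \<gamma>] by (simp add: abs_mult)
      also have "\<dots> \<le> (1 / pi) * (6 * pi * (B0 + B1))"
        by (intro mult_left_mono sdiff_int_bound[OF lip[OF \<gamma>]]) auto
      finally show ?thesis by simp
    qed
  qed (use B0 B1 in \<open>simp add: Lop_dir_def\<close>)
  then show "\<exists>B. \<forall>y t. \<bar>Lop_dir \<psi> y t\<bar> \<le> B" by blast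
  have "(\<lambda>(y, t). Lop_dir \<psi> y t) = (\<lambda>z. if fst z = 0 then 0 else
     (if odd DIM('a) then c1 * D n (fst z /\<^sub>R norm (fst z), snd z)
      else c2 * (- (1 / pi) * (\<integral>s. indicator {0<..} s * ((D n (fst z /\<^sub>R norm (fst z), snd z + s) - D n (fst z /\<^sub>R norm (fst z), snd z - s)) / s) \<partial>lborel))))"
    using hil D(1) by (auto simp: fun_eq_iff Lop_dir_def L1 sdiff_int_def sdiff_def)
  also have "\<dots> \<in> borel_measurable (borel \<Otimes>\<^sub>M borel)" by measurable
  finally show "(\<lambda>(y, t). Lop_dir \<psi> y t) \<in> borel_measurable (borel \<Otimes>\<^sub>M borel)" .
qed

lemma integral_backproj_Lop:
  fixes \<psi> :: "'a::euclidean_space \<Rightarrow> real \<Rightarrow> real"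
  assumes \<psi>: "schwartz_SR \<psi>" and g: "integrable lborel g"
  shows "(\<integral>x. g x * backproj (Lop \<psi>) x \<partial>lborel)
     = real DIM('a) * (\<integral>y. indicator (ball 0 1) y * (\<integral>x. g x * Lop_dir \<psi> y ((y /\<^sub>R norm y) \<bullet> x) \<partial>lborel) \<partial>lborel)"
proof -
  note M[measurable] = Lop_dir_bounded_measurable(2)[OF \<psi>]
  have [measurable]: "g \<in> borel_measurable borel" using g by simp
  obtain B where B: "\<And>y t. \<bar>Lop_dir \<psi> y t\<bar> \<le> B" using Lop_dir_bounded_measurable(1)[OF \<psi>] by blast
  define H where "H y x = Lop_dir \<psi> y ((y /\<^sub>R norm y) \<bullet> x)" for y x
  have Hm: "(\<lambda>(y, x). H y x) \<in> borel_measurable (borel \<Otimes>\<^sub>M borel)"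
    unfolding H_def by measurable
  note [measurable] = Hm
  have Hx[measurable]: "(\<lambda>y. H y x) \<in> borel_measurable borel" for x
    using measurable_compose[OF measurable_Pair2'[of x borel borel] Hm] by simp
  have [measurable]: "ball (0::'a) 1 \<in> sets borel" "{0::'a} \<in> sets borel" by auto
  have HB: "\<bar>H y x\<bar> \<le> B" for y x using B by (simp add: H_def)
  have bp: "backproj (Lop \<psi>) x = real DIM('a) * (\<integral>y. indicator (ball 0 1) y * H y x \<partial>lborel)" for x :: 'a
  proof -
    define k where "k y = Lop \<psi> (y /\<^sub>R norm y) ((y /\<^sub>R norm y) \<bullet> x)" for y
    have k: "indicator (ball 0 1) y * k y = indicator (ball 0 1) y * H y x + indicator {0} y * k 0" for y
      by (auto simp: k_def H_def Lop_dir_def Lop_eq_Lop1 split: split_indicator)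
    have "(\<integral>y. indicator (ball 0 1) y * k y \<partial>lborel) = (\<integral>y. indicator (ball 0 1) y * H y x \<partial>lborel)"
    proof (rule integral_cong_AE)
      show "(\<lambda>y. indicator (ball 0 1) y * k y) \<in> borel_measurable lborel" unfolding k by measurable
      show "(\<lambda>y. indicator (ball 0 1) y * H y x) \<in> borel_measurable lborel" by measurable
      show "AE y in lborel. indicator (ball 0 1) y * k y = indicator (ball 0 1) y * H y x"
        unfolding k using AE_lborel_singleton[of "0::'a"] by eventually_elim simp
    qed
    then show ?thesis by (simp add: backproj_def sph_int_def set_lebesgue_integral_def k_def)
  qed
  have int: "integrable (lborel \<Otimes>\<^sub>M lborel) (\<lambda>(y, x). indicator (ball 0 1) y * (g x * H y x))"
  proof (rule Bochner_Integration.integrable_bound)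
    show "integrable (lborel \<Otimes>\<^sub>M lborel) (\<lambda>(y, x). (indicator (ball (0::'a) 1) y * (B * g x)))"
    proof (rule lborel_pair.Fubini_integrable)
      have fin: "integrable lborel (indicator (ball (0::'a) 1) :: 'a \<Rightarrow> real)"
        using emeasure_lborel_ball_finite[of "0::'a" 1] by (intro integrable_real_indicator) auto
      show "integrable lborel (\<lambda>y. \<integral>x. norm (case (y, x) of (y, x) \<Rightarrow> indicator (ball (0::'a) 1) y * (B * g x)) \<partial>lborel)"
        using integrable_mult_left[OF fin, of "\<integral>x. \<bar>B * g x\<bar> \<partial>lborel"] by (simp add: abs_mult)
      show "AE y in lborel. integrable lborel (\<lambda>x. case (y, x) of (y, x) \<Rightarrow> indicator (ball (0::'a) 1) y * (B * g x))"
        using g by auto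
    qed measurable
    show "AE z in lborel \<Otimes>\<^sub>M lborel. norm (case z of (y, x) \<Rightarrow> indicator (ball 0 1) y * (g x * H y x))
        \<le> norm (case z of (y, x) \<Rightarrow> indicator (ball 0 1) y * (B * g x))"
    proof (rule AE_I2)
      fix z :: "'a \<times> 'a"
      have "\<bar>H (fst z) (snd z)\<bar> \<le> \<bar>B\<bar>" using HB[of "fst z" "snd z"] by linarith
      then have "\<bar>g (snd z)\<bar> * \<bar>H (fst z) (snd z)\<bar> \<le> \<bar>B\<bar> * \<bar>g (snd z)\<bar>"
        using mult_right_mono[of _ _ "\<bar>g (snd z)\<bar>"] by (subst mult.commute) simp
      then show "norm (case z of (y, x) \<Rightarrow> indicator (ball 0 1) y * (g x * H y x))
        \<le> norm (case z of (y, x) \<Rightarrow> indicator (ball 0 1) y * (B * g x))"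
        by (auto simp: split_beta abs_mult split: split_indicator)
    qed
  qed measurable
  have "(\<integral>x. g x * backproj (Lop \<psi>) x \<partial>lborel) = (\<integral>x. real DIM('a) * (\<integral>y. indicator (ball 0 1) y * (g x * H y x) \<partial>lborel) \<partial>lborel)"
    unfolding bp
  proof (intro Bochner_Integration.integral_cong refl)
    fix x
    have "(\<integral>y. indicator (ball 0 1) y * (g x * H y x) \<partial>lborel) = (\<integral>y. g x * (indicator (ball 0 1) y * H y x) \<partial>lborel)"
      by (simp only: mult_ac)
    then show "g x * (real DIM('a) * (\<integral>y. indicator (ball 0 1) y * H y x \<partial>lborel)) = real DIM('a) * (\<integral>y. indicator (ball 0 1) y * (g x * H y x) \<partial>lborel)"
      by simp
  qed
  also have "\<dots> = real DIM('a) * (\<integral>x. (\<integral>y. indicator (ball 0 1) y * (g x * H y x) \<partial>lborel) \<partial>lborel)" by simp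
  also have "(\<integral>x. (\<integral>y. indicator (ball 0 1) y * (g x * H y x) \<partial>lborel) \<partial>lborel) = (\<integral>y. (\<integral>x. indicator (ball 0 1) y * (g x * H y x) \<partial>lborel) \<partial>lborel)"
    by (rule lborel_pair.Fubini_integral[OF int])
  finally show ?thesis by (simp add: H_def)
qed

section \<open>Random sums of Gaussian bumps\<close>

lemma abs_integral_le_nn_integral: "ennreal \<bar>\<integral>x. f x \<partial>M\<bar> \<le> (\<integral>\<^sup>+x. ennreal \<bar>f x\<bar> \<partial>M)" for f :: "'a \<Rightarrow> real"
proof (cases "integrable M f")
  case True
  then show ?thesis using integral_norm_bound_ennreal[OF True] by simp
qed (simp add: not_integrable_integral_eq)

definition set_sgn :: "'a set \<Rightarrow> 'a \<Rightarrow> real" where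
  "set_sgn A z = (if z \<in> A then 1 else - 1)"

lemma sum_Pow_square:
  assumes "finite X"
  shows "(\<Sum>A\<in>Pow X. (\<Sum>z\<in>X. set_sgn A z * F z)\<^sup>2) = 2 ^ card X * (\<Sum>z\<in>X. (F z)\<^sup>2)"
  using assms
proof (induction X)
  case (insert z X)
  define S where "S A = (\<Sum>w\<in>X. set_sgn A w * F w)" for A
  have 1: "(\<Sum>w\<in>insert z X. set_sgn A w * F w) = S A - F z" if "A \<in> Pow X" for A
    using that insert.hyps by (auto simp: S_def set_sgn_def)
  have 2: "(\<Sum>w\<in>insert z X. set_sgn (insert z A) w * F w) = S A + F z" if "A \<in> Pow X" for A
  proof -
    have "(\<Sum>w\<in>X. set_sgn (insert z A) w * F w) = S A"
      unfolding S_def by (intro sum.cong refl) (use insert.hyps in \<open>auto simp: set_sgn_def\<close>)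
    then show ?thesis using insert.hyps by (simp add: set_sgn_def)
  qed
  have "(\<Sum>A\<in>Pow (insert z X). (\<Sum>w\<in>insert z X. set_sgn A w * F w)\<^sup>2)
     = (\<Sum>A\<in>Pow X. (\<Sum>w\<in>insert z X. set_sgn A w * F w)\<^sup>2) + (\<Sum>A\<in>insert z ` Pow X. (\<Sum>w\<in>insert z X. set_sgn A w * F w)\<^sup>2)"
    unfolding Pow_insert by (rule sum.union_disjoint) (use insert.hyps in auto)
  also have "(\<Sum>A\<in>insert z ` Pow X. (\<Sum>w\<in>insert z X. set_sgn A w * F w)\<^sup>2) = (\<Sum>A\<in>Pow X. (\<Sum>w\<in>insert z X. set_sgn (insert z A) w * F w)\<^sup>2)"
  proof (subst sum.reindex)
    show "inj_on (insert z) (Pow X)" using insert.hyps by (auto simp: inj_on_def)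
  qed simp
  also have "(\<Sum>A\<in>Pow X. (\<Sum>w\<in>insert z X. set_sgn A w * F w)\<^sup>2) + \<dots> = (\<Sum>A\<in>Pow X. (S A - F z)\<^sup>2 + (S A + F z)\<^sup>2)"
    unfolding sum.distrib by (intro arg_cong2[where f = "(+)"] sum.cong refl) (simp_all only: 1 2)
  also have "\<dots> = (\<Sum>A\<in>Pow X. 2 * (S A)\<^sup>2 + 2 * (F z)\<^sup>2)"
    by (intro sum.cong refl) (simp add: power2_eq_square algebra_simps)
  also have "\<dots> = 2 * (\<Sum>A\<in>Pow X. (S A)\<^sup>2) + 2 * (2 ^ card X * (F z)\<^sup>2)"
    using insert.hyps by (simp add: sum.distrib sum_distrib_left card_Pow)
  finally show ?case using insert by (simp add: S_def algebra_simps)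
qed simp

definition gauss_sum :: "real \<Rightarrow> real \<Rightarrow> 'a::euclidean_space set \<Rightarrow> 'a set \<Rightarrow> 'a \<Rightarrow> real" where
  "gauss_sum a h X A x = (\<Sum>z\<in>X. set_sgn A z * (a * gauss_bump h z x))"

definition ridge_ker :: "real \<Rightarrow> 'a::euclidean_space set \<Rightarrow> 'a set \<Rightarrow> 'a \<Rightarrow> real \<Rightarrow> real" where
  "ridge_ker h X A \<gamma> t = (\<Sum>z\<in>X. set_sgn A z * gauss_ker DIM('a) ((t - \<gamma> \<bullet> z) / h))"

lemma gauss_sum_measurable [measurable]: "gauss_sum a h X A \<in> borel_measurable borel"
  unfolding gauss_sum_def by measurable

lemma gauss_sum_ridge:
  fixes \<gamma> :: "'a::euclidean_space"
  assumes X: "finite X" and \<gamma>: "norm \<gamma> = 1" and p: "rapid p" and h: "h > 0"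
    and L[measurable]: "Lop1 DIM('a) p \<in> borel_measurable borel" and B: "\<And>t. \<bar>Lop1 DIM('a) p t\<bar> \<le> B"
  shows "(\<integral>x. gauss_sum a h X A x * Lop1 DIM('a) p (\<gamma> \<bullet> x) \<partial>lborel)
     = sqrt (2 * pi) ^ (DIM('a) - 1) * a / h\<^sup>2 * (\<integral>t. ridge_ker h X A \<gamma> t * p t \<partial>lborel)"
proof -
  let ?d = "DIM('a)"
  have [measurable]: "p \<in> borel_measurable borel" using rapid_measurable[OF p, of 0] by simp
  have int: "integrable lborel (\<lambda>x. gauss_bump h z x * Lop1 ?d p (\<gamma> \<bullet> x))" for z
  proof (rule Bochner_Integration.integrable_bound[OF integrable_mult_right[OF integrable_gauss_bump[OF h], of B]])
    show "AE x in lborel. norm (gauss_bump h z x * Lop1 ?d p (\<gamma> \<bullet> x)) \<le> norm (B * gauss_bump h z x)"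
    proof (rule AE_I2)
      fix x
      have "\<bar>gauss_bump h z x\<bar> * \<bar>Lop1 ?d p (\<gamma> \<bullet> x)\<bar> \<le> \<bar>gauss_bump h z x\<bar> * \<bar>B\<bar>"
        using B[of "\<gamma> \<bullet> x"] by (intro mult_left_mono) auto
      then show "norm (gauss_bump h z x * Lop1 ?d p (\<gamma> \<bullet> x)) \<le> norm (B * gauss_bump h z x)"
        by (simp add: abs_mult mult.commute)
    qed
  qed measurable
  obtain Bp where Bp: "\<And>t. \<bar>p t\<bar> \<le> Bp" using rapid_bounded[OF p, of 0] by auto
  obtain Bk where Bk: "\<And>t. \<bar>gauss_ker ?d t\<bar> \<le> Bk / (1 + t\<^sup>2)" using gauss_ker_decay by blast
  have ki: "integrable lborel (gauss_ker ?d)" by (rule integrable_of_decay[OF _ Bk]) measurable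
  have kint: "integrable lborel (\<lambda>t. gauss_ker ?d ((t - b) / h) * p t)" for b
  proof (rule Bochner_Integration.integrable_bound)
    show "integrable lborel (\<lambda>t. Bp * gauss_ker ?d (- b / h + (1 / h) * t))"
      using h by (intro integrable_mult_right lborel_integrable_real_affine ki) auto
    show "AE t in lborel. norm (gauss_ker ?d ((t - b) / h) * p t) \<le> norm (Bp * gauss_ker ?d (- b / h + (1 / h) * t))"
    proof (rule AE_I2)
      fix t
      have "\<bar>gauss_ker ?d ((t - b) / h)\<bar> * \<bar>p t\<bar> \<le> \<bar>gauss_ker ?d ((t - b) / h)\<bar> * \<bar>Bp\<bar>"
        using Bp[of t] by (intro mult_left_mono) auto
      moreover have "- b / h + (1 / h) * t = (t - b) / h" by (simp add: diff_divide_distrib)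
      ultimately show "norm (gauss_ker ?d ((t - b) / h) * p t) \<le> norm (Bp * gauss_ker ?d (- b / h + (1 / h) * t))"
        by (simp add: abs_mult mult.commute)
    qed
  qed measurable
  have "(\<integral>x. gauss_sum a h X A x * Lop1 ?d p (\<gamma> \<bullet> x) \<partial>lborel)
     = (\<integral>x. (\<Sum>z\<in>X. (set_sgn A z * a) * (gauss_bump h z x * Lop1 ?d p (\<gamma> \<bullet> x))) \<partial>lborel)"
    by (simp add: gauss_sum_def sum_distrib_right mult.assoc)
  also have "\<dots> = (\<Sum>z\<in>X. (set_sgn A z * a) * (\<integral>x. gauss_bump h z x * Lop1 ?d p (\<gamma> \<bullet> x) \<partial>lborel))"
    by (subst Bochner_Integration.integral_sum) (use int in auto)
  also have "\<dots> = (\<Sum>z\<in>X. (sqrt (2 * pi) ^ (?d - 1) * a / h\<^sup>2) * (set_sgn A z * (\<integral>t. gauss_ker ?d ((t - \<gamma> \<bullet> z) / h) * p t \<partial>lborel)))"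
    by (intro sum.cong refl) (subst gauss_bump_ridge[OF \<gamma> p h L], simp add: mult_ac)
  also have "\<dots> = (sqrt (2 * pi) ^ (?d - 1) * a / h\<^sup>2) * (\<Sum>z\<in>X. set_sgn A z * (\<integral>t. gauss_ker ?d ((t - \<gamma> \<bullet> z) / h) * p t \<partial>lborel))"
    by (simp only: sum_distrib_left)
  also have "(\<Sum>z\<in>X. set_sgn A z * (\<integral>t. gauss_ker ?d ((t - \<gamma> \<bullet> z) / h) * p t \<partial>lborel))
     = (\<integral>t. (\<Sum>z\<in>X. set_sgn A z * (gauss_ker ?d ((t - \<gamma> \<bullet> z) / h) * p t)) \<partial>lborel)"
    by (subst Bochner_Integration.integral_sum) (use kint in auto)
  also have "\<dots> = (\<integral>t. ridge_ker h X A \<gamma> t * p t \<partial>lborel)"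
    by (simp add: ridge_ker_def sum_distrib_right mult.assoc)
  finally show ?thesis .
qed

lemma integrable_gauss_sum:
  assumes "finite X" "h > 0"
  shows "integrable lborel (gauss_sum a h X A)"
  unfolding gauss_sum_def[abs_def] using assms integrable_gauss_bump
  by (intro Bochner_Integration.integrable_sum integrable_mult_right) auto

text \<open>An upper bound for the \<open>L\<^sup>1\<close> norm of the Radon-side density that is quadratic in the
  signs, so that it can be averaged over them; it comes from
  \<open>2 \<bar>F\<bar> \<le> \<theta> / (1 + t\<^sup>2) + (1 + t\<^sup>2) F\<^sup>2 / \<theta>\<close>.\<close>
definition ridge_energy :: "real \<Rightarrow> real \<Rightarrow> 'a::euclidean_space set \<Rightarrow> 'a set \<Rightarrow> ennreal" where
  "ridge_energy \<theta> h X A = (\<integral>\<^sup>+y. indicator (ball 0 1) y *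
     (\<integral>\<^sup>+t. ennreal ((\<theta> / (1 + t\<^sup>2) + (1 + t\<^sup>2) * (ridge_ker h X A (y /\<^sub>R norm y) t)\<^sup>2 / \<theta>) / 2) \<partial>lborel) \<partial>lborel)"

lemma RTV2_gauss_sum_le:
  fixes X :: "'a::euclidean_space set"
  assumes X: "finite X" and h: "h > 0" and a: "a \<ge> 0" and \<theta>: "\<theta> > 0" and R: "R \<ge> 0"
    and E: "ridge_energy \<theta> h X A \<le> ennreal R"
  shows "RTV2 (gauss_sum a h X A) \<le> ereal (rtv_const DIM('a) * real DIM('a) * sqrt (2 * pi) ^ (DIM('a) - 1) * a / h\<^sup>2 * R)"
proof -
  let ?d = "DIM('a)"
  define K where "K = sqrt (2 * pi) ^ (?d - 1) * a / h\<^sup>2"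
  have K: "K \<ge> 0" using a by (simp add: K_def)
  have pair: "(\<integral>x. gauss_sum a h X A x * backproj (Lop \<psi>) x \<partial>lborel) \<le> real ?d * (K * R)"
    if \<psi>: "schwartz_SR \<psi>" and \<psi>1: "\<And>\<gamma> t. norm \<gamma> = 1 \<Longrightarrow> \<bar>\<psi> \<gamma> t\<bar> \<le> 1" for \<psi> :: "'a \<Rightarrow> real \<Rightarrow> real"
  proof -
    note M = Lop_dir_bounded_measurable(2)[OF \<psi>]
    obtain B where B: "\<And>y t. \<bar>Lop_dir \<psi> y t\<bar> \<le> B" using Lop_dir_bounded_measurable(1)[OF \<psi>] by blast
    define Z where "Z y = (\<integral>x. gauss_sum a h X A x * Lop_dir \<psi> y ((y /\<^sub>R norm y) \<bullet> x) \<partial>lborel)" for y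
    have Z: "ennreal \<bar>Z y\<bar> \<le> ennreal K * (\<integral>\<^sup>+t. ennreal ((\<theta> / (1 + t\<^sup>2) + (1 + t\<^sup>2) * (ridge_ker h X A (y /\<^sub>R norm y) t)\<^sup>2 / \<theta>) / 2) \<partial>lborel)" for y
    proof (cases "y = 0")
      case True
      then show ?thesis by (simp add: Z_def Lop_dir_def)
    next
      case False
      define \<gamma> where "\<gamma> = y /\<^sub>R norm y"
      have \<gamma>: "norm \<gamma> = 1" using False by (simp add: \<gamma>_def)
      have Le: "Lop1 ?d (\<psi> \<gamma>) = Lop_dir \<psi> y" using False by (auto simp: Lop_dir_def \<gamma>_def)
      have Lm: "Lop1 ?d (\<psi> \<gamma>) \<in> borel_measurable borel"
        unfolding Le using measurable_compose[OF measurable_Pair1'[of y borel borel] M] by simp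
      have "Z y = K * (\<integral>t. ridge_ker h X A \<gamma> t * \<psi> \<gamma> t \<partial>lborel)"
        unfolding Z_def K_def \<gamma>_def[symmetric] Le[symmetric]
        by (rule gauss_sum_ridge[OF X \<gamma> schwartz_SR_rapid[OF \<psi> \<gamma>] h Lm]) (use B Le in auto)
      then have "ennreal \<bar>Z y\<bar> = ennreal K * ennreal \<bar>\<integral>t. ridge_ker h X A \<gamma> t * \<psi> \<gamma> t \<partial>lborel\<bar>"
        using K by (simp add: abs_mult ennreal_mult)
      also have "\<dots> \<le> ennreal K * (\<integral>\<^sup>+t. ennreal \<bar>ridge_ker h X A \<gamma> t * \<psi> \<gamma> t\<bar> \<partial>lborel)"
        by (intro mult_left_mono abs_integral_le_nn_integral) auto
      also have "\<dots> \<le> ennreal K * (\<integral>\<^sup>+t. ennreal ((\<theta> / (1 + t\<^sup>2) + (1 + t\<^sup>2) * (ridge_ker h X A \<gamma> t)\<^sup>2 / \<theta>) / 2) \<partial>lborel)"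
      proof (intro mult_left_mono nn_integral_mono ennreal_leI)
        fix t :: real
        define F where "F = \<bar>ridge_ker h X A \<gamma> t\<bar>"
        define w where "w = 1 + t\<^sup>2"
        have w: "w > 0" by (simp add: w_def)
        have "\<bar>ridge_ker h X A \<gamma> t * \<psi> \<gamma> t\<bar> \<le> F * 1"
          unfolding abs_mult F_def by (intro mult_left_mono \<psi>1[OF \<gamma>]) auto
        also have "F * 1 \<le> (\<theta> / w + w * F\<^sup>2 / \<theta>) / 2"
        proof -
          have "0 \<le> (\<theta> - w * F)\<^sup>2" by simp
          then have "2 * \<theta> * w * F \<le> \<theta>\<^sup>2 + w\<^sup>2 * F\<^sup>2" by (simp add: power2_eq_square algebra_simps)
          then show ?thesis using w \<theta> by (simp add: field_simps power2_eq_square)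
        qed
        finally show "\<bar>ridge_ker h X A \<gamma> t * \<psi> \<gamma> t\<bar> \<le> (\<theta> / (1 + t\<^sup>2) + (1 + t\<^sup>2) * (ridge_ker h X A \<gamma> t)\<^sup>2 / \<theta>) / 2"
          by (simp add: F_def w_def)
      qed auto
      finally show ?thesis unfolding \<gamma>_def .
    qed
    have "ennreal \<bar>\<integral>y. indicator (ball 0 1) y * Z y \<partial>lborel\<bar> \<le> (\<integral>\<^sup>+y. ennreal \<bar>indicator (ball 0 1) y * Z y\<bar> \<partial>lborel)"
      by (rule abs_integral_le_nn_integral)
    also have "\<dots> \<le> (\<integral>\<^sup>+y. ennreal K * (indicator (ball 0 1) y *
       (\<integral>\<^sup>+t. ennreal ((\<theta> / (1 + t\<^sup>2) + (1 + t\<^sup>2) * (ridge_ker h X A (y /\<^sub>R norm y) t)\<^sup>2 / \<theta>) / 2) \<partial>lborel)) \<partial>lborel)"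
      by (intro nn_integral_mono) (auto intro!: Z split: split_indicator)
    also have "\<dots> = ennreal K * ridge_energy \<theta> h X A"
    proof -
      have [measurable]: "ball (0::'a) 1 \<in> sets borel" by auto
      show ?thesis unfolding ridge_energy_def ridge_ker_def by (rule nn_integral_cmult) measurable
    qed
    also have "\<dots> \<le> ennreal K * ennreal R" by (intro mult_left_mono E) auto
    also have "\<dots> = ennreal (K * R)" using K R by (simp add: ennreal_mult)
    finally have "\<bar>\<integral>y. indicator (ball 0 1) y * Z y \<partial>lborel\<bar> \<le> K * R" using K R by (simp add: ennreal_le_iff)
    then have "(\<integral>y. indicator (ball 0 1) y * Z y \<partial>lborel) \<le> K * R" by linarith
    then show ?thesis unfolding integral_backproj_Lop[OF \<psi> integrable_gauss_sum[OF X h]] Z_def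
      by (intro mult_left_mono) auto
  qed
  have rtv: "rtv_const ?d \<ge> 0" by (simp add: rtv_const_def)
  have "RTV2 (gauss_sum a h X A) \<le> ereal (rtv_const ?d) * ereal (real ?d * (K * R))"
    unfolding RTV2_def using rtv
    by (intro ereal_mult_left_mono SUP_least) (auto intro!: pair)
  then show ?thesis by (simp add: K_def mult.assoc)
qed

lemma gauss_ker_moment:
  assumes B: "B \<ge> 0" "\<And>t. \<bar>gauss_ker d t\<bar> \<le> B / (1 + t\<^sup>2)" and h: "h > 0" and b: "\<bar>b\<bar> \<le> 1"
  shows "integrable lborel (\<lambda>t. (1 + t\<^sup>2) * (gauss_ker d ((t - b) / h))\<^sup>2)" (is "integrable lborel ?f")
    and "(\<integral>t. (1 + t\<^sup>2) * (gauss_ker d ((t - b) / h))\<^sup>2 \<partial>lborel) \<le> h * ((3 + 2 * h\<^sup>2) * B\<^sup>2 * pi)"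
proof -
  define u where "u s = (1 + (b + h * s)\<^sup>2) * (gauss_ker d s)\<^sup>2" for s
  have u: "\<bar>u s\<bar> \<le> ((3 + 2 * h\<^sup>2) * B\<^sup>2) / (1 + s\<^sup>2)" for s
  proof -
    have "(b + h * s)\<^sup>2 \<le> 2 * b\<^sup>2 + 2 * (h * s)\<^sup>2"
      using zero_le_power2[of "b - h * s"] by (simp add: power2_eq_square algebra_simps)
    moreover have "b\<^sup>2 \<le> 1" using b by (simp add: abs_square_le_1)
    ultimately have "1 + (b + h * s)\<^sup>2 \<le> 3 + 2 * (h\<^sup>2 * s\<^sup>2)" by (simp add: power_mult_distrib)
    also have "\<dots> \<le> (3 + 2 * h\<^sup>2) * (1 + s\<^sup>2)" by (simp add: algebra_simps)
    finally have 1: "1 + (b + h * s)\<^sup>2 \<le> (3 + 2 * h\<^sup>2) * (1 + s\<^sup>2)" .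
    have "\<bar>gauss_ker d s\<bar>\<^sup>2 \<le> (B / (1 + s\<^sup>2))\<^sup>2" by (intro power_mono B(2)) auto
    then have "\<bar>u s\<bar> \<le> ((3 + 2 * h\<^sup>2) * (1 + s\<^sup>2)) * (B / (1 + s\<^sup>2))\<^sup>2"
      unfolding u_def abs_mult using 1 by (intro mult_mono) auto
    also have "\<dots> = ((3 + 2 * h\<^sup>2) * B\<^sup>2) / (1 + s\<^sup>2)"
    proof -
      define w where "w = 1 + s\<^sup>2"
      have "w > 0" by (simp add: w_def)
      then show ?thesis unfolding w_def[symmetric] by (simp add: power_divide power2_eq_square)
    qed
    finally show ?thesis .
  qed
  have ui: "integrable lborel u" by (rule integrable_of_decay[OF _ u]) (unfold u_def, measurable)
  have eq: "u (- b / h + (1 / h) * t) = ?f t" for t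
  proof -
    have "- b / h + (1 / h) * t = (t - b) / h" by (simp add: diff_divide_distrib)
    then show ?thesis using h by (simp add: u_def)
  qed
  show "integrable lborel ?f"
    using lborel_integrable_real_affine[OF ui, of "1/h" "- b / h"] h unfolding eq by simp
  have "(\<integral>t. ?f t \<partial>lborel) = h * (\<integral>t. ?f (b + h * t) \<partial>lborel)"
    using lborel_integral_real_affine[of h ?f b] h by simp
  also have "\<dots> = h * (\<integral>t. u t \<partial>lborel)" using h by (simp add: u_def)
  also have "(\<integral>t. u t \<partial>lborel) \<le> (\<integral>t. ((3 + 2 * h\<^sup>2) * B\<^sup>2) * (1 / (1 + t\<^sup>2)) \<partial>lborel)"
  proof (rule integral_mono[OF ui])
    show "u t \<le> ((3 + 2 * h\<^sup>2) * B\<^sup>2) * (1 / (1 + t\<^sup>2))" for t using u[of t] by simp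
  qed (intro integrable_mult_right integrable_inv_one_plus_sq)
  also have "\<dots> = (3 + 2 * h\<^sup>2) * B\<^sup>2 * pi" unfolding integral_mult_right_zero integral_inv_one_plus_sq ..
  finally show "(\<integral>t. ?f t \<partial>lborel) \<le> h * ((3 + 2 * h\<^sup>2) * B\<^sup>2 * pi)" using h by simp
qed

lemma ridge_energy_sum:
  fixes X :: "'a::euclidean_space set"
  assumes B: "B \<ge> 0" "\<And>t. \<bar>gauss_ker DIM('a) t\<bar> \<le> B / (1 + t\<^sup>2)" and h: "h > 0"
    and X: "finite X" "X \<subseteq> cball 0 1" and \<theta>: "\<theta> > 0" "\<theta>\<^sup>2 = real (card X) * (h * (3 + 2 * h\<^sup>2))"
  shows "(\<Sum>A\<in>Pow X. ridge_energy \<theta> h X A) \<le> ennreal (2 ^ card X * (measure lborel (ball (0::'a) 1) * (pi * (1 + B\<^sup>2) / 2) * \<theta>))"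
proof -
  let ?d = "DIM('a)" and ?m = "card X"
  have [measurable]: "ball (0::'a) 1 \<in> sets borel" by auto
  define e where "e A \<gamma> t = (\<theta> / (1 + t\<^sup>2) + (1 + t\<^sup>2) * (ridge_ker h X A \<gamma> t)\<^sup>2 / \<theta>) / 2" for A \<gamma> t
  have e0: "0 \<le> e A \<gamma> t" for A \<gamma> t using \<theta> by (simp add: e_def)
  have em[measurable]: "(\<lambda>(y, t). e A (y /\<^sub>R norm y) t) \<in> borel_measurable (borel \<Otimes>\<^sub>M borel)" for A
    unfolding e_def ridge_ker_def by measurable
  have em'[measurable]: "e A \<gamma> \<in> borel_measurable borel" for A \<gamma>
    unfolding e_def ridge_ker_def by measurable
  have inner: "(\<Sum>A\<in>Pow X. \<integral>\<^sup>+t. ennreal (e A \<gamma> t) \<partial>lborel) \<le> ennreal (2 ^ ?m * ((pi * (1 + B\<^sup>2) / 2) * \<theta>))"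
    if \<gamma>: "norm \<gamma> \<le> 1" for \<gamma>
  proof -
    define k where "k z t = (1 + t\<^sup>2) * (gauss_ker ?d ((t - \<gamma> \<bullet> z) / h))\<^sup>2" for z t
    have bz: "\<bar>\<gamma> \<bullet> z\<bar> \<le> 1" if "z \<in> X" for z
    proof -
      have "\<bar>\<gamma> \<bullet> z\<bar> \<le> norm \<gamma> * norm z" by (rule Cauchy_Schwarz_ineq2)
      also have "\<dots> \<le> 1 * 1" using \<gamma> X(2) that by (intro mult_mono) auto
      finally show ?thesis by simp
    qed
    have ki: "integrable lborel (k z)" if "z \<in> X" for z
      unfolding k_def by (rule gauss_ker_moment(1)[OF B h bz[OF that]])
    have kI: "(\<integral>t. k z t \<partial>lborel) \<le> h * ((3 + 2 * h\<^sup>2) * B\<^sup>2 * pi)" if "z \<in> X" for z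
      unfolding k_def by (rule gauss_ker_moment(2)[OF B h bz[OF that]])
    have se: "(\<Sum>A\<in>Pow X. e A \<gamma> t) = 2 ^ ?m / 2 * (\<theta> * (1 / (1 + t\<^sup>2)) + (1 / \<theta>) * (\<Sum>z\<in>X. k z t))" for t
    proof -
      have "(\<Sum>A\<in>Pow X. e A \<gamma> t) = (\<Sum>A\<in>Pow X. \<theta> / (1 + t\<^sup>2) / 2) + (1 + t\<^sup>2) / \<theta> / 2 * (\<Sum>A\<in>Pow X. (ridge_ker h X A \<gamma> t)\<^sup>2)"
      proof -
        define w where "w = 1 + t\<^sup>2"
        show ?thesis unfolding e_def w_def[symmetric]
          by (simp add: sum.distrib add_divide_distrib sum_distrib_left)
      qed
      also have "(\<Sum>A\<in>Pow X. (ridge_ker h X A \<gamma> t)\<^sup>2) = 2 ^ ?m * (\<Sum>z\<in>X. (gauss_ker ?d ((t - \<gamma> \<bullet> z) / h))\<^sup>2)"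
        unfolding ridge_ker_def by (rule sum_Pow_square[OF X(1)])
      also have "(\<Sum>A\<in>Pow X. \<theta> / (1 + t\<^sup>2) / 2) = 2 ^ ?m * (\<theta> / (1 + t\<^sup>2) / 2)" using X by (simp add: card_Pow)
      finally show ?thesis unfolding k_def sum_distrib_left[symmetric] by (simp add: distrib_left mult_ac)
    qed
    have int: "integrable lborel (\<lambda>t. 2 ^ ?m / 2 * (\<theta> * (1 / (1 + t\<^sup>2)) + (1 / \<theta>) * (\<Sum>z\<in>X. k z t)))"
      using ki by (intro integrable_mult_right Bochner_Integration.integrable_add Bochner_Integration.integrable_sum integrable_inv_one_plus_sq)
    have "(\<Sum>A\<in>Pow X. \<integral>\<^sup>+t. ennreal (e A \<gamma> t) \<partial>lborel) = (\<integral>\<^sup>+t. (\<Sum>A\<in>Pow X. ennreal (e A \<gamma> t)) \<partial>lborel)"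
      by (rule nn_integral_sum[symmetric]) measurable
    also have "\<dots> = (\<integral>\<^sup>+t. ennreal (2 ^ ?m / 2 * (\<theta> * (1 / (1 + t\<^sup>2)) + (1 / \<theta>) * (\<Sum>z\<in>X. k z t))) \<partial>lborel)"
      unfolding se[symmetric] by (simp add: sum_ennreal e0)
    also have "\<dots> = ennreal (\<integral>t. 2 ^ ?m / 2 * (\<theta> * (1 / (1 + t\<^sup>2)) + (1 / \<theta>) * (\<Sum>z\<in>X. k z t)) \<partial>lborel)"
      by (rule nn_integral_eq_integral[OF int]) (rule AE_I2, unfold se[symmetric], intro sum_nonneg e0)
    also have "(\<integral>t. 2 ^ ?m / 2 * (\<theta> * (1 / (1 + t\<^sup>2)) + (1 / \<theta>) * (\<Sum>z\<in>X. k z t)) \<partial>lborel)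
       = 2 ^ ?m / 2 * (\<theta> * pi + (1 / \<theta>) * (\<Sum>z\<in>X. \<integral>t. k z t \<partial>lborel))"
    proof -
      have "(\<integral>t. \<theta> * (1 / (1 + t\<^sup>2)) + (1 / \<theta>) * (\<Sum>z\<in>X. k z t) \<partial>lborel) = \<theta> * pi + (1 / \<theta>) * (\<Sum>z\<in>X. \<integral>t. k z t \<partial>lborel)"
        using ki by (subst Bochner_Integration.integral_add)
          (auto intro!: integrable_mult_right Bochner_Integration.integrable_sum integrable_inv_one_plus_sq
            simp: Bochner_Integration.integral_sum integral_inv_one_plus_sq simp del: times_divide_eq_right divide_divide_eq_left)
      then show ?thesis by (simp only: integral_mult_right_zero)
    qed
    also have "\<dots> \<le> 2 ^ ?m / 2 * (\<theta> * pi + (1 / \<theta>) * (\<Sum>z\<in>X. h * ((3 + 2 * h\<^sup>2) * B\<^sup>2 * pi)))"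
      using \<theta> by (intro mult_left_mono add_left_mono sum_mono kI) auto
    also have "(\<Sum>z\<in>X. h * ((3 + 2 * h\<^sup>2) * B\<^sup>2 * pi)) = \<theta>\<^sup>2 * (B\<^sup>2 * pi)"
      unfolding \<theta>(2) by (simp add: mult_ac)
    also have "2 ^ ?m / 2 * (\<theta> * pi + (1 / \<theta>) * (\<theta>\<^sup>2 * (B\<^sup>2 * pi))) = 2 ^ ?m * ((pi * (1 + B\<^sup>2) / 2) * \<theta>)"
      using \<theta>(1) by (simp add: field_simps power2_eq_square)
    finally show ?thesis by (simp add: ennreal_leI)
  qed
  have "(\<Sum>A\<in>Pow X. ridge_energy \<theta> h X A)
     = (\<integral>\<^sup>+y. (\<Sum>A\<in>Pow X. indicator (ball 0 1) y * (\<integral>\<^sup>+t. ennreal (e A (y /\<^sub>R norm y) t) \<partial>lborel)) \<partial>lborel)"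
    unfolding ridge_energy_def e_def[symmetric] by (rule nn_integral_sum[symmetric]) measurable
  also have "\<dots> \<le> (\<integral>\<^sup>+y. ennreal (2 ^ ?m * ((pi * (1 + B\<^sup>2) / 2) * \<theta>)) * indicator (ball (0::'a) 1) y \<partial>lborel)"
    unfolding sum_distrib_left[symmetric]
  proof (intro nn_integral_mono)
    fix y :: 'a
    have "norm (y /\<^sub>R norm y) \<le> 1" by (cases "y = 0") auto
    from inner[OF this] show "indicator (ball 0 1) y * (\<Sum>A\<in>Pow X. \<integral>\<^sup>+t. ennreal (e A (y /\<^sub>R norm y) t) \<partial>lborel)
      \<le> ennreal (2 ^ ?m * ((pi * (1 + B\<^sup>2) / 2) * \<theta>)) * indicator (ball 0 1) y"
      by (cases "y \<in> ball 0 1") simp_all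
  qed
  also have "\<dots> = ennreal (2 ^ ?m * ((pi * (1 + B\<^sup>2) / 2) * \<theta>)) * emeasure lborel (ball (0::'a) 1)"
    by (rule nn_integral_cmult_indicator) auto
  also have "emeasure lborel (ball (0::'a) 1) = ennreal (measure lborel (ball (0::'a) 1))"
    using emeasure_lborel_ball_finite[of "0::'a" 1] by (intro emeasure_eq_ennreal_measure) auto
  also have "ennreal (2 ^ ?m * ((pi * (1 + B\<^sup>2) / 2) * \<theta>)) * ennreal (measure lborel (ball (0::'a) 1))
     = ennreal (2 ^ ?m * (measure lborel (ball (0::'a) 1) * (pi * (1 + B\<^sup>2) / 2) * \<theta>))"
    using \<theta>(1) by (subst ennreal_mult[symmetric]) (auto simp: mult_ac)
  finally show ?thesis .
qed

theorem gauss_sum_mostly_in_class: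
  "\<exists>\<Gamma>>0. \<forall>(X :: 'a::euclidean_space set) h a C. finite X \<longrightarrow> X \<noteq> {} \<longrightarrow> X \<subseteq> cball 0 1 \<longrightarrow> h > 0 \<longrightarrow> a > 0 \<longrightarrow> C > 0 \<longrightarrow>
     \<Gamma> * a / h\<^sup>2 * sqrt (real (card X) * (h * (3 + 2 * h\<^sup>2))) \<le> C \<longrightarrow>
     4 * card {A \<in> Pow X. \<not> RTV2 (gauss_sum a h X A) \<le> ereal C} \<le> 2 ^ card X"
proof -
  let ?d = "DIM('a)"
  obtain B where B: "B \<ge> 0" "\<And>t. \<bar>gauss_ker ?d t\<bar> \<le> B / (1 + t\<^sup>2)" using gauss_ker_decay by blast
  define G0 where "G0 = rtv_const ?d * real ?d * sqrt (2 * pi) ^ (?d - 1)"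
  define G1 where "G1 = measure lborel (ball (0::'a) 1) * (pi * (1 + B\<^sup>2) / 2)"
  have G0: "G0 > 0" by (simp add: G0_def rtv_const_def)
  have G1: "G1 > 0" using content_ball_pos[of 1 "0::'a"] by (simp add: G1_def add_pos_nonneg)
  show ?thesis
  proof (intro exI[of _ "4 * G0 * G1"] conjI allI impI)
    show "0 < 4 * G0 * G1" using G0 G1 by simp
    fix X :: "'a set" and h a C :: real
    assume X: "finite X" "X \<noteq> {}" "X \<subseteq> cball 0 1" and h: "h > 0" and a: "a > 0" and C: "C > 0"
      and le: "4 * G0 * G1 * a / h\<^sup>2 * sqrt (real (card X) * (h * (3 + 2 * h\<^sup>2))) \<le> C"
    define \<theta> where "\<theta> = sqrt (real (card X) * (h * (3 + 2 * h\<^sup>2)))"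
    have pos: "real (card X) * (h * (3 + 2 * h\<^sup>2)) > 0"
      using X h by (intro mult_pos_pos) (auto simp: card_gt_0_iff add_pos_nonneg)
    have \<theta>: "\<theta> > 0" "\<theta>\<^sup>2 = real (card X) * (h * (3 + 2 * h\<^sup>2))" using pos by (auto simp: \<theta>_def)
    define R where "R = C * h\<^sup>2 / (G0 * a)"
    have R: "R > 0" using C h G0 a by (simp add: R_def)
    define bad where "bad = {A \<in> Pow X. \<not> RTV2 (gauss_sum a h X A) \<le> ereal C}"
    have fb: "finite bad" using X by (simp add: bad_def)
    have badR: "ennreal R \<le> ridge_energy \<theta> h X A" if "A \<in> bad" for A
    proof (rule ccontr)
      assume "\<not> ennreal R \<le> ridge_energy \<theta> h X A"
      then have "RTV2 (gauss_sum a h X A) \<le> ereal (G0 * a / h\<^sup>2 * R)"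
        unfolding G0_def using X h a \<theta> R by (intro RTV2_gauss_sum_le[where \<theta> = \<theta>]) auto
      moreover have "G0 * a / h\<^sup>2 * R = C" using G0 a h by (simp add: R_def)
      ultimately show False using that by (simp add: bad_def)
    qed
    have "ennreal (real (card bad) * R) = (\<Sum>A\<in>bad. ennreal R)"
      using R by (simp add: ennreal_mult ennreal_of_nat_eq_real_of_nat)
    also have "\<dots> \<le> (\<Sum>A\<in>bad. ridge_energy \<theta> h X A)" by (intro sum_mono badR)
    also have "\<dots> \<le> (\<Sum>A\<in>Pow X. ridge_energy \<theta> h X A)" using X by (intro sum_mono2) (auto simp: bad_def)
    also have "\<dots> \<le> ennreal (2 ^ card X * (G1 * \<theta>))"
      unfolding G1_def by (rule ridge_energy_sum[OF B h X(1,3) \<theta>])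
    finally have "real (card bad) * R \<le> 2 ^ card X * (G1 * \<theta>)" using G1 \<theta> by (simp add: ennreal_le_iff)
    moreover have "4 * (G1 * \<theta>) \<le> R"
      using le G0 a h unfolding R_def \<theta>_def[symmetric] by (simp add: field_simps)
    then have "2 ^ card X * (4 * (G1 * \<theta>)) \<le> 2 ^ card X * R" by (rule mult_left_mono) simp
    ultimately have "4 * (real (card bad) * R) \<le> 2 ^ card X * R" by linarith
    then have "4 * real (card bad) \<le> 2 ^ card X" using R by (simp add: mult.assoc[symmetric])
    then have "real (4 * card bad) \<le> real (2 ^ card X)" by simp
    then show "4 * card {A \<in> Pow X. \<not> RTV2 (gauss_sum a h X A) \<le> ereal C} \<le> 2 ^ card X"
      unfolding bad_def[symmetric] by (simp only: of_nat_le_iff)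
  qed
qed

section \<open>Assouad's argument\<close>

lemma assouad:
  fixes r :: "'b set \<Rightarrow> 'b \<Rightarrow> ennreal"
  assumes X: "finite X" and bad: "bad \<subseteq> Pow X" "4 * card bad \<le> 2 ^ card X"
    and pair: "\<And>z A. z \<in> X \<Longrightarrow> A \<subseteq> X - {z} \<Longrightarrow> e \<le> r A z + r (insert z A) z"
    and V: "\<And>A. A \<in> Pow X - bad \<Longrightarrow> (\<Sum>z\<in>X. r A z) \<le> V"
  shows "of_nat (card X) * e \<le> 4 * V"
proof -
  define good where "good = Pow X - bad"
  have fin: "finite good" "finite bad" using X bad by (auto simp: good_def intro: finite_subset)
  define P where "P z = {A \<in> Pow (X - {z}). A \<in> good \<and> insert z A \<in> good}" for z
  have cP: "2 ^ card X \<le> 4 * card (P z)" if z: "z \<in> X" for z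
  proof -
    define f where "f A = (if A \<in> bad then A else insert z A)" for A
    have "card (Pow (X - {z}) - P z) \<le> card bad"
    proof (rule card_inj_on_le[of f])
      show "inj_on f (Pow (X - {z}) - P z)" by (rule inj_onI) (auto simp: f_def split: if_splits)
      show "f ` (Pow (X - {z}) - P z) \<subseteq> bad" using z by (auto simp: f_def P_def good_def)
    qed (rule fin)
    moreover have "card (Pow (X - {z})) = card (P z) + card (Pow (X - {z}) - P z)"
      using X by (subst card_Diff_subset) (auto simp: P_def intro!: finite_subset[of _ "Pow X"] le_add_diff_inverse[symmetric] card_mono)
    moreover have "2 * card (Pow (X - {z})) = 2 ^ card X"
      using X z card_gt_0_iff[of X] by (auto simp: card_Pow card_Diff_singleton simp flip: power_Suc)
    ultimately show ?thesis using bad(2) by linarith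
  qed
  have Pz: "of_nat (card (P z)) * e \<le> (\<Sum>A\<in>good. r A z)" if z: "z \<in> X" for z
  proof -
    have fP: "finite (P z)" using X by (auto simp: P_def)
    have "of_nat (card (P z)) * e = (\<Sum>A\<in>P z. e)" by simp
    also have "\<dots> \<le> (\<Sum>A\<in>P z. r A z + r (insert z A) z)"
      by (intro sum_mono pair z) (auto simp: P_def)
    also have "\<dots> = (\<Sum>A\<in>P z. r A z) + (\<Sum>A\<in>P z. r (insert z A) z)" by (rule sum.distrib)
    also have "(\<Sum>A\<in>P z. r (insert z A) z) = (\<Sum>A\<in>insert z ` P z. r A z)"
      by (subst sum.reindex) (auto simp: P_def inj_on_def)
    also have "(\<Sum>A\<in>P z. r A z) + (\<Sum>A\<in>insert z ` P z. r A z) = (\<Sum>A\<in>P z \<union> insert z ` P z. r A z)"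
      using fP by (intro sum.union_disjoint[symmetric]) (auto simp: P_def)
    also have "\<dots> \<le> (\<Sum>A\<in>good. r A z)"
      using fin by (intro sum_mono2) (auto simp: P_def)
    finally show ?thesis .
  qed
  have "2 ^ card X * (of_nat (card X) * e) = (\<Sum>z\<in>X. of_nat (2 ^ card X) * e)"
    by (simp add: mult_ac)
  also have "\<dots> \<le> (\<Sum>z\<in>X. of_nat (4 * card (P z)) * e)"
    by (intro sum_mono mult_right_mono) (auto simp only: of_nat_le_iff cP zero_le)
  also have "\<dots> = 4 * (\<Sum>z\<in>X. of_nat (card (P z)) * e)"
    by (simp add: sum_distrib_left mult.assoc)
  also have "\<dots> \<le> 4 * (2 ^ card X * V)"
  proof (rule mult_left_mono)
    have "(\<Sum>z\<in>X. of_nat (card (P z)) * e) \<le> (\<Sum>z\<in>X. \<Sum>A\<in>good. r A z)" by (intro sum_mono Pz)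
    also have "\<dots> = (\<Sum>A\<in>good. \<Sum>z\<in>X. r A z)" by (rule sum.swap)
    also have "\<dots> \<le> (\<Sum>A\<in>good. V)" by (intro sum_mono V) (simp add: good_def)
    also have "\<dots> \<le> 2 ^ card X * V"
    proof -
      have "card good \<le> 2 ^ card X" using X by (simp add: good_def card_Pow[symmetric] card_mono)
      then have "(of_nat (card good) :: ennreal) \<le> of_nat (2 ^ card X)" by (simp only: of_nat_le_iff)
      then show ?thesis by (simp add: mult_right_mono)
    qed
    finally show "(\<Sum>z\<in>X. of_nat (card (P z)) * e) \<le> 2 ^ card X * V" .
  qed simp
  also have "4 * (2 ^ card X * V) = 2 ^ card X * (4 * V)" by (simp only: mult_ac)
  finally have "2 ^ card X * (of_nat (card X) * e) \<le> 2 ^ card X * (4 * V)" .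
  moreover have "(2 ^ card X :: ennreal) \<noteq> 0" "(2 ^ card X :: ennreal) \<noteq> \<top>"
    by (auto simp: power_eq_top_ennreal)
  ultimately show ?thesis by (metis ennreal_mult_le_mult_iff)
qed

lemma sum_risk_on_le:
  fixes f :: "'a::euclidean_space \<Rightarrow> real"
  assumes X: "finite X" and Q: "\<And>z. z \<in> X \<Longrightarrow> Q z \<in> sets borel" and disj: "disjoint_family_on Q X"
    and fh: "fh \<in> estimators N" and f[measurable]: "f \<in> borel_measurable borel"
  shows "(\<Sum>z\<in>X. risk_on (Q z) N \<sigma> fh f) \<le> risk N \<sigma> fh f"
proof -
  interpret PX: prob_space "PX :: 'a measure" by (rule prob_space_PX)
  let ?D = "data_law N f \<sigma>"
  have sB: "sets ?D = sets (PiM {..<N} (\<lambda>_. (borel :: 'a measure) \<Otimes>\<^sub>M (borel :: real measure)))"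
    unfolding data_law_def by (intro sets_PiM_cong refl) (simp add: obs_law_def)
  have fm[measurable]: "(\<lambda>p. fh (fst p) (snd p)) \<in> borel_measurable (?D \<Otimes>\<^sub>M borel)"
    using fh unfolding estimators_def measurable_cong_sets[OF sets_pair_measure_cong[OF sB refl] refl] by simp
  have [measurable]: "Q z \<in> sets borel" if "z \<in> X" for z using Q[OF that] .
  have fhD: "fh D \<in> borel_measurable borel" if "D \<in> space ?D" for D
    using measurable_compose[OF measurable_Pair1'[OF that] fm] by simp
  have "(\<Sum>z\<in>X. risk_on (Q z) N \<sigma> fh f) = (\<integral>\<^sup>+D. (\<Sum>z\<in>X. \<integral>\<^sup>+x. ennreal ((f x - fh D x)\<^sup>2) * indicator (Q z) x \<partial>PX) \<partial>?D)"
    unfolding risk_on_def by (rule nn_integral_sum[symmetric]) measurable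
  also have "\<dots> \<le> (\<integral>\<^sup>+D. (\<integral>\<^sup>+x. ennreal ((f x - fh D x)\<^sup>2) \<partial>PX) \<partial>?D)"
  proof (rule nn_integral_mono)
    fix D assume D: "D \<in> space ?D"
    note [measurable] = fhD[OF D]
    have "(\<Sum>z\<in>X. \<integral>\<^sup>+x. ennreal ((f x - fh D x)\<^sup>2) * indicator (Q z) x \<partial>PX) = (\<integral>\<^sup>+x. (\<Sum>z\<in>X. ennreal ((f x - fh D x)\<^sup>2) * indicator (Q z) x) \<partial>PX)"
      by (rule nn_integral_sum[symmetric]) measurable
    also have "\<dots> \<le> (\<integral>\<^sup>+x. ennreal ((f x - fh D x)\<^sup>2) \<partial>PX)"
    proof (rule nn_integral_mono)
      fix x
      have "(\<Sum>z\<in>X. indicator (Q z) x) = (indicator (\<Union>z\<in>X. Q z) x :: ennreal)"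
        by (rule indicator_UN_disjoint[symmetric, OF X disj])
      then show "(\<Sum>z\<in>X. ennreal ((f x - fh D x)\<^sup>2) * indicator (Q z) x) \<le> ennreal ((f x - fh D x)\<^sup>2)"
        unfolding sum_distrib_left[symmetric] by (simp split: split_indicator)
    qed
    finally show "(\<Sum>z\<in>X. \<integral>\<^sup>+x. ennreal ((f x - fh D x)\<^sup>2) * indicator (Q z) x \<partial>PX) \<le> (\<integral>\<^sup>+x. ennreal ((f x - fh D x)\<^sup>2) \<partial>PX)" .
  qed
  finally show ?thesis unfolding risk_def .
qed

lemma gauss_sum_in_class:
  assumes X: "finite X" and R: "RTV2 (gauss_sum a h X A) \<le> ereal C"
  shows "RBV2_ball (gauss_sum a h X A)" "RTV2_ball (gauss_sum a h X A) \<le> ereal C"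
proof -
  have "\<bar>gauss_sum a h X A x\<bar> \<le> (real (card X) * \<bar>a\<bar>) * (1 + norm x)" for x
  proof -
    have "\<bar>gauss_sum a h X A x\<bar> \<le> (\<Sum>z\<in>X. \<bar>set_sgn A z * (a * gauss_bump h z x)\<bar>)"
      unfolding gauss_sum_def by (rule sum_abs)
    also have "\<dots> \<le> (\<Sum>z\<in>X. \<bar>a\<bar>)"
      by (intro sum_mono) (auto simp: set_sgn_def abs_mult gauss_bump_def gauss_pos less_imp_le intro!: mult_left_le gauss_le_1)
    also have "\<dots> = (real (card X) * \<bar>a\<bar>) * 1" by simp
    also have "\<dots> \<le> (real (card X) * \<bar>a\<bar>) * (1 + norm x)" by (intro mult_left_mono) auto
    finally show ?thesis .
  qed
  then have g: "RBV2 (gauss_sum a h X A)"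
    unfolding RBV2_def using R le_less_trans[OF R] by (auto intro!: exI[of _ "real (card X) * \<bar>a\<bar>"])
  then show "RBV2_ball (gauss_sum a h X A)" unfolding RBV2_ball_def by blast
  show "RTV2_ball (gauss_sum a h X A) \<le> ereal C"
    unfolding RTV2_ball_def by (rule INF_lower2[where i = "gauss_sum a h X A"]) (use g R in auto)
qed

lemma gauss_sum_flip:
  assumes "finite X" "z \<in> X" "A \<subseteq> X - {z}"
  shows "gauss_sum a h X A x - gauss_sum a h X (insert z A) x = - (2 * (a * gauss_bump h z x))"
proof -
  have "gauss_sum a h X A x - gauss_sum a h X (insert z A) x
     = (\<Sum>w\<in>X. (set_sgn A w - set_sgn (insert z A) w) * (a * gauss_bump h w x))"
    by (simp add: gauss_sum_def sum_subtractf left_diff_distrib)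
  also have "\<dots> = (\<Sum>w\<in>{z}. (set_sgn A w - set_sgn (insert z A) w) * (a * gauss_bump h w x))"
    using assms by (intro sum.mono_neutral_right) (auto simp: set_sgn_def)
  finally show ?thesis using assms by (auto simp: set_sgn_def)
qed

lemma minimax_risk_ge_gauss_sum:
  fixes X :: "'a::euclidean_space set"
  assumes X: "finite X" and mostly: "4 * card {A \<in> Pow X. \<not> RTV2 (gauss_sum a h X A) \<le> ereal C} \<le> 2 ^ card X"
    and \<sigma>: "\<sigma> > 0" and N: "N \<ge> 1" and e: "e \<ge> 0"
    and Q: "\<And>z. z \<in> X \<Longrightarrow> Q z \<in> sets borel" and disj: "disjoint_family_on Q X"
    and close: "\<And>z. z \<in> X \<Longrightarrow> (\<integral>\<^sup>+x. ennreal ((2 * (a * gauss_bump h z x))\<^sup>2) \<partial>PX) \<le> ennreal (\<sigma>\<^sup>2 / real N)"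
    and sep: "\<And>z. z \<in> X \<Longrightarrow> ennreal e \<le> (\<integral>\<^sup>+x. ennreal ((2 * (a * gauss_bump h z x))\<^sup>2) * indicator (Q z) x \<partial>PX)"
  shows "minimax_risk TYPE('a) N \<sigma> C \<ge> ennreal (real (card X) * e / 32)"
  unfolding minimax_risk_def
proof (rule INF_greatest)
  fix fh :: "(nat \<Rightarrow> 'a \<times> real) \<Rightarrow> 'a \<Rightarrow> real" assume fh: "fh \<in> estimators N"
  define V where "V = (SUP f \<in> {f :: 'a \<Rightarrow> real. RBV2_ball f \<and> RTV2_ball f \<le> ereal C}. risk N \<sigma> fh f)"
  define bad where "bad = {A \<in> Pow X. \<not> RTV2 (gauss_sum a h X A) \<le> ereal C}"
  have "of_nat (card X) * ennreal (1/8 * e) \<le> 4 * V"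
  proof (rule assouad[OF X, where bad = bad and r = "\<lambda>A z. risk_on (Q z) N \<sigma> fh (gauss_sum a h X A)"])
    show "bad \<subseteq> Pow X" by (auto simp: bad_def)
    show "4 * card bad \<le> 2 ^ card X" unfolding bad_def by (rule mostly)
    fix z A assume z: "z \<in> X" and A: "A \<subseteq> X - {z}"
    have sq: "(gauss_sum a h X A x - gauss_sum a h X (insert z A) x)\<^sup>2 = (2 * (a * gauss_bump h z x))\<^sup>2" for x
      unfolding gauss_sum_flip[OF X z A] by simp
    have "ennreal (1/8 * e) = ennreal (1/8) * ennreal e" using e by (intro ennreal_mult) auto
    also have "\<dots> \<le> ennreal (1/8) * (\<integral>\<^sup>+x. ennreal ((2 * (a * gauss_bump h z x))\<^sup>2) * indicator (Q z) x \<partial>PX)"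
      by (intro mult_left_mono sep z) auto
    also have "\<dots> \<le> risk_on (Q z) N \<sigma> fh (gauss_sum a h X A) + risk_on (Q z) N \<sigma> fh (gauss_sum a h X (insert z A))"
      unfolding sq[symmetric]
      by (rule two_point_risk[OF _ _ \<sigma> fh Q[OF z] N]) (use close[OF z] in \<open>simp_all only: sq gauss_sum_measurable\<close>)
    finally show "ennreal (1/8 * e) \<le> risk_on (Q z) N \<sigma> fh (gauss_sum a h X A) + risk_on (Q z) N \<sigma> fh (gauss_sum a h X (insert z A))" .
  next
    fix A assume "A \<in> Pow X - bad"
    then have R: "RTV2 (gauss_sum a h X A) \<le> ereal C" by (auto simp: bad_def)
    have "(\<Sum>z\<in>X. risk_on (Q z) N \<sigma> fh (gauss_sum a h X A)) \<le> risk N \<sigma> fh (gauss_sum a h X A)"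
      by (rule sum_risk_on_le[OF X Q disj fh]) auto
    also have "\<dots> \<le> V" unfolding V_def using gauss_sum_in_class[OF X R] by (intro SUP_upper) auto
    finally show "(\<Sum>z\<in>X. risk_on (Q z) N \<sigma> fh (gauss_sum a h X A)) \<le> V" .
  qed
  moreover have "of_nat (card X) * ennreal (1/8 * e) = 4 * ennreal (real (card X) * e / 32)"
  proof -
    have "of_nat (card X) * ennreal (1/8 * e) = ennreal (real (card X) * (1/8 * e))"
      unfolding ennreal_of_nat_eq_real_of_nat using e by (intro ennreal_mult[symmetric]) auto
    also have "real (card X) * (1/8 * e) = 4 * (real (card X) * e / 32)" by simp
    also have "ennreal \<dots> = ennreal 4 * ennreal (real (card X) * e / 32)" using e by (intro ennreal_mult) auto
    finally show ?thesis by simp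
  qed
  ultimately have "4 * ennreal (real (card X) * e / 32) \<le> 4 * V" by simp
  then show "ennreal (real (card X) * e / 32) \<le> (SUP f \<in> {f. RBV2_ball f \<and> RTV2_ball f \<le> ereal C}. risk N \<sigma> fh f)"
    unfolding V_def[symmetric] by (subst (asm) ennreal_mult_le_mult_iff) auto
qed

section \<open>Choice of the bumps\<close>

lemma nn_integral_PX:
  fixes f :: "'a::euclidean_space \<Rightarrow> ennreal"
  assumes [measurable]: "f \<in> borel_measurable borel"
  shows "(\<integral>\<^sup>+x. f x \<partial>PX) = (\<integral>\<^sup>+x. f x * indicator (cball 0 1) x \<partial>lborel) / emeasure lborel (cball (0::'a) 1)"
  unfolding PX_def by (rule nn_integral_uniform_measure) auto

lemma emeasure_lborel_cball_eq: "emeasure lborel (cball (0::'a::euclidean_space) 1) = ennreal (measure lborel (cball (0::'a) 1))"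
  using emeasure_lborel_cball_finite[of "0::'a" 1] by (intro emeasure_eq_ennreal_measure) auto

lemma measure_cball_pos: "measure lborel (cball (0::'a::euclidean_space) 1) > 0"
  by (rule content_cball_pos) simp

lemma emeasure_PX:
  assumes "Q \<in> sets borel" "Q \<subseteq> cball (0::'a::euclidean_space) 1"
  shows "emeasure PX Q = emeasure lborel Q / emeasure lborel (cball (0::'a) 1)"
  unfolding PX_def using assms by (subst emeasure_uniform_measure) (auto simp: Int_absorb1)

lemma emeasure_PX_ball:
  fixes z :: "'a::euclidean_space"
  assumes h: "h > 0" and sub: "ball z h \<subseteq> cball 0 1"
  shows "emeasure PX (ball z h) = ennreal (h ^ DIM('a))"
proof -
  have b: "emeasure lborel (ball z h) = ennreal (h ^ DIM('a) * measure lborel (cball (0::'a) 1))"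
  proof -
    have "emeasure lborel (ball z h) = ennreal (measure lborel (ball z h))"
      using emeasure_lborel_ball_finite[of z h] by (intro emeasure_eq_ennreal_measure) auto
    also have "measure lborel (ball z h) = h ^ DIM('a) * measure lborel (cball (0::'a) 1)"
      using h by (simp add: content_ball content_cball)
    finally show ?thesis .
  qed
  show ?thesis
    using h measure_cball_pos[where 'a = 'a]
    by (subst emeasure_PX[OF _ sub]) (auto simp: b emeasure_lborel_cball_eq divide_ennreal)
qed

lemma gauss_bump_bounds: "0 \<le> gauss_bump h z x" "gauss_bump h z x \<le> 1"
  by (auto simp: gauss_bump_def gauss_pos less_imp_le gauss_le_1)

lemma gauss_bump_ge:
  assumes "h > 0" "norm (x - z) \<le> h"
  shows "exp (-1) \<le> (gauss_bump h z x)\<^sup>2"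
proof -
  have "norm ((x - z) /\<^sub>R h) = norm (x - z) / h" using assms by (simp add: divide_inverse mult.commute)
  then have n: "norm ((x - z) /\<^sub>R h) \<le> 1" using assms by simp
  have "(gauss_bump h z x)\<^sup>2 = exp (- (norm ((x - z) /\<^sub>R h))\<^sup>2)"
    unfolding gauss_bump_def gauss_def exp_double[symmetric] by simp
  moreover have "(norm ((x - z) /\<^sub>R h))\<^sup>2 \<le> 1" using n by (simp add: power_le_one)
  ultimately show ?thesis by simp
qed

lemma bump_sq_integral_ge:
  fixes z :: "'a::euclidean_space"
  assumes h: "h > 0" and Q: "Q \<in> sets borel" "Q \<subseteq> cball z h" and q: "ennreal q \<le> emeasure PX Q" "q \<ge> 0"
  shows "ennreal (4 * a\<^sup>2 * exp (-1) * q) \<le> (\<integral>\<^sup>+x. ennreal ((2 * (a * gauss_bump h z x))\<^sup>2) * indicator Q x \<partial>PX)"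
proof -
  have "ennreal (4 * a\<^sup>2 * exp (-1) * q) = ennreal (4 * a\<^sup>2 * exp (-1)) * ennreal q" using q by (intro ennreal_mult) auto
  also have "\<dots> \<le> ennreal (4 * a\<^sup>2 * exp (-1)) * emeasure PX Q" by (intro mult_left_mono q) auto
  also have "\<dots> = (\<integral>\<^sup>+x. ennreal (4 * a\<^sup>2 * exp (-1)) * indicator Q x \<partial>PX)"
    using Q by (intro nn_integral_cmult_indicator[symmetric]) auto
  also have "\<dots> \<le> (\<integral>\<^sup>+x. ennreal ((2 * (a * gauss_bump h z x))\<^sup>2) * indicator Q x \<partial>PX)"
  proof (rule nn_integral_mono)
    fix x
    show "ennreal (4 * a\<^sup>2 * exp (-1)) * indicator Q x \<le> ennreal ((2 * (a * gauss_bump h z x))\<^sup>2) * indicator Q x"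
    proof (cases "x \<in> Q")
      case True
      then have "norm (x - z) \<le> h" using Q by (auto simp: dist_norm norm_minus_commute)
      then have "4 * a\<^sup>2 * exp (-1) \<le> 4 * a\<^sup>2 * (gauss_bump h z x)\<^sup>2" by (intro mult_left_mono gauss_bump_ge h) auto
      then show ?thesis using True by (auto simp: power_mult_distrib mult_ac intro!: ennreal_leI)
    qed simp
  qed
  finally show ?thesis .
qed

lemma bump_sq_integral_le:
  fixes z :: "'a::euclidean_space"
  assumes h: "h > 0"
  shows "(\<integral>\<^sup>+x. ennreal ((2 * (a * gauss_bump h z x))\<^sup>2) \<partial>PX)
     \<le> ennreal (4 * a\<^sup>2 * (h ^ DIM('a) * ((\<integral>x. gauss (x::'a) \<partial>lborel) / measure lborel (cball (0::'a) 1))))" (is ?th1)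
    and "(\<integral>\<^sup>+x. ennreal ((2 * (a * gauss_bump h z x))\<^sup>2) \<partial>PX) \<le> ennreal (4 * a\<^sup>2)" (is ?th2)
proof -
  interpret PX: prob_space "PX :: 'a measure" by (rule prob_space_PX)
  have sq: "(2 * (a * gauss_bump h z x))\<^sup>2 \<le> 4 * a\<^sup>2 * gauss_bump h z x" for x
  proof -
    have "(gauss_bump h z x)\<^sup>2 \<le> gauss_bump h z x"
      using gauss_bump_bounds[of h z x] by (simp add: power2_eq_square mult_left_le)
    then have "4 * a\<^sup>2 * (gauss_bump h z x)\<^sup>2 \<le> 4 * a\<^sup>2 * gauss_bump h z x" by (intro mult_left_mono) auto
    then show ?thesis by (simp add: power_mult_distrib mult_ac)
  qed
  have "(\<integral>\<^sup>+x. ennreal ((2 * (a * gauss_bump h z x))\<^sup>2) \<partial>PX) \<le> (\<integral>\<^sup>+x. ennreal (4 * a\<^sup>2) \<partial>(PX :: 'a measure))"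
  proof (intro nn_integral_mono ennreal_leI)
    fix x
    have "4 * a\<^sup>2 * gauss_bump h z x \<le> 4 * a\<^sup>2 * 1" using gauss_bump_bounds by (intro mult_left_mono) auto
    with sq[of x] show "(2 * (a * gauss_bump h z x))\<^sup>2 \<le> 4 * a\<^sup>2" by simp
  qed
  also have "\<dots> = ennreal (4 * a\<^sup>2)" using PX.emeasure_space_1 by simp
  finally show ?th2 .
  let ?v = "measure lborel (cball (0::'a) 1)"
  have I: "(\<integral>x. gauss_bump h z x \<partial>lborel) = h ^ DIM('a) * (\<integral>x. gauss (x::'a) \<partial>lborel)"
  proof -
    have "gauss_bump h z (z + h *\<^sub>R x) = gauss x" for x using h by (simp add: gauss_bump_def)
    then show ?thesis by (subst integral_lborel_affine[OF h, where t = z]) auto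
  qed
  have G0: "0 \<le> (\<integral>x. gauss (x::'a) \<partial>lborel)" by (intro integral_nonneg_AE AE_I2) (simp add: gauss_pos less_imp_le)
  have "(\<integral>\<^sup>+x. ennreal ((2 * (a * gauss_bump h z x))\<^sup>2) \<partial>PX)
     = (\<integral>\<^sup>+x. ennreal ((2 * (a * gauss_bump h z x))\<^sup>2) * indicator (cball 0 1) x \<partial>lborel) / ennreal ?v"
    unfolding emeasure_lborel_cball_eq[symmetric] by (rule nn_integral_PX) measurable
  also have "\<dots> \<le> (\<integral>\<^sup>+x. ennreal (4 * a\<^sup>2 * gauss_bump h z x) \<partial>lborel) / ennreal ?v"
  proof (intro divide_right_mono_ennreal nn_integral_mono)
    fix x
    show "ennreal ((2 * (a * gauss_bump h z x))\<^sup>2) * indicator (cball 0 1) x \<le> ennreal (4 * a\<^sup>2 * gauss_bump h z x)"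
      using ennreal_leI[OF sq[of x]] by (cases "x \<in> cball 0 1") simp_all
  qed
  also have "(\<integral>\<^sup>+x. ennreal (4 * a\<^sup>2 * gauss_bump h z x) \<partial>lborel) = ennreal (4 * a\<^sup>2 * (h ^ DIM('a) * (\<integral>x. gauss (x::'a) \<partial>lborel)))"
    using gauss_bump_bounds integrable_gauss_bump[OF h, of z] by (subst nn_integral_eq_integral) (auto simp: I intro!: AE_I2 mult_nonneg_nonneg)
  also have "\<dots> / ennreal ?v = ennreal (4 * a\<^sup>2 * (h ^ DIM('a) * ((\<integral>x. gauss (x::'a) \<partial>lborel) / ?v)))"
    using measure_cball_pos[where 'a = 'a] h G0 by (subst divide_ennreal) auto
  finally show ?th1 .
qed

lemma grid_packing:
  fixes K :: nat
  assumes K: "K \<ge> 1" and h: "h = 1 / (4 * real DIM('a) * real K)"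
  shows "\<exists>X :: 'a::euclidean_space set. finite X \<and> card X = K ^ DIM('a) \<and> X \<subseteq> cball 0 1 \<and>
     disjoint_family_on (\<lambda>z. ball z h) X \<and> (\<forall>z\<in>X. ball z h \<subseteq> cball 0 1)"
proof -
  let ?d = "DIM('a)"
  have d: "real ?d \<ge> 1" using DIM_positive[where 'a='a] by linarith
  have K1: "real K \<ge> 1" using K by simp
  have h0: "h > 0" using h d K1 by simp
  have hK: "2 * h * real K * real ?d = 1 / 2" using h d K1 by (simp add: field_simps)
  have h4: "h \<le> 1 / 4"
  proof -
    have "4 * 1 * 1 \<le> 4 * real ?d * real K" using d K1 by (intro mult_mono) auto
    then show ?thesis unfolding h by (intro divide_left_mono) auto
  qed
  define I where "I = PiE (Basis :: 'a set) (\<lambda>_. {..<K})"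
  define pt where "pt k = (\<Sum>b\<in>(Basis::'a set). (2 * h * real (k b)) *\<^sub>R b)" for k :: "'a \<Rightarrow> nat"
  have ptb: "pt k \<bullet> b = 2 * h * real (k b)" if "b \<in> Basis" for k b using that by (simp add: pt_def)
  have finI: "finite I" unfolding I_def by (intro finite_PiE) auto
  have far: "2 * h \<le> norm (pt k - pt l)" if kl: "k \<in> I" "l \<in> I" "k \<noteq> l" for k l
  proof -
    obtain b where b: "b \<in> Basis" "k b \<noteq> l b" using kl unfolding I_def by (metis PiE_ext)
    have "2 * h * 1 \<le> 2 * h * \<bar>real (k b) - real (l b)\<bar>"
      using b h0 by (intro mult_left_mono) auto
    also have "\<dots> = \<bar>(pt k - pt l) \<bullet> b\<bar>" using h0 b by (simp add: inner_diff_left ptb abs_mult right_diff_distrib[symmetric])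
    also have "\<dots> \<le> norm (pt k - pt l)" using Basis_le_norm[OF b(1)] .
    finally show ?thesis by simp
  qed
  have inj: "inj_on pt I"
  proof (rule inj_onI, rule ccontr)
    fix k l assume "k \<in> I" "l \<in> I" "pt k = pt l" "k \<noteq> l"
    with far[of k l] h0 show False by simp
  qed
  have nrm: "norm (pt k) \<le> 1 / 2" if k: "k \<in> I" for k
  proof -
    have "norm (pt k) \<le> (\<Sum>b\<in>(Basis::'a set). norm ((2 * h * real (k b)) *\<^sub>R b))" unfolding pt_def by (rule norm_sum)
    also have "\<dots> \<le> (\<Sum>b\<in>(Basis::'a set). 2 * h * real K)"
    proof (rule sum_mono)
      fix b :: 'a assume b: "b \<in> Basis"
      have "k b < K" using k b by (auto simp: I_def)
      then show "norm ((2 * h * real (k b)) *\<^sub>R b) \<le> 2 * h * real K" using b h0 by (simp add: abs_mult)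
    qed
    also have "\<dots> = 1 / 2" using hK by (simp add: mult_ac)
    finally show ?thesis .
  qed
  show ?thesis
  proof (intro exI[of _ "pt ` I"] conjI ballI)
    show "finite (pt ` I)" using finI by simp
    show "card (pt ` I) = K ^ ?d" unfolding card_image[OF inj] by (simp add: I_def card_PiE)
    show "pt ` I \<subseteq> cball 0 1" using nrm by fastforce
    show "disjoint_family_on (\<lambda>z. ball z h) (pt ` I)" unfolding disjoint_family_on_def
    proof (intro ballI impI)
      fix x y assume "x \<in> pt ` I" "y \<in> pt ` I" "x \<noteq> y"
      then have "2 * h \<le> dist x y" using far by (auto simp: dist_norm)
      then show "ball x h \<inter> ball y h = {}" using disjoint_ballI[of h h x y] by simp
    qed
    fix z assume "z \<in> pt ` I"
    then have "norm z \<le> 1 / 2" using nrm by auto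
    then show "ball z h \<subseteq> cball 0 1"
    proof (intro subsetI)
      fix x assume "x \<in> ball z h"
      then have "norm (x - z) < h" by (simp add: dist_norm norm_minus_commute)
      then show "x \<in> cball 0 1" using \<open>norm z \<le> 1 / 2\<close> h4 norm_triangle_ineq[of "x - z" z] by simp
    qed
  qed
qed

theorem theorem6:
  fixes C :: real
  assumes "C > 0"
  shows "\<exists>c>0. \<forall>\<sigma>>0. \<forall>N::nat. N \<ge> 1 \<longrightarrow>
           minimax_risk TYPE('a::euclidean_space) N \<sigma> C \<ge>
           ennreal (c * (real N / \<sigma>\<^sup>2) powr
             (- (real DIM('a) + 3) / (2 * real DIM('a) + 3)))"
proof -
  let ?d = "DIM('a)"
  have d: "real ?d \<ge> 1" using DIM_positive[where 'a='a] by linarith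
  obtain \<Gamma> where \<Gamma>: "\<Gamma> > 0" and mostly0: "\<forall>(X :: 'a set) h a C. finite X \<longrightarrow> X \<noteq> {} \<longrightarrow> X \<subseteq> cball 0 1 \<longrightarrow> h > 0 \<longrightarrow> a > 0 \<longrightarrow> C > 0 \<longrightarrow>
     \<Gamma> * a / h\<^sup>2 * sqrt (real (card X) * (h * (3 + 2 * h\<^sup>2))) \<le> C \<longrightarrow>
     4 * card {A \<in> Pow X. \<not> RTV2 (gauss_sum a h X A) \<le> ereal C} \<le> 2 ^ card X"
    using gauss_sum_mostly_in_class[where 'a = 'a] by (elim exE conjE)
  note mostly = mostly0[rule_format, OF _ _ _ _ _ assms]
  define W where "W = (\<integral>x. gauss (x::'a) \<partial>lborel) / measure lborel (cball (0::'a) 1)"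
  have W0: "W \<ge> 0" unfolding W_def
    by (intro divide_nonneg_nonneg integral_nonneg_AE AE_I2) (simp_all add: gauss_pos less_imp_le)
  define s where "s = (real ?d + 3) / (2 * real ?d + 3)"
  have s: "0 < s" "s \<le> 1" using d by (auto simp: s_def)
  define a0 where "a0 = min (C / (3 * \<Gamma>)) (min 1 (1 / (4 * (W + 1))))"
  have a0: "a0 > 0" "a0 \<le> C / (3 * \<Gamma>)" "a0 \<le> 1" "a0 \<le> 1 / (4 * (W + 1))"
  proof -
    have "0 < C / (3 * \<Gamma>)" "0 < 1 / (4 * (W + 1))" using assms \<Gamma> W0 by simp_all
    then show "a0 > 0" "a0 \<le> C / (3 * \<Gamma>)" "a0 \<le> 1" "a0 \<le> 1 / (4 * (W + 1))"
      unfolding a0_def by linarith+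
  qed
  define D where "D = 1 / (4 * real ?d)"
  have D: "D > 0" "D \<le> 1"
  proof -
    have "1 \<le> 4 * real ?d" using d by linarith
    then show "D > 0" "D \<le> 1" unfolding D_def by (auto simp: divide_le_eq)
  qed
  define c1 where "c1 = D ^ ?d * (4 * a0\<^sup>2 * exp (-1)) / 32 * (D / 2) ^ (?d + 3)"
  define c2 where "c2 = exp (-1) / (32 :: real)"
  have c: "c1 > 0" "c2 > 0" using D a0 by (auto simp: c1_def c2_def)
  show ?thesis
  proof (intro exI[of _ "min c1 c2"] conjI allI impI)
    show "min c1 c2 > 0" using c by simp
    fix \<sigma> :: real and N :: nat assume \<sigma>: "\<sigma> > 0" and N: "N \<ge> 1"
    define T where "T = real N / \<sigma>\<^sup>2"
    have T: "T > 0" using \<sigma> N by (simp add: T_def)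
    have T': "\<sigma>\<^sup>2 / real N = 1 / T" by (simp add: T_def)
    have ex: "- (real ?d + 3) / (2 * real ?d + 3) = - s" by (simp only: s_def minus_divide_left)
    show "minimax_risk TYPE('a) N \<sigma> C \<ge> ennreal (min c1 c2 * (real N / \<sigma>\<^sup>2) powr (- (real ?d + 3) / (2 * real ?d + 3)))"
      unfolding T_def[symmetric] ex
    proof (cases "T \<ge> 1")
      case True
      define t where "t = T powr (1 / (2 * real ?d + 3))"
      have t1: "t \<ge> 1" unfolding t_def using True by (intro ge_one_powr_ge_zero) auto
      have tn: "t ^ n = T powr (real n / (2 * real ?d + 3))" for n
      proof -
        have "t ^ n = t powr real n" using t1 by (simp add: powr_realpow)
        also have "\<dots> = T powr (1 / (2 * real ?d + 3) * real n)" unfolding t_def by (rule powr_powr)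
        finally show ?thesis by simp
      qed
      have tp: "t ^ (2 * ?d + 3) = T"
      proof -
        have "real (2 * ?d + 3) / (2 * real ?d + 3) = 1" using d by (subst divide_eq_1_iff) auto
        then show ?thesis unfolding tn using T by simp
      qed
      define K where "K = nat \<lceil>t\<rceil>"
      have K: "K \<ge> 1" "t \<le> real K" "real K \<le> 2 * t"
      proof -
        have "real K = of_int \<lceil>t\<rceil>" unfolding K_def using t1 by simp
        then show "t \<le> real K" "real K \<le> 2 * t" using t1 ceiling_correct[of t] by auto
        then show "K \<ge> 1" using t1 by linarith
      qed
      define h where "h = D / real K"
      have hdef: "h = 1 / (4 * real ?d * real K)" by (simp add: h_def D_def)
      have h: "h > 0" "h \<le> 1" "h \<le> 1 / t" "h \<ge> D / 2 / t" and hK: "h * real K = D"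
      proof -
        show "h > 0" using D K by (simp add: h_def)
        show "h * real K = D" using K by (simp add: h_def)
        have "h \<le> 1 / t" unfolding h_def using D K t1 by (intro frac_le) auto
        then show "h \<le> 1 / t" .
        also have "1 / t \<le> 1" using t1 by simp
        finally show "h \<le> 1" .
        have "D / (2 * t) \<le> D / real K" using D K t1 by (intro divide_left_mono) auto
        then show "h \<ge> D / 2 / t" by (simp add: h_def)
      qed
      obtain X :: "'a set" where X: "finite X" "card X = K ^ ?d" "X \<subseteq> cball 0 1"
        "disjoint_family_on (\<lambda>z. ball z h) X" "\<And>z. z \<in> X \<Longrightarrow> ball z h \<subseteq> cball 0 1"
        using grid_packing[OF K(1) hdef] by blast
      have Xne: "X \<noteq> {}" using X(2) K by auto
      define a where "a = a0 * sqrt (h ^ (?d + 3))"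
      have a: "a > 0" using a0 h by (simp add: a_def)
      have a2: "a\<^sup>2 = a0\<^sup>2 * h ^ (?d + 3)" using h by (simp add: a_def power_mult_distrib)
      have m: "4 * card {A \<in> Pow X. \<not> RTV2 (gauss_sum a h X A) \<le> ereal C} \<le> 2 ^ card X"
      proof (rule mostly[OF X(1) Xne X(3) h(1) a])
        have "sqrt (h ^ (?d + 3)) * sqrt (real (card X) * (h * (3 + 2 * h\<^sup>2))) = sqrt (h ^ (?d + 3) * (real (card X) * (h * (3 + 2 * h\<^sup>2))))"
          by (simp only: real_sqrt_mult)
        also have "h ^ (?d + 3) * (real (card X) * (h * (3 + 2 * h\<^sup>2))) = h ^ 4 * (D ^ ?d * (3 + 2 * h\<^sup>2))"
          unfolding X(2) hK[symmetric] by (simp add: power_mult_distrib power_add power4_eq_xxxx power3_eq_cube mult_ac)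
        also have "sqrt \<dots> \<le> sqrt (h ^ 4 * 9)"
        proof -
          have "h\<^sup>2 \<le> 1" using h by (simp add: power_le_one)
          then have "D ^ ?d * (3 + 2 * h\<^sup>2) \<le> 1 * 9" using D by (intro mult_mono power_le_one) auto
          then show ?thesis using h by (intro real_sqrt_le_mono mult_left_mono) auto
        qed
        also have "\<dots> = 3 * h\<^sup>2"
        proof (rule real_sqrt_unique)
          show "(3 * h\<^sup>2)\<^sup>2 = h ^ 4 * 9" by (simp add: power_mult_distrib)
        qed simp
        finally have *: "sqrt (h ^ (?d + 3)) * sqrt (real (card X) * (h * (3 + 2 * h\<^sup>2))) \<le> 3 * h\<^sup>2" .
        have "\<Gamma> * a / h\<^sup>2 * sqrt (real (card X) * (h * (3 + 2 * h\<^sup>2)))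
           = \<Gamma> * a0 / h\<^sup>2 * (sqrt (h ^ (?d + 3)) * sqrt (real (card X) * (h * (3 + 2 * h\<^sup>2))))" by (simp add: a_def)
        also have "\<dots> \<le> \<Gamma> * a0 / h\<^sup>2 * (3 * h\<^sup>2)" using * \<Gamma> a0 h by (intro mult_left_mono) auto
        also have "\<dots> = 3 * \<Gamma> * a0" using h by simp
        also have "\<dots> \<le> C" using a0(2) \<Gamma> by (simp add: field_simps)
        finally show "\<Gamma> * a / h\<^sup>2 * sqrt (real (card X) * (h * (3 + 2 * h\<^sup>2))) \<le> C" .
      qed
      have close: "4 * a\<^sup>2 * (h ^ ?d * W) \<le> 1 / T"
      proof -
        have "a0\<^sup>2 \<le> a0" using a0 by (simp add: power2_eq_square mult_left_le)
        then have "a0\<^sup>2 * W \<le> a0 * (W + 1)" by (rule mult_mono) (use W0 a0 in auto)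
        moreover have "a0 * (W + 1) \<le> 1 / (4 * (W + 1)) * (W + 1)" by (rule mult_right_mono[OF a0(4)]) (use W0 in simp)
        moreover have "1 / (4 * (W + 1)) * (W + 1) = 1 / 4" using W0 by simp
        ultimately have 1: "4 * a0\<^sup>2 * W \<le> 1" by linarith
        have "h ^ (2 * ?d + 3) \<le> (1 / t) ^ (2 * ?d + 3)" by (rule power_mono[OF h(3) less_imp_le[OF h(1)]])
        also have "\<dots> = 1 / T" unfolding power_one_over tp ..
        finally have 2: "h ^ (2 * ?d + 3) \<le> 1 / T" .
        have "4 * a\<^sup>2 * (h ^ ?d * W) = (4 * a0\<^sup>2 * W) * h ^ (2 * ?d + 3)"
        proof -
          have "h ^ (2 * ?d + 3) = h ^ (?d + 3) * h ^ ?d"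
            unfolding power_add[symmetric] by (rule arg_cong[where f = "(^) h"]) simp
          then show ?thesis unfolding a2 by (simp only: mult_ac)
        qed
        also have "\<dots> \<le> 1 * (1 / T)"
          by (rule mult_mono[OF 1 2]) (use h(1) in simp_all)
        finally show ?thesis by simp
      qed
      have "ennreal (real (card X) * (4 * a\<^sup>2 * exp (-1) * h ^ ?d) / 32) \<le> minimax_risk TYPE('a) N \<sigma> C"
      proof (rule minimax_risk_ge_gauss_sum[OF X(1) m \<sigma> N])
        show "0 \<le> 4 * a\<^sup>2 * exp (-1) * h ^ ?d" using h by simp
        show "disjoint_family_on (\<lambda>z. ball z h) X" by (rule X)
        fix z assume z: "z \<in> X"
        show "ball z h \<in> sets borel" by simp
        show "(\<integral>\<^sup>+x. ennreal ((2 * (a * gauss_bump h z x))\<^sup>2) \<partial>PX) \<le> ennreal (\<sigma>\<^sup>2 / real N)"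
          unfolding T' by (rule order_trans[OF bump_sq_integral_le(1)[OF h(1)] ennreal_leI[OF close[unfolded W_def]]])
        show "ennreal (4 * a\<^sup>2 * exp (-1) * h ^ ?d) \<le> (\<integral>\<^sup>+x. ennreal ((2 * (a * gauss_bump h z x))\<^sup>2) * indicator (ball z h) x \<partial>PX)"
        proof (rule bump_sq_integral_ge[OF h(1)])
          show "ennreal (h ^ ?d) \<le> emeasure PX (ball z h)"
            by (rule eq_refl, rule emeasure_PX_ball[OF h(1) X(5)[OF z], symmetric])
          show "0 \<le> h ^ ?d" using h by simp
        qed (simp_all add: ball_subset_cball)
      qed
      moreover have "min c1 c2 * T powr (- s) \<le> real (card X) * (4 * a\<^sup>2 * exp (-1) * h ^ ?d) / 32"
      proof -
        have ts: "T powr (- s) = (1 / t) ^ (?d + 3)"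
        proof -
          have "t ^ (?d + 3) = T powr s" unfolding tn by (simp add: s_def)
          then show ?thesis by (simp add: powr_minus_divide power_one_over)
        qed
        have "min c1 c2 * T powr (- s) \<le> c1 * (1 / t) ^ (?d + 3)"
          unfolding ts using t1 by (intro mult_right_mono) auto
        also have "\<dots> = D ^ ?d * (4 * a0\<^sup>2 * exp (-1)) / 32 * (D / 2 / t) ^ (?d + 3)"
          by (simp add: c1_def power_divide)
        also have "\<dots> \<le> D ^ ?d * (4 * a0\<^sup>2 * exp (-1)) / 32 * h ^ (?d + 3)"
          using h D t1 by (intro mult_left_mono power_mono) auto
        also have "\<dots> = real (card X) * (4 * a\<^sup>2 * exp (-1) * h ^ ?d) / 32"
          unfolding a2 X(2) hK[symmetric] by (simp add: power_mult_distrib mult_ac)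
        finally show ?thesis .
      qed
      ultimately show "ennreal (min c1 c2 * T powr (- s)) \<le> minimax_risk TYPE('a) N \<sigma> C"
        by (rule order_trans[OF ennreal_leI, rotated])
    next
      case False
      define a where "a = 1 / (2 * sqrt T)"
      have a: "a > 0" using T by (simp add: a_def)
      have a2: "4 * a\<^sup>2 = 1 / T" using T by (simp add: a_def power_divide power_mult_distrib)
      define h where "h = max 1 (5 * (\<Gamma> * a / C)\<^sup>2)"
      have h: "h \<ge> 1" "h \<ge> 5 * (\<Gamma> * a / C)\<^sup>2" by (auto simp: h_def)
      let ?X = "{0 :: 'a}"
      have m: "4 * card {A \<in> Pow ?X. \<not> RTV2 (gauss_sum a h ?X A) \<le> ereal C} \<le> 2 ^ card ?X"
      proof (rule mostly)
        have "sqrt (real (card ?X) * (h * (3 + 2 * h\<^sup>2))) \<le> sqrt (h ^ 4 * (5 / h))"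
        proof (rule real_sqrt_le_mono)
          have "3 + 2 * h\<^sup>2 \<le> 5 * h\<^sup>2" using h by (simp add: one_le_power)
          then have "h * (3 + 2 * h\<^sup>2) \<le> h * (5 * h\<^sup>2)" using h by (intro mult_left_mono) auto
          then show "real (card ?X) * (h * (3 + 2 * h\<^sup>2)) \<le> h ^ 4 * (5 / h)"
            using h by (simp add: power2_eq_square power4_eq_xxxx)
        qed
        also have "\<dots> = h\<^sup>2 * sqrt (5 / h)"
        proof -
          have "sqrt (h ^ 4) = h\<^sup>2" by (rule real_sqrt_unique) (auto simp flip: power_mult)
          then show ?thesis by (simp only: real_sqrt_mult[of "h ^ 4" "5 / h"])
        qed
        finally have "\<Gamma> * a / h\<^sup>2 * sqrt (real (card ?X) * (h * (3 + 2 * h\<^sup>2))) \<le> \<Gamma> * a / h\<^sup>2 * (h\<^sup>2 * sqrt (5 / h))"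
          using \<Gamma> a by (intro mult_left_mono) auto
        also have "\<dots> = \<Gamma> * a * sqrt (5 / h)" using h by simp
        also have "\<dots> \<le> C"
        proof (rule power2_le_imp_le)
          have "5 * (\<Gamma> * a)\<^sup>2 \<le> h * C\<^sup>2" using h(2) assms by (simp add: power_divide field_simps)
          then show "(\<Gamma> * a * sqrt (5 / h))\<^sup>2 \<le> C\<^sup>2" using h by (simp add: power_mult_distrib field_simps)
        qed (use assms in auto)
        finally show "\<Gamma> * a / h\<^sup>2 * sqrt (real (card ?X) * (h * (3 + 2 * h\<^sup>2))) \<le> C" .
      qed (use h a in auto)
      interpret PX: prob_space "PX :: 'a measure" by (rule prob_space_PX)
      have PXc: "emeasure PX (cball (0::'a) 1) = 1"
        using emeasure_cball_neq[where 'a = 'a] by (subst emeasure_PX) (auto simp: ennreal_divide_self less_top)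
      have "ennreal (real (card ?X) * (4 * a\<^sup>2 * exp (-1) * 1) / 32) \<le> minimax_risk TYPE('a) N \<sigma> C"
      proof (rule minimax_risk_ge_gauss_sum[OF _ m \<sigma> N, where Q = "\<lambda>_. cball 0 1"])
        fix z :: 'a assume z: "z \<in> ?X"
        show "(\<integral>\<^sup>+x. ennreal ((2 * (a * gauss_bump h z x))\<^sup>2) \<partial>PX) \<le> ennreal (\<sigma>\<^sup>2 / real N)"
          unfolding T' a2[symmetric] using h by (intro bump_sq_integral_le(2)) auto
        show "ennreal (4 * a\<^sup>2 * exp (-1) * 1) \<le> (\<integral>\<^sup>+x. ennreal ((2 * (a * gauss_bump h z x))\<^sup>2) * indicator (cball 0 1) x \<partial>PX)"
          by (rule bump_sq_integral_ge) (use h z PXc in auto)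
      qed (auto simp: disjoint_family_on_def)
      moreover have "min c1 c2 * T powr (- s) \<le> real (card ?X) * (4 * a\<^sup>2 * exp (-1) * 1) / 32"
      proof -
        have "T powr (- s) \<le> T powr (- 1)" using False T s by (intro powr_mono') auto
        also have "\<dots> = 1 / T" using T by (simp add: powr_minus_divide)
        finally have "min c1 c2 * T powr (- s) \<le> c2 * (1 / T)" using c by (intro mult_mono) auto
        then show ?thesis unfolding a2 by (simp add: c2_def mult_ac)
      qed
      ultimately show "ennreal (min c1 c2 * T powr (- s)) \<le> minimax_risk TYPE('a) N \<sigma> C"
        by (rule order_trans[OF ennreal_leI, rotated])
    qed
  qed
qed

end
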